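(* The group algebra $kD_n$ is of finite representation type. If $n=p^st$ is odd, then $kD_n$ has exactly $\frac{t+3}{2}p^s$ indecomposable modules up to isomorphism. If $n=p^st$ is even, then $kD_n$ has exactly $\frac{t+6}{2}p^s$ indecomposable modules up to isomorphism.
   Context: $k$ is an algebraically closed field of odd characteristic $p$; $n=p^st$ with $s\geqslant 1$ and $p\nmid t$. $D_n=\langle a,b\mid a^n=1,\ b^2=1,\ (ab)^2=1\rangle$ is the dihedral group of order $2n$. All modules are left modules, finite dimensional over $k$. An algebra is of finite representation type if it has only finitely many isomorphism classes of finite dimensional indecomposable modules. *)

theory Defs
  imports "HOL-Algebra.AbelCoset" "HOL-Algebra.Module" "HOL-Computational_Algebra.Polynomial"
begin

text \<open>
  A group word over a set \<^typ>\<open>'x\<close> of generators is a list of letters; \<open>(x, True)\<close>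
  stands for \<open>x\<close> and \<open>(x, False)\<close> for its inverse.
\<close>

type_synonym 'x group_word = "('x \<times> bool) list"

inductive word_eq :: "'x group_word set \<Rightarrow> 'x group_word \<Rightarrow> 'x group_word \<Rightarrow> bool"
  for rels :: "'x group_word set" where
  refl: "word_eq rels u u"
| sym: "word_eq rels u v \<Longrightarrow> word_eq rels v u"
| trans: "word_eq rels u v \<Longrightarrow> word_eq rels v w \<Longrightarrow> word_eq rels u w"
| cancel: "word_eq rels (u @ [(x, e), (x, \<not> e)] @ v) (u @ v)"
| relator: "r \<in> rels \<Longrightarrow> word_eq rels (u @ r @ v) (u @ v)"

definition presented_group :: "'x group_word set \<Rightarrow> 'x group_word set monoid" where
  "presented_group rels =
    \<lparr>carrier = UNIV // {(u, v). word_eq rels u v},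
     monoid.mult = (\<lambda>X Y. {w. \<exists>u\<in>X. \<exists>v\<in>Y. word_eq rels (u @ v) w}),
     one = {w. word_eq rels [] w}\<rparr>"

lemma word_eq_ctxt: "word_eq rels u v \<Longrightarrow> word_eq rels (x @ u @ y) (x @ v @ y)"
proof (induction rule: word_eq.induct)
  case (cancel u z e v)
  show ?case using word_eq.cancel[of rels "x @ u" z e "v @ y"] by simp
next
  case (relator r u v)
  then show ?case using word_eq.relator[of r rels "x @ u" "v @ y"] by simp
qed (blast intro: word_eq.intros)+

lemma word_eq_append:
  "word_eq rels u u' \<Longrightarrow> word_eq rels v v' \<Longrightarrow> word_eq rels (u @ v) (u' @ v')"
  using word_eq_ctxt[of rels u u' "[]" v] word_eq_ctxt[of rels v v' u' "[]"]
  by (auto intro: word_eq.trans)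

lemma word_eq_class_eq:
  "{w. word_eq rels u w} = {w. word_eq rels v w} \<longleftrightarrow> word_eq rels u v"
  by (blast intro: word_eq.intros)

lemma presented_group_mult:
  "{w. word_eq rels u w} \<otimes>\<^bsub>presented_group rels\<^esub> {w. word_eq rels v w} = {w. word_eq rels (u @ v) w}"
  unfolding presented_group_def
  by (auto intro: word_eq.trans word_eq_append word_eq.refl)

lemma presented_group_carrier:
  "carrier (presented_group rels) = range (\<lambda>u. {w. word_eq rels u w})"
  by (auto simp: presented_group_def quotient_def)

lemma word_eq_inverse: "\<exists>v. word_eq rels (v @ u) []"
proof (induction u)
  case (Cons l u)
  obtain x e where l: "l = (x, e)" by force
  from Cons obtain v where "word_eq rels (v @ u) []" by blast
  moreover have "word_eq rels (v @ [(x, \<not> e), (x, \<not> \<not> e)] @ u) (v @ u)" by (rule word_eq.cancel)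
  ultimately show ?case
    by (intro exI[of _ "v @ [(x, \<not> e)]"]) (auto simp: l intro: word_eq.trans)
qed (auto intro: exI[of _ "[]"] word_eq.refl)

lemma group_presented_group: "group (presented_group rels)"
proof (rule groupI)
  have one: "\<one>\<^bsub>presented_group rels\<^esub> = {w. word_eq rels [] w}"
    by (simp add: presented_group_def)
  then show "\<one>\<^bsub>presented_group rels\<^esub> \<in> carrier (presented_group rels)"
    by (auto simp: presented_group_carrier)
  show "\<one>\<^bsub>presented_group rels\<^esub> \<otimes>\<^bsub>presented_group rels\<^esub> x = x"
    if "x \<in> carrier (presented_group rels)" for x
    using that by (auto simp: presented_group_carrier one presented_group_mult simp del: Collect_mem_eq)
  show "\<exists>y\<in>carrier (presented_group rels). y \<otimes>\<^bsub>presented_group rels\<^esub> x = \<one>\<^bsub>presented_group rels\<^esub>"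
    if x: "x \<in> carrier (presented_group rels)" for x
  proof -
    obtain u where u: "x = {w. word_eq rels u w}" using x by (auto simp: presented_group_carrier)
    obtain v where v: "word_eq rels (v @ u) []" using word_eq_inverse by blast
    show ?thesis unfolding u one
      by (rule bexI[of _ "{w. word_eq rels v w}"])
         (use v in \<open>auto simp: presented_group_mult word_eq_class_eq presented_group_carrier\<close>)
  qed
qed (auto simp: presented_group_carrier presented_group_mult)

datatype dihedral_gen = a | b

hide_const (open) a b

definition dihedral_group :: "nat \<Rightarrow> dihedral_gen group_word set monoid" where
  "dihedral_group n =
    (let a = (dihedral_gen.a, True); b = (dihedral_gen.b, True)
     in presented_group {replicate n a, [b, b], [a, b, a, b]})"

definition group_algebra :: "('g, 'm) monoid_scheme \<Rightarrow> ('g \<Rightarrow> 'k::field) ring" where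
  "group_algebra G =
    \<lparr>carrier = {f. finite {x. f x \<noteq> 0} \<and> {x. f x \<noteq> 0} \<subseteq> carrier G},
     monoid.mult = (\<lambda>f g x. \<Sum>y | f y \<noteq> 0. \<Sum>z | g z \<noteq> 0.
        if y \<otimes>\<^bsub>G\<^esub> z = x then f y * g z else 0),
     one = (\<lambda>x. if x = \<one>\<^bsub>G\<^esub> then 1 else 0),
     zero = (\<lambda>x. 0),
     add = (\<lambda>f g x. f x + g x)\<rparr>"

definition group_algebra_of_field :: "('g, 'm) monoid_scheme \<Rightarrow> 'k::field \<Rightarrow> 'g \<Rightarrow> 'k" where
  "group_algebra_of_field G c = (\<lambda>x. if x = \<one>\<^bsub>G\<^esub> then c else 0)"

text \<open>
  The locale \<^locale>\<open>module\<close> requires a commutative ring. The axioms are the same here;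
  the fields \<open>mult\<close> and \<open>one\<close> of the record \<open>M\<close> play no role.
\<close>

locale left_module = R?: ring A + M?: abelian_group M
  for A (structure) and M :: "('a, 'v, 'c) module_scheme" (structure) +
  assumes smult_closed [simp, intro]:
      "\<lbrakk>r \<in> carrier A; x \<in> carrier M\<rbrakk> \<Longrightarrow> r \<odot>\<^bsub>M\<^esub> x \<in> carrier M"
    and smult_l_distr:
      "\<lbrakk>r \<in> carrier A; q \<in> carrier A; x \<in> carrier M\<rbrakk> \<Longrightarrow>
        (r \<oplus>\<^bsub>A\<^esub> q) \<odot>\<^bsub>M\<^esub> x = r \<odot>\<^bsub>M\<^esub> x \<oplus>\<^bsub>M\<^esub> q \<odot>\<^bsub>M\<^esub> x"
    and smult_r_distr:
      "\<lbrakk>r \<in> carrier A; x \<in> carrier M; y \<in> carrier M\<rbrakk> \<Longrightarrow>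
        r \<odot>\<^bsub>M\<^esub> (x \<oplus>\<^bsub>M\<^esub> y) = r \<odot>\<^bsub>M\<^esub> x \<oplus>\<^bsub>M\<^esub> r \<odot>\<^bsub>M\<^esub> y"
    and smult_assoc1:
      "\<lbrakk>r \<in> carrier A; q \<in> carrier A; x \<in> carrier M\<rbrakk> \<Longrightarrow>
        (r \<otimes>\<^bsub>A\<^esub> q) \<odot>\<^bsub>M\<^esub> x = r \<odot>\<^bsub>M\<^esub> (q \<odot>\<^bsub>M\<^esub> x)"
    and smult_one [simp]: "x \<in> carrier M \<Longrightarrow> \<one>\<^bsub>A\<^esub> \<odot>\<^bsub>M\<^esub> x = x"

definition module_isomorphic ::
    "('a, 'r) ring_scheme \<Rightarrow> ('a, 'v, 'c) module_scheme \<Rightarrow> ('a, 'w, 'd) module_scheme \<Rightarrow> bool" where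
  "module_isomorphic A M N \<longleftrightarrow>
    (\<exists>h \<in> iso (add_monoid M) (add_monoid N).
      \<forall>r \<in> carrier A. \<forall>x \<in> carrier M. h (r \<odot>\<^bsub>M\<^esub> x) = r \<odot>\<^bsub>N\<^esub> h x)"

definition indecomposable_module ::
    "('a, 'r) ring_scheme \<Rightarrow> ('a, 'v, 'c) module_scheme \<Rightarrow> bool" where
  "indecomposable_module A M \<longleftrightarrow>
    left_module A M \<and> carrier M \<noteq> {\<zero>\<^bsub>M\<^esub>} \<and>
    (\<forall>U V. submodule U A M \<and> submodule V A M \<and>
       U <+>\<^bsub>M\<^esub> V = carrier M \<and> U \<inter> V = {\<zero>\<^bsub>M\<^esub>} \<longrightarrow> U = {\<zero>\<^bsub>M\<^esub>} \<or> V = {\<zero>\<^bsub>M\<^esub>})"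

text \<open>
  From here on, a \<open>k\<close>-algebra is given by a ring \<open>A\<close> and the structure map
  \<open>\<eta> : k \<rightarrow> A\<close>, through which \<open>k\<close> acts on every \<open>A\<close>-module.
\<close>

definition fd_module ::
    "('k::field \<Rightarrow> 'a) \<Rightarrow> ('a, 'r) ring_scheme \<Rightarrow> ('a, 'v, 'c) module_scheme \<Rightarrow> bool" where
  "fd_module \<eta> A M \<longleftrightarrow>
    left_module A M \<and>
    (\<exists>B. finite B \<and> B \<subseteq> carrier M \<and>
      (\<forall>x \<in> carrier M. \<exists>c. x = (\<Oplus>\<^bsub>M\<^esub>v\<in>B. \<eta> (c v) \<odot>\<^bsub>M\<^esub> v)))"

text \<open>
  To speak of the collection of all finite dimensional modules, a type for the underlying
  sets has to be fixed. With \<^typ>\<open>'k list\<close> nothing is lost: by the lemma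
  \<open>fd_module_copy\<close> below, every finite dimensional module, on whatever type, is isomorphic
  to one whose underlying set is a set of lists over \<open>k\<close>.
\<close>

definition fd_indecomposables ::
    "('k::field \<Rightarrow> 'a) \<Rightarrow> ('a, 'r) ring_scheme \<Rightarrow> ('a, 'k list) module set" where
  "fd_indecomposables \<eta> A = {M. fd_module \<eta> A M \<and> indecomposable_module A M}"

definition indecomposable_classes ::
    "('k::field \<Rightarrow> 'a) \<Rightarrow> ('a, 'r) ring_scheme \<Rightarrow> ('a, 'k list) module set set" where
  "indecomposable_classes \<eta> A =
    fd_indecomposables \<eta> A //
      {(M, N) \<in> fd_indecomposables \<eta> A \<times> fd_indecomposables \<eta> A. module_isomorphic A M N}"

definition finite_representation_type ::
    "('k::field \<Rightarrow> 'a) \<Rightarrow> ('a, 'r) ring_scheme \<Rightarrow> bool" where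
  "finite_representation_type \<eta> A \<longleftrightarrow> finite (indecomposable_classes \<eta> A)"

lemma module_copy:
  fixes M :: "('a, 'v, 'c) module_scheme" and f :: "'v \<Rightarrow> 'w"
  assumes M: "left_module A M" and f: "inj_on f (carrier M)"
  shows "\<exists>N :: ('a, 'w) module. left_module A N \<and> f \<in> iso (add_monoid M) (add_monoid N) \<and>
      (\<forall>r \<in> carrier A. \<forall>x \<in> carrier M. f (r \<odot>\<^bsub>M\<^esub> x) = r \<odot>\<^bsub>N\<^esub> f x)"
proof -
  interpret left_module A M by fact
  define g where "g = inv_into (carrier M) f"
  have g [simp]: "g (f x) = x" if "x \<in> carrier M" for x
    using f that by (simp add: g_def)
  define N :: "('a, 'w) module" where
    "N = \<lparr>carrier = f ` carrier M, monoid.mult = undefined, one = undefined, zero = f \<zero>\<^bsub>M\<^esub>,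
          add = (\<lambda>x y. f (g x \<oplus>\<^bsub>M\<^esub> g y)), module.smult = (\<lambda>r x. f (r \<odot>\<^bsub>M\<^esub> g x))\<rparr>"
  have "abelian_group N"
  proof (rule abelian_groupI)
    fix x assume "x \<in> carrier N"
    then obtain y where "y \<in> carrier M" "x = f y" by (auto simp: N_def)
    then show "\<exists>z\<in>carrier N. z \<oplus>\<^bsub>N\<^esub> x = \<zero>\<^bsub>N\<^esub>"
      by (intro bexI[of _ "f (\<ominus>\<^bsub>M\<^esub> y)"]) (auto simp: N_def M.l_neg)
  qed (auto simp: N_def M.a_ac)
  then have "left_module A N"
    by (intro left_module.intro left_module_axioms.intro R.ring_axioms)
       (auto simp: N_def smult_l_distr smult_r_distr smult_assoc1)
  moreover have "f \<in> iso (add_monoid M) (add_monoid N)"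
    using f by (auto simp: N_def iso_def hom_def bij_betw_def)
  ultimately show ?thesis
    by (intro exI[of _ N]) (auto simp: N_def)
qed

lemma fd_module_copy:
  fixes M :: "('a, 'v, 'c) module_scheme" and \<eta> :: "'k::field \<Rightarrow> 'a"
  assumes M: "fd_module \<eta> A M" and \<eta>: "range \<eta> \<subseteq> carrier A"
  shows "\<exists>N :: ('a, 'k list) module. fd_module \<eta> A N \<and> module_isomorphic A M N"
proof -
  obtain B where B: "finite B" "B \<subseteq> carrier M"
    and span: "\<forall>x \<in> carrier M. \<exists>c. x = (\<Oplus>\<^bsub>M\<^esub>v\<in>B. \<eta> (c v) \<odot>\<^bsub>M\<^esub> v)"
    and lm: "left_module A M"
    using M by (auto simp: fd_module_def)
  interpret left_module A M by fact
  obtain c where c: "\<And>x. x \<in> carrier M \<Longrightarrow> x = (\<Oplus>\<^bsub>M\<^esub>v\<in>B. \<eta> (c x v) \<odot>\<^bsub>M\<^esub> v)"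
    using span by metis
  obtain bs where bs: "set bs = B" using B(1) finite_list by blast
  define f where "f x = map (c x) bs" for x
  have cl: "(\<lambda>v. \<eta> (d v) \<odot>\<^bsub>M\<^esub> v) \<in> B \<rightarrow> carrier M" for d
    using B(2) \<eta> by (auto intro!: smult_closed)
  have inj: "inj_on f (carrier M)"
  proof (rule inj_onI)
    fix x y assume xy: "x \<in> carrier M" "y \<in> carrier M" "f x = f y"
    then have "\<forall>v\<in>B. c x v = c y v" by (simp add: f_def bs)
    then have "(\<Oplus>\<^bsub>M\<^esub>v\<in>B. \<eta> (c x v) \<odot>\<^bsub>M\<^esub> v) = (\<Oplus>\<^bsub>M\<^esub>v\<in>B. \<eta> (c y v) \<odot>\<^bsub>M\<^esub> v)"
      using cl by (intro M.finsum_cong') auto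
    then show "x = y" using c xy by metis
  qed
  obtain N :: "('a, 'k list) module" where N: "left_module A N"
    and f: "f \<in> iso (add_monoid M) (add_monoid N)"
    and lin: "\<And>r x. r \<in> carrier A \<Longrightarrow> x \<in> carrier M \<Longrightarrow> f (r \<odot>\<^bsub>M\<^esub> x) = r \<odot>\<^bsub>N\<^esub> f x"
    using module_copy[OF lm inj] by blast
  interpret N: left_module A N by fact
  have bij: "bij_betw f (carrier M) (carrier N)"
    and hom: "\<And>x y. x \<in> carrier M \<Longrightarrow> y \<in> carrier M \<Longrightarrow> f (x \<oplus>\<^bsub>M\<^esub> y) = f x \<oplus>\<^bsub>N\<^esub> f y"
    using f by (auto simp: iso_def hom_def)
  have fcl: "f x \<in> carrier N" if "x \<in> carrier M" for x
    using bij that bij_betwE by blast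
  have f0: "f \<zero>\<^bsub>M\<^esub> = \<zero>\<^bsub>N\<^esub>"
    using hom[of "\<zero>\<^bsub>M\<^esub>" "\<zero>\<^bsub>M\<^esub>"] fcl[of "\<zero>\<^bsub>M\<^esub>"] by (simp add: N.M.add.r_cancel_one')
  have fsum: "f (finsum M h S) = finsum N (\<lambda>v. f (h v)) S"
    if "finite S" "h \<in> S \<rightarrow> carrier M" for h and S :: "'v set"
    using that
  proof (induction S)
    case (insert v S)
    then have "(\<lambda>v. f (h v)) \<in> S \<rightarrow> carrier N" "h \<in> S \<rightarrow> carrier M" "h v \<in> carrier M"
      using fcl by (auto simp: Pi_iff)
    with insert show ?case by (simp add: hom fcl)
  qed (simp add: f0)
  have injB: "inj_on f B" using inj B(2) by (rule inj_on_subset)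
  have "\<exists>d. y = (\<Oplus>\<^bsub>N\<^esub>v\<in>f ` B. \<eta> (d v) \<odot>\<^bsub>N\<^esub> v)" if "y \<in> carrier N" for y
  proof -
    obtain x where x: "x \<in> carrier M" "y = f x" using bij \<open>y \<in> carrier N\<close>
      by (auto simp: bij_betw_def)
    define d where "d w = c x (inv_into B f w)" for w
    have d: "d (f v) = c x v" if "v \<in> B" for v
      using injB that by (simp add: d_def)
    have ncl: "(\<lambda>w. \<eta> (d w) \<odot>\<^bsub>N\<^esub> w) \<in> f ` B \<rightarrow> carrier N"
      using B(2) \<eta> fcl by (auto intro!: N.smult_closed)
    have "y = f (\<Oplus>\<^bsub>M\<^esub>v\<in>B. \<eta> (c x v) \<odot>\<^bsub>M\<^esub> v)" using c x by metis
    also have "\<dots> = (\<Oplus>\<^bsub>N\<^esub>v\<in>B. f (\<eta> (c x v) \<odot>\<^bsub>M\<^esub> v))"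
      by (rule fsum[OF B(1) cl])
    also have "\<dots> = (\<Oplus>\<^bsub>N\<^esub>v\<in>B. \<eta> (d (f v)) \<odot>\<^bsub>N\<^esub> f v)"
    proof (rule N.M.finsum_cong')
      show "(\<lambda>v. \<eta> (d (f v)) \<odot>\<^bsub>N\<^esub> f v) \<in> B \<rightarrow> carrier N" using ncl by auto
      show "f (\<eta> (c x v) \<odot>\<^bsub>M\<^esub> v) = \<eta> (d (f v)) \<odot>\<^bsub>N\<^esub> f v" if "v \<in> B" for v
        using that \<eta> B(2) by (subst lin) (auto simp: d)
    qed simp
    also have "\<dots> = (\<Oplus>\<^bsub>N\<^esub>w\<in>f ` B. \<eta> (d w) \<odot>\<^bsub>N\<^esub> w)"
      by (rule N.M.finsum_reindex[OF ncl injB, symmetric])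
    finally show ?thesis by blast
  qed
  moreover have "f ` B \<subseteq> carrier N" using fcl B(2) by auto
  ultimately have "fd_module \<eta> A N" using N B(1) unfolding fd_module_def by blast
  moreover have "module_isomorphic A M N"
    unfolding module_isomorphic_def using f lin by blast
  ultimately show ?thesis by blast
qed

end

theory Submission
  imports Defs
begin

text \<open>
  Write \<open>q = p^s\<close>, so that \<open>n = qt\<close>, and \<open>u = X^t - 1\<close>. A module over \<open>kD\<^sub>n\<close> is a
  \<open>k[X]\<close>-module, on which \<open>X\<close> acts as \<open>a\<close>, together with an involution \<open>b\<close> that
  intertwines \<open>X\<close> with \<open>1/X\<close>. In characteristic \<open>p\<close> one has \<open>X^n - 1 = u^q\<close>, and
  \<open>u\<close> has \<open>t\<close> distinct roots. So \<open>u\<close> is nilpotent; it generates a two-sided ideal, and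
  modulo this ideal one gets the semisimple algebra \<open>kD\<^sub>t\<close>. Its simple modules belong to the
  pairs \<open>{\<zeta>, 1/\<zeta>}\<close> of distinct \<open>t\<close>-th roots of unity and to the pairs \<open>(\<zeta>, \<epsilon>)\<close>
  with \<open>\<zeta>^2 = 1\<close> and a sign \<open>\<epsilon>\<close>, the eigenvalue of \<open>b\<close>.

  The indecomposable modules are the cyclic modules with a simple top; up to isomorphism there is
  one for each simple module and each Loewy length from \<open>1\<close> to \<open>q\<close>. To see this, let
  \<open>V\<close> be a nonzero module, and let \<open>l\<close> be largest with \<open>u^l V \<noteq> 0\<close>. Projecting to
  primary components and to eigenspaces of \<open>b\<close>, one finds a \<open>v\<close> with
  \<open>u^l v \<noteq> 0\<close> that lies in a single primary component and, if \<open>\<zeta>^2 = 1\<close> there, is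
  an eigenvector of \<open>b\<close> (\<open>homogeneous_component\<close>). The submodule generated by \<open>v\<close> is local
  (\<open>homogeneous_local\<close>), and, as its Loewy length is the largest possible in \<open>V\<close>, it is a direct
  summand (\<open>cyclic_complement\<close>). So an indecomposable \<open>V\<close> is generated by \<open>v\<close>. The
  annihilator of \<open>v\<close> can be read off from the label \<open>(\<zeta>, \<epsilon>, l)\<close>
  (\<open>generator_annihilator\<close>), so the label determines \<open>V\<close>; conversely \<open>V\<close> determines the
  label up to exchanging \<open>\<zeta>\<close> and \<open>1/\<zeta>\<close> (\<open>generator_unique\<close>). Local modules are
  indecomposable (\<open>generator_indecomposable\<close>), and all labels occur in the regular module
  (\<open>generator_exists\<close>).

  Among the \<open>t\<close> roots of unity there are \<open>e = 1\<close> or \<open>e = 2\<close> with \<open>\<zeta>^2 = 1\<close>, according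
  to the parity of \<open>t\<close>, which is that of \<open>n\<close>. This makes \<open>2e + (t - e)/2\<close> simple modules
  and \<open>q (t + 3e)/2\<close> indecomposable ones.

  The argument uses only that the algebra is spanned by the \<open>f(a) + g(a) b\<close> with the dihedral
  relations, and, for the existence of all labels, that it has dimension \<open>2n\<close>. It is carried
  out in the locales \<open>dihedral_algebra\<close> and \<open>free_dihedral_algebra\<close>.
\<close>

section \<open>Roots of unity in positive characteristic\<close>

lemma poly_freshman:
  fixes f g :: "'k::field poly"
  assumes "prime CHAR('k)"
  shows "(f + g) ^ (CHAR('k) ^ s) = f ^ (CHAR('k) ^ s) + g ^ (CHAR('k) ^ s)"
  by (rule freshmans_dream'[where n = s]) (use assms in auto)

lemma poly_freshman_diff:
  fixes f g :: "'k::field poly"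
  assumes "prime CHAR('k)"
  shows "(f - g) ^ (CHAR('k) ^ s) = f ^ (CHAR('k) ^ s) - g ^ (CHAR('k) ^ s)"
  using poly_freshman[OF assms, of "f - g" g s] by (simp add: algebra_simps)

definition unity_poly :: "nat \<Rightarrow> 'k::field poly" where
  "unity_poly t = monom 1 t - 1"

lemma poly_unity_poly [simp]: "poly (unity_poly t) x = x ^ t - 1"
  by (simp add: unity_poly_def poly_monom)

lemma unity_poly_nonzero: "t > 0 \<Longrightarrow> unity_poly t \<noteq> (0 :: 'k::field poly)"
  by (auto simp: unity_poly_def monom_eq_1_iff)

lemma degree_unity_poly: "degree (unity_poly t :: 'k::field poly) = t"
proof (cases "t = 0")
  case False
  have "degree (monom 1 t + (- 1) :: 'k poly) = degree (monom 1 t :: 'k poly)"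
    by (rule degree_add_eq_left) (use False in \<open>simp add: degree_monom_eq\<close>)
  then show ?thesis by (simp add: unity_poly_def degree_monom_eq)
qed (simp add: unity_poly_def)

lemma unity_poly_frobenius:
  assumes "prime CHAR('k::field)"
  shows "(unity_poly t :: 'k poly) ^ (CHAR('k) ^ s) = unity_poly (CHAR('k) ^ s * t)"
  unfolding unity_poly_def by (simp add: poly_freshman_diff[OF assms] monom_power mult.commute)

text \<open>
  Since \<open>t\<close> is invertible in the field, the derivative \<open>t X^(t-1)\<close> does not vanish at a
  root of unity, so every root of \<open>X^t - 1\<close> is simple.
\<close>
lemma unity_poly_simple_root:
  fixes \<zeta> :: "'k::field"
  assumes "\<not> CHAR('k) dvd t" "\<zeta> ^ t = 1"
  obtains f where "unity_poly t = [:-\<zeta>, 1:] * f" "poly f \<zeta> \<noteq> 0"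
proof -
  have t: "t > 0" using assms(1) by (cases t) auto
  have "poly (unity_poly t) \<zeta> = 0" using assms by simp
  then obtain f where f: "unity_poly t = [:-\<zeta>, 1:] * f"
    unfolding poly_eq_0_iff_dvd by (elim dvdE)
  have "pderiv (unity_poly t) = monom (of_nat t :: 'k) (t - 1)"
    by (simp add: unity_poly_def pderiv_diff pderiv_monom)
  then have "poly (pderiv (unity_poly t)) \<zeta> = of_nat t * \<zeta> ^ (t - 1)"
    by (simp add: poly_monom)
  moreover have "poly (pderiv (unity_poly t)) \<zeta> = poly f \<zeta>"
    unfolding f by (simp only: pderiv_mult) (simp add: pderiv_pCons)
  moreover have "\<zeta> \<noteq> 0" using assms t by (auto simp: power_0_left)
  ultimately have "poly f \<zeta> \<noteq> 0" using assms(1) by (simp add: of_nat_eq_0_iff_char_dvd)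
  with f show ?thesis by (rule that)
qed

lemma prod_linear_dvd:
  fixes f :: "'k::field poly"
  assumes "finite S" "\<And>x. x \<in> S \<Longrightarrow> poly f x = 0"
  shows "(\<Prod>x\<in>S. [:-x, 1:]) dvd f"
  using assms
proof (induction S)
  case (insert y S)
  then obtain g where g: "f = (\<Prod>x\<in>S. [:-x, 1:]) * g" by (auto elim: dvdE)
  have "poly (\<Prod>x\<in>S. [:-x, 1:]) y \<noteq> 0"
    using insert.hyps by (auto simp: poly_prod)
  with insert.prems[of y] have "poly g y = 0" by (simp add: g)
  then have "[:-y, 1:] dvd g" by (simp add: poly_eq_0_iff_dvd)
  then show ?case using insert.hyps by (simp add: g mult.commute mult_dvd_mono del: mult_pCons_left)
qed simp

definition unity_roots :: "nat \<Rightarrow> 'k::field set" where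
  "unity_roots t = {\<zeta>. \<zeta> ^ t = 1}"

lemma finite_unity_roots: "t > 0 \<Longrightarrow> finite (unity_roots t :: 'k::field set)"
  using poly_roots_finite[OF unity_poly_nonzero, of t] by (simp add: unity_roots_def)

lemma degree_prod_linear: "degree (\<Prod>x\<in>S. [:-x, 1:] :: 'k::field poly) = card S"
  by (subst degree_prod_eq_sum_degree) auto

lemma unity_poly_splits:
  assumes "\<not> CHAR('k::alg_closed_field) dvd t"
  shows "unity_poly t = (\<Prod>\<zeta>\<in>unity_roots t. [:-\<zeta>, 1:] :: 'k poly)"
proof -
  have t: "t > 0" using assms by (cases t) auto
  let ?P = "\<Prod>\<zeta>\<in>unity_roots t. [:-\<zeta>, 1:] :: 'k poly"
  have fin: "finite (unity_roots t :: 'k set)" by (rule finite_unity_roots[OF t])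
  have "?P dvd unity_poly t"
    by (rule prod_linear_dvd[OF fin]) (simp add: unity_roots_def)
  then obtain g where g: "unity_poly t = ?P * g" by (elim dvdE)
  have "poly g x \<noteq> 0" for x
  proof
    assume gx: "poly g x = 0"
    then have "x ^ t - 1 = 0" using arg_cong[OF g, of "\<lambda>f. poly f x"] by simp
    then have x: "x ^ t = 1" by simp
    obtain f where f: "unity_poly t = [:-x, 1:] * f" "poly f x \<noteq> 0"
      using unity_poly_simple_root[OF assms x] .
    have "[:-x, 1:] dvd ?P" using fin x by (intro dvd_prodI) (auto simp: unity_roots_def)
    moreover have "[:-x, 1:] dvd g" using gx by (simp add: poly_eq_0_iff_dvd)
    ultimately have "[:-x, 1:] * [:-x, 1:] dvd [:-x, 1:] * f"
      using f g mult_dvd_mono by metis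
    then have "[:-x, 1:] dvd f" by (subst (asm) dvd_mult_cancel_left) auto
    with f(2) show False by (simp add: poly_eq_0_iff_dvd)
  qed
  then have "degree g = 0" using alg_closed_imp_poly_has_root[of g] by blast
  then obtain d where d: "g = [:d:]" by (elim degree_eq_zeroE)
  have "lead_coeff (unity_poly t :: 'k poly) = 1"
    using t by (simp add: degree_unity_poly) (simp add: unity_poly_def)
  moreover have "lead_coeff ?P = 1"
    by (simp add: lead_coeff_prod)
  ultimately have "lead_coeff g = 1" using g by (metis lead_coeff_mult mult_1)
  with d have "d = 1" by simp
  with g d show ?thesis by simp
qed

lemma card_unity_roots:
  assumes "\<not> CHAR('k::alg_closed_field) dvd t"
  shows "card (unity_roots t :: 'k set) = t"
  using arg_cong[OF unity_poly_splits[OF assms], of degree]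
  by (simp add: degree_unity_poly degree_prod_linear del: One_nat_def)

text \<open>
  Lagrange interpolation of the constant \<open>1\<close>: these are the primitive idempotents of
  \<open>k[X]/(X^t - 1)\<close>.
\<close>
lemma lagrange_unity:
  assumes "\<not> CHAR('k::alg_closed_field) dvd t"
  obtains l :: "'k::alg_closed_field \<Rightarrow> 'k poly" where
    "(\<Sum>\<zeta>\<in>unity_roots t. l \<zeta>) = 1"
    "\<And>\<zeta>. \<zeta> \<in> unity_roots t \<Longrightarrow> unity_poly t dvd [:-\<zeta>, 1:] * l \<zeta>"
    "\<And>\<zeta>. \<zeta> \<in> unity_roots t \<Longrightarrow> poly (l \<zeta>) \<zeta> = 1"
proof -
  have t: "t > 0" using assms by (cases t) auto
  let ?T = "unity_roots t :: 'k set"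
  have fin: "finite ?T" by (rule finite_unity_roots[OF t])
  define d where "d \<zeta> = (\<Prod>\<mu>\<in>?T - {\<zeta>}. \<zeta> - \<mu>)" for \<zeta>
  define l where "l \<zeta> = Polynomial.smult (1 / d \<zeta>) (\<Prod>\<mu>\<in>?T - {\<zeta>}. [:-\<mu>, 1:])" for \<zeta>
  have d0: "d \<zeta> \<noteq> 0" for \<zeta> using fin by (auto simp: d_def)
  have self: "poly (l \<zeta>) \<zeta> = 1" for \<zeta>
    using d0[of \<zeta>] by (simp add: l_def poly_prod d_def)
  have other: "poly (l \<zeta>) \<mu> = 0" if "\<mu> \<in> ?T" "\<mu> \<noteq> \<zeta>" for \<zeta> \<mu>
    using that fin by (auto simp: l_def poly_prod)
  have "(\<Sum>\<zeta>\<in>?T. l \<zeta>) = 1"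
  proof (rule poly_eqI_degree[of ?T])
    fix \<mu> assume \<mu>: "\<mu> \<in> ?T"
    have "poly (\<Sum>\<zeta>\<in>?T. l \<zeta>) \<mu> = (\<Sum>\<zeta>\<in>?T. if \<zeta> = \<mu> then 1 else 0)"
      using \<mu> by (auto simp: poly_sum self other intro!: sum.cong)
    also have "\<dots> = 1" using \<mu> fin by simp
    finally show "poly (\<Sum>\<zeta>\<in>?T. l \<zeta>) \<mu> = poly 1 \<mu>" by simp
  next
    have "degree (l \<zeta>) < t" if "\<zeta> \<in> ?T" for \<zeta>
    proof -
      have "degree (l \<zeta>) = card (?T - {\<zeta>})" using d0[of \<zeta>] by (simp add: l_def degree_prod_linear)
      also have "\<dots> < card ?T" using that fin by (intro psubset_card_mono) auto
      finally show ?thesis by (simp add: card_unity_roots[OF assms])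
    qed
    then show "degree (\<Sum>\<zeta>\<in>?T. l \<zeta>) < card ?T"
      unfolding card_unity_roots[OF assms]
      by (intro degree_sum_less) (use t in auto)
  next
    show "degree (1 :: 'k poly) < card ?T" using t by (simp add: card_unity_roots[OF assms])
  qed
  moreover have "unity_poly t dvd [:-\<zeta>, 1:] * l \<zeta>" if "\<zeta> \<in> ?T" for \<zeta>
  proof -
    have "[:-\<zeta>, 1:] * l \<zeta> = Polynomial.smult (1 / d \<zeta>) ([:-\<zeta>, 1:] * (\<Prod>\<mu>\<in>?T - {\<zeta>}. [:-\<mu>, 1:]))"
      unfolding l_def by (rule mult_smult_right)
    also have "[:-\<zeta>, 1:] * (\<Prod>\<mu>\<in>?T - {\<zeta>}. [:-\<mu>, 1:]) = unity_poly t"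
      unfolding unity_poly_splits[OF assms] using prod.remove[OF fin that] by metis
    finally show ?thesis by (simp add: dvd_smult)
  qed
  ultimately show ?thesis using self by (intro that[of l]) auto
qed

section \<open>Algebras with dihedral relations\<close>

text \<open>
  Modulo \<open>(X - \<zeta>)^q\<close>, with \<open>q\<close> a power of the characteristic, \<open>f^q\<close> is the constant
  \<open>f(\<zeta>)^q\<close>. Hence \<open>f^(q-1) / f(\<zeta>)^q\<close> is an inverse of \<open>f\<close>.
\<close>
lemma poly_local_inverse:
  fixes f :: "'k::field poly"
  assumes "prime CHAR('k)" "poly f \<zeta> \<noteq> 0"
  obtains g where "[:-\<zeta>, 1:] ^ (CHAR('k) ^ s) dvd g * f - 1"
proof -
  let ?q = "CHAR('k) ^ s"
  have q: "?q > 0" using assms(1) by (simp add: prime_gt_0_nat)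
  define d where "d = poly f \<zeta>"
  have d: "d \<noteq> 0" using assms(2) by (simp add: d_def)
  have "poly (f - [:d:]) \<zeta> = 0" by (simp add: d_def)
  then obtain h where "f - [:d:] = [:-\<zeta>, 1:] * h"
    unfolding poly_eq_0_iff_dvd by (elim dvdE)
  then have f: "f = [:d:] + [:-\<zeta>, 1:] * h" by (simp add: algebra_simps)
  define g where "g = Polynomial.smult (1 / d ^ ?q) (f ^ (?q - 1))"
  have "f ^ ?q = [:d:] ^ ?q + [:-\<zeta>, 1:] ^ ?q * h ^ ?q"
    unfolding power_mult_distrib[symmetric] by (subst f) (rule poly_freshman[OF assms(1)])
  moreover have "[:d:] ^ ?q = [:d ^ ?q:]" by (simp add: poly_const_pow)
  moreover have "g * f = Polynomial.smult (1 / d ^ ?q) (f ^ ?q)"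
    using power_minus_mult[OF q, of f] by (simp add: g_def)
  ultimately have "g * f - 1 = [:-\<zeta>, 1:] ^ ?q * Polynomial.smult (1 / d ^ ?q) (h ^ ?q)"
    using d by (simp add: smult_add_right)
  then show ?thesis by (intro that[of g]) (metis dvd_triv_left)
qed

locale algebra_over_field = ring A for A (structure) +
  fixes \<eta> :: "'k::field \<Rightarrow> 'a"
  assumes scalar_closed [simp, intro]: "\<eta> c \<in> carrier A"
    and scalar_add: "\<eta> (c + d) = \<eta> c \<oplus> \<eta> d"
    and scalar_mult: "\<eta> (c * d) = \<eta> c \<otimes> \<eta> d"
    and scalar_one [simp]: "\<eta> 1 = \<one>"
    and scalar_central: "r \<in> carrier A \<Longrightarrow> \<eta> c \<otimes> r = r \<otimes> \<eta> c"
begin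

lemma scalar_zero [simp]: "\<eta> 0 = \<zero>"
  using scalar_add[of 0 0] by (simp add: add.r_cancel_one')

definition poly_at :: "'a \<Rightarrow> 'k poly \<Rightarrow> 'a" where
  "poly_at r f = fold_coeffs (\<lambda>c x. \<eta> c \<oplus> r \<otimes> x) f \<zero>"

lemma poly_at_0 [simp]: "poly_at r 0 = \<zero>"
  by (simp add: poly_at_def)

lemma poly_at_pCons [simp]:
  "r \<in> carrier A \<Longrightarrow> poly_at r (pCons c f) = \<eta> c \<oplus> r \<otimes> poly_at r f"
  by (cases "c = 0 \<and> f = 0") (auto simp: poly_at_def)

lemma poly_at_closed [simp, intro]: "r \<in> carrier A \<Longrightarrow> poly_at r f \<in> carrier A"
  by (induction f) auto

lemma poly_at_add:
  assumes [simp]: "r \<in> carrier A"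
  shows "poly_at r (f + g) = poly_at r f \<oplus> poly_at r g"
proof (induction f g rule: poly_induct2)
  case (pCons c f d g)
  then show ?case by (simp add: scalar_add r_distr a_ac)
qed simp

lemma poly_at_smult:
  assumes [simp]: "r \<in> carrier A"
  shows "poly_at r (Polynomial.smult c f) = \<eta> c \<otimes> poly_at r f"
proof (induction f)
  case (pCons d f)
  have "r \<otimes> (\<eta> c \<otimes> poly_at r f) = \<eta> c \<otimes> (r \<otimes> poly_at r f)"
    using scalar_central[of r c] by (simp add: m_assoc[symmetric])
  with pCons show ?case by (simp add: scalar_mult r_distr)
qed simp

lemma poly_at_mult:
  assumes [simp]: "r \<in> carrier A"
  shows "poly_at r (f * g) = poly_at r f \<otimes> poly_at r g"
  by (induction f) (auto simp: poly_at_add poly_at_smult l_distr m_assoc)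

lemma poly_at_1 [simp]: "r \<in> carrier A \<Longrightarrow> poly_at r 1 = \<one>"
  by (simp add: one_pCons)

lemma poly_at_uminus:
  assumes [simp]: "r \<in> carrier A"
  shows "poly_at r (- f) = \<ominus> poly_at r f"
  using poly_at_add[of r "- f" f] by (simp add: minus_equality)

lemma poly_at_diff: "r \<in> carrier A \<Longrightarrow> poly_at r (f - g) = poly_at r f \<ominus> poly_at r g"
  using poly_at_add[of r f "- g"] by (simp add: poly_at_uminus minus_eq)

lemma poly_at_monom: "r \<in> carrier A \<Longrightarrow> poly_at r (monom c i) = \<eta> c \<otimes> r [^] i"
proof (induction i)
  case (Suc i)
  have "poly_at r (monom c (Suc i)) = r \<otimes> (\<eta> c \<otimes> r [^] i)"
    using Suc by (simp add: monom_Suc)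
  also have "\<dots> = \<eta> c \<otimes> (r \<otimes> r [^] i)"
    using Suc.prems scalar_central[of r c] by (simp add: m_assoc[symmetric])
  finally show ?case using nat_pow_Suc2[OF Suc.prems, of i] by simp
qed (simp add: monom_0)

end

lemma (in Group.monoid) nat_pow_mod_order:
  fixes i m :: nat
  assumes x: "x \<in> carrier G" "x [^] m = \<one>"
  shows "x [^] i = x [^] (i mod m)"
proof -
  have "x [^] i = x [^] (m * (i div m)) \<otimes> x [^] (i mod m)"
    using x(1) by (simp add: nat_pow_mult)
  also have "x [^] (m * (i div m)) = \<one>"
    using x by (simp flip: nat_pow_pow)
  finally show ?thesis using x(1) by simp
qed

text \<open>
  The algebras that are generated by a rotation \<open>\<alpha>\<close> and an involution \<open>\<beta>\<close> subject to the
  dihedral relations, possibly with further relations. The normal form \<open>f(\<alpha>) + g(\<alpha>) \<beta>\<close>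
  reduces all computations to the commutative ring \<open>k[X]\<close>.
\<close>
locale dihedral_algebra = algebra_over_field A \<eta>
  for A (structure) and \<eta> :: "'k::alg_closed_field \<Rightarrow> 'a" +
  fixes \<alpha> \<beta> :: 'a and s t q n :: nat
  assumes q_eq: "q = CHAR('k) ^ s" and n_eq: "n = q * t"
    and odd_char: "odd CHAR('k)"
    and not_dvd: "\<not> CHAR('k) dvd t"
    and rot_closed [simp, intro]: "\<alpha> \<in> carrier A"
    and invol_closed [simp, intro]: "\<beta> \<in> carrier A"
    and rot_order: "\<alpha> [^] n = \<one>"
    and flip_flip: "\<beta> \<otimes> \<beta> = \<one>"
    and flip_rot: "\<beta> \<otimes> \<alpha> = \<alpha> [^] (n - 1) \<otimes> \<beta>"
    and spanned: "r \<in> carrier A \<Longrightarrow> \<exists>f g. r = poly_at \<alpha> f \<oplus> poly_at \<alpha> g \<otimes> \<beta>"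
begin

abbreviation \<Phi> :: "'k poly \<Rightarrow> 'a" where "\<Phi> \<equiv> poly_at \<alpha>"
abbreviation u :: "'k poly" where "u \<equiv> unity_poly t"

text \<open>
  This is the substitution of \<open>1/X\<close> for \<open>X\<close>: modulo \<open>X^n - 1\<close> the inverse of \<open>X\<close> is
  \<open>X^(n-1)\<close>.
\<close>
definition star :: "'k poly \<Rightarrow> 'k poly" where
  "star f = pcompose f (monom 1 (n - 1))"

lemma prime_char: "prime CHAR('k)"
  using odd_char by (metis even_zero prime_CHAR_semidom gr0I)

lemma t_pos: "t > 0" using not_dvd by (cases t) auto

lemma q_pos: "q > 0" using prime_char by (simp add: q_eq prime_gt_0_nat)

lemma n_pos: "n > 0" using q_pos t_pos by (simp add: n_eq)

lemma two_nonzero: "(2 :: 'k) \<noteq> 0"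
proof
  assume "(2 :: 'k) = 0"
  then have "of_nat 2 = (0 :: 'k)" by simp
  then have "CHAR('k) dvd 2" by (simp only: of_nat_eq_0_iff_char_dvd)
  then have "CHAR('k) = 2" using prime_char by (metis primes_dvd_imp_eq two_is_prime_nat)
  with odd_char show False by simp
qed

lemma unity_power: "u ^ q = unity_poly n"
  unfolding n_eq q_eq by (rule unity_poly_frobenius[OF prime_char])

lemma poly_at_unity: "\<Phi> (unity_poly n) = \<zero>"
  by (simp add: unity_poly_def poly_at_diff poly_at_monom rot_order minus_eq r_neg)

lemma star_mult: "star (f * g) = star f * star g"
  by (simp add: star_def pcompose_mult)

lemma star_1 [simp]: "star 1 = 1"
  by (simp add: star_def pcompose_1)

lemma star_power: "star (f ^ i) = star f ^ i"
  by (induction i) (simp_all add: star_mult)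

lemma poly_star: "poly (star f) \<zeta> = poly f (\<zeta> ^ (n - 1))"
  by (simp add: star_def poly_pcompose poly_monom)

lemma flip_poly: "\<beta> \<otimes> \<Phi> f = \<Phi> (star f) \<otimes> \<beta>"
proof (induction f)
  case (pCons c f)
  have "\<beta> \<otimes> \<Phi> (pCons c f) = \<beta> \<otimes> \<eta> c \<oplus> (\<beta> \<otimes> \<alpha>) \<otimes> \<Phi> f"
    by (simp add: r_distr m_assoc)
  also have "\<dots> = \<eta> c \<otimes> \<beta> \<oplus> \<alpha> [^] (n - 1) \<otimes> (\<beta> \<otimes> \<Phi> f)"
    unfolding flip_rot using scalar_central[of \<beta> c] by (simp add: m_assoc)
  also have "\<dots> = (\<eta> c \<oplus> \<alpha> [^] (n - 1) \<otimes> \<Phi> (star f)) \<otimes> \<beta>"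
    unfolding pCons.IH by (simp add: l_distr m_assoc)
  also have "\<eta> c \<oplus> \<alpha> [^] (n - 1) \<otimes> \<Phi> (star f) = \<Phi> (star (pCons c f))"
    by (simp add: star_def pcompose_pCons poly_at_add poly_at_mult poly_at_monom)
  finally show ?case .
qed (simp add: star_def)

lemma star_monom: "star (monom 1 i) = monom 1 (n - 1) ^ i"
  by (induction i) (simp_all add: star_def monom_Suc pcompose_pCons monom_0)

text \<open>
  The ideal of \<open>u\<close> is stable under \<open>X \<mapsto> 1/X\<close>, because \<open>X^t - 1\<close> divides
  \<open>X^(tm) - 1\<close>. This makes \<open>u\<close> generate a two-sided ideal of the algebra.
\<close>
lemma unity_dvd_star: "u ^ i dvd star (u ^ i)"
proof -
  have "star u = monom 1 t ^ (n - 1) - 1"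
    using star_monom[of t]
    by (simp add: star_def unity_poly_def pcompose_diff pcompose_1 monom_power mult.commute)
  then have "u dvd star u"
    using power_diff_1_eq[of "monom 1 t :: 'k poly" "n - 1"] by (simp add: unity_poly_def)
  then show ?thesis by (simp add: star_power dvd_power_same)
qed

end

section \<open>Left modules and their submodules\<close>

context left_module
begin

lemma smult_r_null [simp]: "r \<in> carrier A \<Longrightarrow> r \<odot>\<^bsub>M\<^esub> \<zero>\<^bsub>M\<^esub> = \<zero>\<^bsub>M\<^esub>"
  using smult_r_distr[of r "\<zero>\<^bsub>M\<^esub>" "\<zero>\<^bsub>M\<^esub>"] by (simp add: M.add.r_cancel_one')

lemma smult_l_null [simp]: "x \<in> carrier M \<Longrightarrow> \<zero> \<odot>\<^bsub>M\<^esub> x = \<zero>\<^bsub>M\<^esub>"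
  using smult_l_distr[of \<zero> \<zero> x] by (simp add: M.add.r_cancel_one')

lemma smult_l_minus: "r \<in> carrier A \<Longrightarrow> x \<in> carrier M \<Longrightarrow> (\<ominus> r) \<odot>\<^bsub>M\<^esub> x = \<ominus>\<^bsub>M\<^esub> (r \<odot>\<^bsub>M\<^esub> x)"
  using smult_l_distr[of "\<ominus> r" r x] by (intro M.minus_equality[symmetric]) (simp_all add: R.l_neg)

lemma minus_eq_zero_iff:
  assumes "x \<in> carrier M" "y \<in> carrier M"
  shows "x \<ominus>\<^bsub>M\<^esub> y = \<zero>\<^bsub>M\<^esub> \<longleftrightarrow> x = y"
proof
  assume "x \<ominus>\<^bsub>M\<^esub> y = \<zero>\<^bsub>M\<^esub>"
  then have "\<ominus>\<^bsub>M\<^esub> (\<ominus>\<^bsub>M\<^esub> y) = x"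
    using assms by (intro M.minus_equality) (simp_all add: M.minus_eq)
  then show "x = y" using assms by simp
qed (use assms in \<open>simp add: M.minus_eq M.r_neg\<close>)

lemma submoduleI:
  assumes "U \<subseteq> carrier M" "\<zero>\<^bsub>M\<^esub> \<in> U"
    and "\<And>x y. x \<in> U \<Longrightarrow> y \<in> U \<Longrightarrow> x \<oplus>\<^bsub>M\<^esub> y \<in> U"
    and smult: "\<And>r x. r \<in> carrier A \<Longrightarrow> x \<in> U \<Longrightarrow> r \<odot>\<^bsub>M\<^esub> x \<in> U"
  shows "submodule U A M"
proof (intro submodule.intro subgroup.intro submodule_axioms.intro)
  show "inv\<^bsub>add_monoid M\<^esub> x \<in> U" if "x \<in> U" for x
  proof -
    have "\<ominus>\<^bsub>M\<^esub> x = (\<ominus> \<one>) \<odot>\<^bsub>M\<^esub> x" using that assms(1) by (subst smult_l_minus) auto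
    also have "\<dots> \<in> U" by (rule smult) (use that in auto)
    finally show ?thesis by (simp add: a_inv_def)
  qed
qed (use assms in auto)

lemma submoduleD:
  assumes "submodule U A M"
  shows "x \<in> U \<Longrightarrow> x \<in> carrier M" "\<zero>\<^bsub>M\<^esub> \<in> U"
    and "x \<in> U \<Longrightarrow> y \<in> U \<Longrightarrow> x \<oplus>\<^bsub>M\<^esub> y \<in> U"
    and "r \<in> carrier A \<Longrightarrow> x \<in> U \<Longrightarrow> r \<odot>\<^bsub>M\<^esub> x \<in> U"
    and "x \<in> U \<Longrightarrow> \<ominus>\<^bsub>M\<^esub> x \<in> U"
proof -
  interpret submodule U A M by fact
  show "x \<in> U \<Longrightarrow> x \<in> carrier M" "\<zero>\<^bsub>M\<^esub> \<in> U"
    "x \<in> U \<Longrightarrow> y \<in> U \<Longrightarrow> x \<oplus>\<^bsub>M\<^esub> y \<in> U"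
    "r \<in> carrier A \<Longrightarrow> x \<in> U \<Longrightarrow> r \<odot>\<^bsub>M\<^esub> x \<in> U"
    "x \<in> U \<Longrightarrow> \<ominus>\<^bsub>M\<^esub> x \<in> U"
    using subset one_closed m_closed m_inv_closed by (auto simp: a_inv_def)
qed

lemma submodule_zero: "submodule {\<zero>\<^bsub>M\<^esub>} A M"
  by (rule submoduleI) auto

definition cyclic :: "'v \<Rightarrow> 'v set" where
  "cyclic v = (\<lambda>r. r \<odot>\<^bsub>M\<^esub> v) ` carrier A"

lemma submodule_cyclic:
  assumes v: "v \<in> carrier M"
  shows "submodule (cyclic v) A M"
proof (rule submoduleI)
  show "cyclic v \<subseteq> carrier M" using v by (auto simp: cyclic_def)
  have "\<zero>\<^bsub>M\<^esub> = \<zero> \<odot>\<^bsub>M\<^esub> v" using v by simp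
  then show "\<zero>\<^bsub>M\<^esub> \<in> cyclic v" unfolding cyclic_def by blast
next
  fix x y assume "x \<in> cyclic v" "y \<in> cyclic v"
  then obtain r r' where "r \<in> carrier A" "r' \<in> carrier A" "x = r \<odot>\<^bsub>M\<^esub> v" "y = r' \<odot>\<^bsub>M\<^esub> v"
    by (auto simp: cyclic_def)
  then show "x \<oplus>\<^bsub>M\<^esub> y \<in> cyclic v"
    unfolding cyclic_def using v by (intro image_eqI[of _ _ "r \<oplus> r'"]) (auto simp: smult_l_distr)
next
  fix r x assume "r \<in> carrier A" "x \<in> cyclic v"
  then obtain r' where "r \<in> carrier A" "r' \<in> carrier A" "x = r' \<odot>\<^bsub>M\<^esub> v"
    by (auto simp: cyclic_def)
  then show "r \<odot>\<^bsub>M\<^esub> x \<in> cyclic v"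
    unfolding cyclic_def using v by (intro image_eqI[of _ _ "r \<otimes> r'"]) (auto simp: smult_assoc1)
qed

lemma cyclic_self: "v \<in> carrier M \<Longrightarrow> v \<in> cyclic v"
  unfolding cyclic_def by (rule image_eqI[of _ _ \<one>]) auto

lemma cyclic_subset:
  assumes "submodule U A M" "v \<in> U"
  shows "cyclic v \<subseteq> U"
  using submoduleD[OF assms(1)] assms(2) by (auto simp: cyclic_def)

lemma set_add_iff: "z \<in> U <+>\<^bsub>M\<^esub> W \<longleftrightarrow> (\<exists>x\<in>U. \<exists>y\<in>W. z = x \<oplus>\<^bsub>M\<^esub> y)"
  by (auto simp: set_add_def')

lemma submodule_set_add:
  assumes U: "submodule U A M" and W: "submodule W A M"
  shows "submodule (U <+>\<^bsub>M\<^esub> W) A M"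
proof (rule submoduleI)
  note D = submoduleD[OF U] submoduleD[OF W]
  show "U <+>\<^bsub>M\<^esub> W \<subseteq> carrier M" using D by (auto simp: set_add_iff)
  show "\<zero>\<^bsub>M\<^esub> \<in> U <+>\<^bsub>M\<^esub> W" using D(2,7) by (auto simp: set_add_iff intro!: bexI[of _ "\<zero>\<^bsub>M\<^esub>"])
next
  note D = submoduleD[OF U] submoduleD[OF W]
  fix x y assume "x \<in> U <+>\<^bsub>M\<^esub> W" "y \<in> U <+>\<^bsub>M\<^esub> W"
  then obtain u w u' w' where *: "u \<in> U" "u' \<in> U" "w \<in> W" "w' \<in> W" "x = u \<oplus>\<^bsub>M\<^esub> w" "y = u' \<oplus>\<^bsub>M\<^esub> w'"
    by (auto simp: set_add_iff)
  then have "x \<oplus>\<^bsub>M\<^esub> y = (u \<oplus>\<^bsub>M\<^esub> u') \<oplus>\<^bsub>M\<^esub> (w \<oplus>\<^bsub>M\<^esub> w')"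
    using D(1,6) by (simp add: M.a_ac)
  with * D(3,8) show "x \<oplus>\<^bsub>M\<^esub> y \<in> U <+>\<^bsub>M\<^esub> W" unfolding set_add_iff by blast
next
  note D = submoduleD[OF U] submoduleD[OF W]
  fix r x assume r: "r \<in> carrier A" and "x \<in> U <+>\<^bsub>M\<^esub> W"
  then obtain u w where *: "u \<in> U" "w \<in> W" "x = u \<oplus>\<^bsub>M\<^esub> w"
    by (auto simp: set_add_iff)
  then have "r \<odot>\<^bsub>M\<^esub> x = r \<odot>\<^bsub>M\<^esub> u \<oplus>\<^bsub>M\<^esub> r \<odot>\<^bsub>M\<^esub> w"
    using D(1,6) r by (simp add: smult_r_distr)
  with * r D(4,9) show "r \<odot>\<^bsub>M\<^esub> x \<in> U <+>\<^bsub>M\<^esub> W" unfolding set_add_iff by blast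
qed

lemma set_add_upper:
  assumes U: "submodule U A M" and W: "submodule W A M"
  shows "U \<subseteq> U <+>\<^bsub>M\<^esub> W" "W \<subseteq> U <+>\<^bsub>M\<^esub> W"
proof -
  note D = submoduleD[OF U] submoduleD[OF W]
  show "U \<subseteq> U <+>\<^bsub>M\<^esub> W"
    using D(1,7) by (force simp: set_add_iff)
  show "W \<subseteq> U <+>\<^bsub>M\<^esub> W"
    using D(2,6) by (force simp: set_add_iff)
qed

text \<open>Zorn's lemma: a submodule that meets \<open>U\<close> trivially lies in a maximal one.\<close>
lemma maximal_disjoint_submodule:
  assumes U: "submodule U A M"
  obtains W where "submodule W A M" "U \<inter> W = {\<zero>\<^bsub>M\<^esub>}"
    "\<And>W'. submodule W' A M \<Longrightarrow> U \<inter> W' = {\<zero>\<^bsub>M\<^esub>} \<Longrightarrow> W \<subseteq> W' \<Longrightarrow> W' = W"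
proof -
  let ?S = "{W. submodule W A M \<and> U \<inter> W = {\<zero>\<^bsub>M\<^esub>}}"
  have "\<exists>W\<in>?S. \<forall>X\<in>?S. W \<subseteq> X \<longrightarrow> X = W"
  proof (rule subset_Zorn_nonempty)
    show "?S \<noteq> {}" using submodule_zero submoduleD(2)[OF U] by blast
  next
    fix C assume C: "C \<noteq> {}" "subset.chain ?S C"
    then have CS: "C \<subseteq> ?S" by (simp add: subset.chain_def)
    have D: "\<And>W x. W \<in> C \<Longrightarrow> x \<in> W \<Longrightarrow> x \<in> carrier M" "\<And>W. W \<in> C \<Longrightarrow> \<zero>\<^bsub>M\<^esub> \<in> W"
      "\<And>W x y. W \<in> C \<Longrightarrow> x \<in> W \<Longrightarrow> y \<in> W \<Longrightarrow> x \<oplus>\<^bsub>M\<^esub> y \<in> W"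
      "\<And>W r x. W \<in> C \<Longrightarrow> r \<in> carrier A \<Longrightarrow> x \<in> W \<Longrightarrow> r \<odot>\<^bsub>M\<^esub> x \<in> W"
      using CS submoduleD by blast+
    have "submodule (\<Union>C) A M"
    proof (rule submoduleI)
      fix x y assume "x \<in> \<Union>C" "y \<in> \<Union>C"
      then obtain X Y where XY: "X \<in> C" "Y \<in> C" "x \<in> X" "y \<in> Y" by blast
      then have "X \<subseteq> Y \<or> Y \<subseteq> X" using C(2) by (auto simp: subset.chain_def)
      then show "x \<oplus>\<^bsub>M\<^esub> y \<in> \<Union>C" using XY D(3) by blast
    qed (use D C(1) in blast)+
    moreover have "U \<inter> \<Union>C = {\<zero>\<^bsub>M\<^esub>}" using CS C(1) by blast
    ultimately show "\<Union>C \<in> ?S" by blast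
  qed
  then obtain W where W: "W \<in> ?S" and max: "\<forall>X\<in>?S. W \<subseteq> X \<longrightarrow> X = W" by blast
  show ?thesis
  proof (rule that[of W])
    show "W' = W" if "submodule W' A M" "U \<inter> W' = {\<zero>\<^bsub>M\<^esub>}" "W \<subseteq> W'" for W'
      using max that by simp
  qed (use W in simp_all)
qed

lemma left_module_submodule:
  assumes U: "submodule U A M"
  shows "left_module A (M\<lparr>carrier := U\<rparr>)"
proof (intro left_module.intro left_module_axioms.intro R.ring_axioms)
  note D = submoduleD[OF U]
  show "abelian_group (M\<lparr>carrier := U\<rparr>)"
  proof (rule abelian_groupI)
    fix x assume "x \<in> carrier (M\<lparr>carrier := U\<rparr>)"
    then show "\<exists>y\<in>carrier (M\<lparr>carrier := U\<rparr>). y \<oplus>\<^bsub>M\<lparr>carrier := U\<rparr>\<^esub> x = \<zero>\<^bsub>M\<lparr>carrier := U\<rparr>\<^esub>"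
      using D by (intro bexI[of _ "\<ominus>\<^bsub>M\<^esub> x"]) (auto simp: M.l_neg)
  qed (use D in \<open>auto simp: M.a_ac\<close>)
qed (simp_all add: submoduleD[OF U] smult_l_distr smult_r_distr smult_assoc1)

end

text \<open>
  A cyclic module is determined by the annihilator of its generator: it is the quotient of the
  algebra by this left ideal.
\<close>
lemma cyclic_modules_isomorphic:
  assumes M: "left_module A M" and N: "left_module A N"
    and v: "v \<in> carrier M" "carrier M = (\<lambda>r. r \<odot>\<^bsub>M\<^esub> v) ` carrier A"
    and w: "w \<in> carrier N" "carrier N = (\<lambda>r. r \<odot>\<^bsub>N\<^esub> w) ` carrier A"
    and ann: "\<And>r. r \<in> carrier A \<Longrightarrow> r \<odot>\<^bsub>M\<^esub> v = \<zero>\<^bsub>M\<^esub> \<longleftrightarrow> r \<odot>\<^bsub>N\<^esub> w = \<zero>\<^bsub>N\<^esub>"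
  shows "module_isomorphic A M N"
proof -
  interpret M: left_module A M by fact
  interpret N: left_module A N by fact
  have key: "r \<odot>\<^bsub>M\<^esub> v = r' \<odot>\<^bsub>M\<^esub> v \<longleftrightarrow> r \<odot>\<^bsub>N\<^esub> w = r' \<odot>\<^bsub>N\<^esub> w"
    if "r \<in> carrier A" "r' \<in> carrier A" for r r'
  proof -
    have "r \<odot>\<^bsub>M\<^esub> v = r' \<odot>\<^bsub>M\<^esub> v \<longleftrightarrow> (r \<ominus>\<^bsub>A\<^esub> r') \<odot>\<^bsub>M\<^esub> v = \<zero>\<^bsub>M\<^esub>"
      using that v(1)
      by (simp add: M.R.minus_eq M.smult_l_distr M.smult_l_minus M.minus_eq_zero_iff flip: M.M.minus_eq)
    moreover have "r \<odot>\<^bsub>N\<^esub> w = r' \<odot>\<^bsub>N\<^esub> w \<longleftrightarrow> (r \<ominus>\<^bsub>A\<^esub> r') \<odot>\<^bsub>N\<^esub> w = \<zero>\<^bsub>N\<^esub>"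
      using that w(1)
      by (simp add: M.R.minus_eq N.smult_l_distr N.smult_l_minus N.minus_eq_zero_iff flip: N.M.minus_eq)
    ultimately show ?thesis using ann[of "r \<ominus>\<^bsub>A\<^esub> r'"] that by simp
  qed
  define h where "h x = (SOME r. r \<in> carrier A \<and> r \<odot>\<^bsub>M\<^esub> v = x) \<odot>\<^bsub>N\<^esub> w" for x
  have h: "h (r \<odot>\<^bsub>M\<^esub> v) = r \<odot>\<^bsub>N\<^esub> w" if r: "r \<in> carrier A" for r
  proof -
    let ?r = "SOME r'. r' \<in> carrier A \<and> r' \<odot>\<^bsub>M\<^esub> v = r \<odot>\<^bsub>M\<^esub> v"
    have "?r \<in> carrier A \<and> ?r \<odot>\<^bsub>M\<^esub> v = r \<odot>\<^bsub>M\<^esub> v"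
      by (rule someI[of _ r]) (use r in simp)
    then show ?thesis using key r unfolding h_def by blast
  qed
  have ex: "\<exists>r. r \<in> carrier A \<and> x = r \<odot>\<^bsub>M\<^esub> v" if "x \<in> carrier M" for x
  proof -
    from that have "x \<in> (\<lambda>r. r \<odot>\<^bsub>M\<^esub> v) ` carrier A" by (simp only: v(2)[symmetric])
    then show ?thesis by (elim imageE) blast
  qed
  have "h (x \<oplus>\<^bsub>M\<^esub> y) = h x \<oplus>\<^bsub>N\<^esub> h y" if x: "x \<in> carrier M" and y: "y \<in> carrier M" for x y
  proof -
    obtain r r' where r: "r \<in> carrier A" "r' \<in> carrier A" "x = r \<odot>\<^bsub>M\<^esub> v" "y = r' \<odot>\<^bsub>M\<^esub> v"
      using ex[OF x] ex[OF y] by blast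
    then have "x \<oplus>\<^bsub>M\<^esub> y = (r \<oplus>\<^bsub>A\<^esub> r') \<odot>\<^bsub>M\<^esub> v" using v(1) by (simp add: M.smult_l_distr)
    then show ?thesis using r w(1) by (simp add: h N.smult_l_distr)
  qed
  moreover have "bij_betw h (carrier M) (carrier N)"
    unfolding bij_betw_def
  proof
    show "inj_on h (carrier M)" unfolding v(2) by (auto simp: inj_on_def h key)
    show "h ` carrier M = carrier N" unfolding v(2) w(2) by (auto simp: h image_image)
  qed
  moreover have "h (r \<odot>\<^bsub>M\<^esub> x) = r \<odot>\<^bsub>N\<^esub> h x" if r: "r \<in> carrier A" and x: "x \<in> carrier M" for r x
  proof -
    obtain r' where r': "r' \<in> carrier A" "x = r' \<odot>\<^bsub>M\<^esub> v" using ex[OF x] by blast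
    then have "r \<odot>\<^bsub>M\<^esub> x = (r \<otimes>\<^bsub>A\<^esub> r') \<odot>\<^bsub>M\<^esub> v" using r v(1) by (simp add: M.smult_assoc1)
    then show ?thesis using r r' w(1) by (simp add: h N.smult_assoc1)
  qed
  ultimately show ?thesis
    unfolding module_isomorphic_def iso_def hom_def bij_betw_def by (intro bexI[of _ h]) auto
qed

section \<open>Polynomials acting on a module\<close>

context dihedral_algebra
begin

abbreviation primary :: "'k \<Rightarrow> 'k poly" where "primary \<zeta> \<equiv> [:-\<zeta>, 1:] ^ q"

text \<open>
  A homogeneous element lies in the primary component of a root of unity \<open>\<zeta>\<close>. The involution
  maps this component to that of \<open>1/\<zeta>\<close>; if the two agree, the element is also required to
  be an eigenvector of the involution, with sign \<open>\<epsilon>\<close>. Otherwise there is no sign to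
  record, and \<open>\<epsilon>\<close> is fixed at \<open>1\<close> so that equal data have equal labels. Modulo
  \<open>u\<close> a homogeneous element generates a simple module or \<open>0\<close>.
\<close>
definition homogeneous :: "('a, 'v, 'c) module_scheme \<Rightarrow> 'v \<Rightarrow> 'k \<Rightarrow> 'k \<Rightarrow> bool" where
  "homogeneous M v \<zeta> \<epsilon> \<longleftrightarrow>
    v \<in> carrier M \<and> \<zeta> ^ t = 1 \<and> \<Phi> (primary \<zeta>) \<odot>\<^bsub>M\<^esub> v = \<zero>\<^bsub>M\<^esub> \<and>
    (if \<zeta> ^ 2 = 1 then \<epsilon> \<in> {1, -1} \<and> \<beta> \<odot>\<^bsub>M\<^esub> v = \<eta> \<epsilon> \<odot>\<^bsub>M\<^esub> v else \<epsilon> = 1)"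

text \<open>
  The triple \<open>(\<zeta>, \<epsilon>, l)\<close> is the label of the module: \<open>\<zeta>\<close> and \<open>\<epsilon>\<close> name its simple
  top, and \<open>l + 1\<close> is its Loewy length.
\<close>
definition generator :: "('a, 'v, 'c) module_scheme \<Rightarrow> 'v \<Rightarrow> 'k \<Rightarrow> 'k \<Rightarrow> nat \<Rightarrow> bool" where
  "generator M v \<zeta> \<epsilon> l \<longleftrightarrow>
    homogeneous M v \<zeta> \<epsilon> \<and> \<Phi> (u ^ l) \<odot>\<^bsub>M\<^esub> v \<noteq> \<zero>\<^bsub>M\<^esub> \<and> \<Phi> (u ^ Suc l) \<odot>\<^bsub>M\<^esub> v = \<zero>\<^bsub>M\<^esub> \<and>
    carrier M = (\<lambda>r. r \<odot>\<^bsub>M\<^esub> v) ` carrier A"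

lemma root_nonzero: "\<zeta> ^ t = 1 \<Longrightarrow> \<zeta> \<noteq> (0 :: 'k)"
  using t_pos by (auto simp: power_0_left)

lemma root_star:
  assumes "\<zeta> ^ t = (1 :: 'k)"
  shows "\<zeta> ^ (n - 1) = inverse \<zeta>"
proof -
  have "\<zeta> * \<zeta> ^ (n - 1) = \<zeta> ^ n" using n_pos by (simp flip: power_Suc)
  also have "\<dots> = 1" using assms by (simp add: n_eq mult.commute[of q] power_mult)
  finally show ?thesis by (rule inverse_unique[symmetric])
qed

lemma involutive_root:
  assumes "\<zeta> ^ 2 = (1 :: 'k)"
  shows "inverse \<zeta> = \<zeta>"
  using assms by (metis inverse_unique power2_eq_square)

lemma non_involutive_root:
  assumes "\<zeta> ^ t = 1" "\<zeta> ^ 2 \<noteq> (1 :: 'k)"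
  shows "inverse \<zeta> \<noteq> \<zeta>"
  using assms root_nonzero[OF assms(1)] by (metis power2_eq_square right_inverse)

lemma unity_dvd_primary_star:
  assumes "\<zeta> ^ t = (1 :: 'k)"
  shows "primary \<zeta> dvd star (primary (inverse \<zeta>))"
proof -
  have "poly (star [:- inverse \<zeta>, 1:]) \<zeta> = 0"
    using root_star[OF assms] by (simp add: poly_star)
  then have "[:-\<zeta>, 1:] dvd star [:- inverse \<zeta>, 1:]" by (simp only: poly_eq_0_iff_dvd)
  then show ?thesis by (simp only: star_power dvd_power_same)
qed

end

locale dihedral_module = dihedral_algebra A \<eta> \<alpha> \<beta> s t q n + left_module A M
  for A (structure) and \<eta> :: "'k::alg_closed_field \<Rightarrow> 'a" and \<alpha> \<beta> s t q n and M (structure)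
begin

definition act :: "'k poly \<Rightarrow> 'c \<Rightarrow> 'c" (infixr "\<bullet>" 75) where
  "f \<bullet> v = \<Phi> f \<odot>\<^bsub>M\<^esub> v"

definition flip :: "'c \<Rightarrow> 'c" where
  "flip v = \<beta> \<odot>\<^bsub>M\<^esub> v"

lemma act_closed [simp, intro]: "v \<in> carrier M \<Longrightarrow> f \<bullet> v \<in> carrier M"
  by (simp add: act_def)

lemma flip_closed [simp, intro]: "v \<in> carrier M \<Longrightarrow> flip v \<in> carrier M"
  by (simp add: flip_def)

lemma act_0 [simp]: "v \<in> carrier M \<Longrightarrow> 0 \<bullet> v = \<zero>\<^bsub>M\<^esub>"
  by (simp add: act_def)

lemma act_1 [simp]: "v \<in> carrier M \<Longrightarrow> 1 \<bullet> v = v"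
  by (simp add: act_def)

lemma act_zero [simp]: "f \<bullet> \<zero>\<^bsub>M\<^esub> = \<zero>\<^bsub>M\<^esub>"
  by (simp add: act_def)

lemma act_add: "v \<in> carrier M \<Longrightarrow> (f + g) \<bullet> v = f \<bullet> v \<oplus>\<^bsub>M\<^esub> g \<bullet> v"
  by (simp add: act_def poly_at_add smult_l_distr)

lemma act_mult: "v \<in> carrier M \<Longrightarrow> (f * g) \<bullet> v = f \<bullet> g \<bullet> v"
  by (simp add: act_def poly_at_mult smult_assoc1)

lemma act_distrib: "v \<in> carrier M \<Longrightarrow> w \<in> carrier M \<Longrightarrow> f \<bullet> (v \<oplus>\<^bsub>M\<^esub> w) = f \<bullet> v \<oplus>\<^bsub>M\<^esub> f \<bullet> w"
  by (simp add: act_def smult_r_distr)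

lemma act_uminus: "v \<in> carrier M \<Longrightarrow> (- f) \<bullet> v = \<ominus>\<^bsub>M\<^esub> (f \<bullet> v)"
  by (simp add: act_def poly_at_uminus smult_l_minus)

lemma act_commute: "v \<in> carrier M \<Longrightarrow> f \<bullet> g \<bullet> v = g \<bullet> f \<bullet> v"
  by (simp add: mult.commute flip: act_mult)

lemma act_const: "[:c:] \<bullet> v = \<eta> c \<odot>\<^bsub>M\<^esub> v"
  by (simp add: act_def)

lemma act_smult: "v \<in> carrier M \<Longrightarrow> Polynomial.smult c f \<bullet> v = f \<bullet> (\<eta> c \<odot>\<^bsub>M\<^esub> v)"
  using act_mult[of v f "[:c:]"] by (simp add: act_const)

lemma act_dvd: "v \<in> carrier M \<Longrightarrow> f dvd g \<Longrightarrow> f \<bullet> v = \<zero>\<^bsub>M\<^esub> \<Longrightarrow> g \<bullet> v = \<zero>\<^bsub>M\<^esub>"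
  by (elim dvdE) (simp add: mult.commute[of f] act_mult)

lemma act_unity: "v \<in> carrier M \<Longrightarrow> unity_poly n \<bullet> v = \<zero>\<^bsub>M\<^esub>"
  by (simp add: act_def poly_at_unity)

lemma flip_flip_module [simp]: "v \<in> carrier M \<Longrightarrow> flip (flip v) = v"
  by (simp add: flip_def flip_flip flip: smult_assoc1)

lemma flip_act: "v \<in> carrier M \<Longrightarrow> flip (f \<bullet> v) = star f \<bullet> flip v"
  by (simp add: flip_def act_def flip_poly flip: smult_assoc1)

lemma act_flip: "v \<in> carrier M \<Longrightarrow> f \<bullet> flip v = flip (star f \<bullet> v)"
  using flip_act[of "flip v" f] flip_flip_module[of "f \<bullet> flip v"] by simp

lemma flip_add: "v \<in> carrier M \<Longrightarrow> w \<in> carrier M \<Longrightarrow> flip (v \<oplus>\<^bsub>M\<^esub> w) = flip v \<oplus>\<^bsub>M\<^esub> flip w"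
  by (simp add: flip_def smult_r_distr)

lemma flip_zero [simp]: "flip \<zero>\<^bsub>M\<^esub> = \<zero>\<^bsub>M\<^esub>"
  by (simp add: flip_def)

lemma flip_scalar: "v \<in> carrier M \<Longrightarrow> flip (\<eta> c \<odot>\<^bsub>M\<^esub> v) = \<eta> c \<odot>\<^bsub>M\<^esub> flip v"
  using scalar_central[of \<beta> c] by (simp add: flip_def flip: smult_assoc1)

lemma spanned_act:
  assumes "r \<in> carrier A"
  obtains f g where "\<And>v. v \<in> carrier M \<Longrightarrow> r \<odot>\<^bsub>M\<^esub> v = f \<bullet> v \<oplus>\<^bsub>M\<^esub> g \<bullet> flip v"
proof -
  obtain f g where "r = \<Phi> f \<oplus> \<Phi> g \<otimes> \<beta>" using spanned[OF assms] by blast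
  then show ?thesis
    by (intro that[of f g]) (simp add: act_def flip_def smult_l_distr smult_assoc1)
qed

lemma submodule_act: "submodule Y A M \<Longrightarrow> v \<in> Y \<Longrightarrow> f \<bullet> v \<in> Y"
  by (simp add: act_def submoduleD)

lemma submodule_flip: "submodule Y A M \<Longrightarrow> v \<in> Y \<Longrightarrow> flip v \<in> Y"
  by (simp add: flip_def submoduleD)

text \<open>
  The map \<open>w \<mapsto> u^i \<bullet> w\<close> is not linear over the algebra, but it is so up to the factor
  \<open>star (u^i) / u^i\<close>, and preimages of submodules are submodules.
\<close>
lemma submodule_preimage:
  assumes Y: "submodule Y A M"
  shows "submodule {w \<in> carrier M. u ^ i \<bullet> w \<in> Y} A M"
proof (rule submoduleI)
  note D = submoduleD[OF Y]
  fix r x assume r: "r \<in> carrier A" and "x \<in> {w \<in> carrier M. u ^ i \<bullet> w \<in> Y}"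
  then have x: "x \<in> carrier M" and ux: "u ^ i \<bullet> x \<in> Y" by auto
  obtain h where h: "star (u ^ i) = u ^ i * h" using unity_dvd_star[of i] by (elim dvdE)
  obtain f g where fg: "\<And>v. v \<in> carrier M \<Longrightarrow> r \<odot>\<^bsub>M\<^esub> v = f \<bullet> v \<oplus>\<^bsub>M\<^esub> g \<bullet> flip v"
    using spanned_act[OF r] by blast
  have "u ^ i \<bullet> flip x = flip (h \<bullet> u ^ i \<bullet> x)"
    using x by (simp add: act_flip h mult.commute[of _ h] act_mult)
  then have *: "u ^ i \<bullet> flip x \<in> Y"
    using ux Y by (simp add: submodule_act submodule_flip)
  have "u ^ i \<bullet> (r \<odot>\<^bsub>M\<^esub> x) = f \<bullet> u ^ i \<bullet> x \<oplus>\<^bsub>M\<^esub> g \<bullet> u ^ i \<bullet> flip x"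
    using x by (simp add: fg act_distrib act_commute[of _ "u ^ i"])
  also have "\<dots> \<in> Y" using * ux Y D(3) by (simp add: submodule_act)
  finally show "r \<odot>\<^bsub>M\<^esub> x \<in> {w \<in> carrier M. u ^ i \<bullet> w \<in> Y}" using x r by simp
qed (use submoduleD[OF Y] in \<open>auto simp: act_distrib\<close>)

lemma submodule_kernel: "submodule {w \<in> carrier M. u ^ i \<bullet> w = \<zero>\<^bsub>M\<^esub>} A M"
  using submodule_preimage[OF submodule_zero, of i] by simp

lemma act_cong_primary:
  assumes v: "v \<in> carrier M" "primary \<zeta> \<bullet> v = \<zero>\<^bsub>M\<^esub>" and fg: "primary \<zeta> dvd f - g"
  shows "f \<bullet> v = g \<bullet> v"
proof -
  have "f \<bullet> v = (g + (f - g)) \<bullet> v" by simp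
  also have "\<dots> = g \<bullet> v" using act_dvd[OF v(1) fg v(2)] v(1) by (simp only: act_add) simp
  finally show ?thesis .
qed

lemma act_inverse:
  assumes "poly f \<zeta> \<noteq> 0"
  obtains g where "\<And>v. v \<in> carrier M \<Longrightarrow> primary \<zeta> \<bullet> v = \<zero>\<^bsub>M\<^esub> \<Longrightarrow> g \<bullet> f \<bullet> v = v"
proof -
  obtain g where g: "primary \<zeta> dvd g * f - 1"
    using poly_local_inverse[OF prime_char assms, of s] by (auto simp: q_eq)
  show ?thesis
  proof (rule that[of g])
    fix v assume "v \<in> carrier M" "primary \<zeta> \<bullet> v = \<zero>\<^bsub>M\<^esub>"
    with act_cong_primary[OF this g] show "g \<bullet> f \<bullet> v = v" by (simp add: act_mult)
  qed
qed

lemma act_eq_zero_cancel: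
  assumes "poly f \<zeta> \<noteq> 0" "v \<in> carrier M" "primary \<zeta> \<bullet> v = \<zero>\<^bsub>M\<^esub>" "f \<bullet> v = \<zero>\<^bsub>M\<^esub>"
  shows "v = \<zero>\<^bsub>M\<^esub>"
  using act_inverse[OF assms(1)] assms(2-4) by (metis act_zero)

lemma primary_act:
  assumes "v \<in> carrier M" "primary \<zeta> \<bullet> v = \<zero>\<^bsub>M\<^esub>"
  shows "primary \<zeta> \<bullet> f \<bullet> v = \<zero>\<^bsub>M\<^esub>"
  using assms by (simp add: act_commute[of v "primary \<zeta>"])

lemma primary_flip:
  assumes "v \<in> carrier M" "\<zeta> ^ t = 1" "primary \<zeta> \<bullet> v = \<zero>\<^bsub>M\<^esub>"
  shows "primary (inverse \<zeta>) \<bullet> flip v = \<zero>\<^bsub>M\<^esub>"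
  using act_dvd[OF assms(1) unity_dvd_primary_star[OF assms(2)] assms(3)] assms(1)
  by (simp add: act_flip)

text \<open>
  On a primary component the factors of \<open>u\<close> other than \<open>X - \<zeta>\<close> are invertible, so \<open>u\<close>
  generates the maximal ideal there.
\<close>
lemma act_root_factor:
  assumes \<zeta>: "\<zeta> ^ t = 1" and f: "poly f \<zeta> = 0"
  obtains g where "\<And>v. v \<in> carrier M \<Longrightarrow> primary \<zeta> \<bullet> v = \<zero>\<^bsub>M\<^esub> \<Longrightarrow> f \<bullet> v = g \<bullet> u \<bullet> v"
proof -
  obtain h where h: "u = [:-\<zeta>, 1:] * h" "poly h \<zeta> \<noteq> 0"
    using unity_poly_simple_root[OF not_dvd \<zeta>] .
  obtain f' where f': "f = [:-\<zeta>, 1:] * f'" using f by (auto simp only: poly_eq_0_iff_dvd dvd_def)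
  obtain g where g: "\<And>v. v \<in> carrier M \<Longrightarrow> primary \<zeta> \<bullet> v = \<zero>\<^bsub>M\<^esub> \<Longrightarrow> g \<bullet> h \<bullet> v = v"
    using act_inverse[OF h(2)] by blast
  show ?thesis
  proof (rule that[of "f' * g"])
    fix v assume v: "v \<in> carrier M" "primary \<zeta> \<bullet> v = \<zero>\<^bsub>M\<^esub>"
    have "(f' * g) \<bullet> u \<bullet> v = (f' * [:-\<zeta>, 1:]) \<bullet> g \<bullet> h \<bullet> v"
      using v(1) by (simp only: h(1) mult_ac act_closed flip: act_mult)
    also have "\<dots> = f \<bullet> v" by (simp only: g[OF v] f' mult.commute)
    finally show "f \<bullet> v = (f' * g) \<bullet> u \<bullet> v" by simp
  qed
qed

lemma homogeneousD:
  assumes "homogeneous M v \<zeta> \<epsilon>"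
  shows "v \<in> carrier M" "\<zeta> ^ t = 1" "primary \<zeta> \<bullet> v = \<zero>\<^bsub>M\<^esub>"
    and "\<zeta> ^ 2 = 1 \<Longrightarrow> flip v = \<eta> \<epsilon> \<odot>\<^bsub>M\<^esub> v"
  using assms by (auto simp: homogeneous_def act_def flip_def)

end

section \<open>Homogeneous elements generate direct summands\<close>

context dihedral_module
begin

text \<open>
  If \<open>\<zeta> \<noteq> 1/\<zeta>\<close>, then \<open>f \<bullet> v\<close> and \<open>g \<bullet> flip v\<close> lie in different primary components,
  and a submodule contains the components of its elements.
\<close>
lemma split_components:
  assumes Y: "submodule Y A M" and v: "v \<in> carrier M" "\<zeta> ^ t = 1" "primary \<zeta> \<bullet> v = \<zero>\<^bsub>M\<^esub>"
    and \<zeta>2: "\<zeta> ^ 2 \<noteq> 1" and mem: "f \<bullet> v \<oplus>\<^bsub>M\<^esub> g \<bullet> flip v \<in> Y"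
  shows "f \<bullet> v \<in> Y" "star g \<bullet> v \<in> Y"
proof -
  note D = submoduleD[OF Y]
  let ?e = "primary (inverse \<zeta>)"
  have "poly ?e \<zeta> \<noteq> 0" using non_involutive_root[OF v(2) \<zeta>2] by simp
  then obtain h where h: "\<And>w. w \<in> carrier M \<Longrightarrow> primary \<zeta> \<bullet> w = \<zero>\<^bsub>M\<^esub> \<Longrightarrow> h \<bullet> ?e \<bullet> w = w"
    using act_inverse by blast
  have "h \<bullet> ?e \<bullet> (f \<bullet> v \<oplus>\<^bsub>M\<^esub> g \<bullet> flip v) = h \<bullet> ?e \<bullet> f \<bullet> v"
    using v primary_flip[OF v] by (simp add: act_distrib primary_act)
  also have "\<dots> = f \<bullet> v" by (rule h) (use v in \<open>simp_all add: primary_act\<close>)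
  finally show f: "f \<bullet> v \<in> Y" using submodule_act[OF Y submodule_act[OF Y mem]] by metis
  have "g \<bullet> flip v = (f \<bullet> v \<oplus>\<^bsub>M\<^esub> g \<bullet> flip v) \<oplus>\<^bsub>M\<^esub> \<ominus>\<^bsub>M\<^esub> (f \<bullet> v)"
    using v(1) by (simp add: M.a_comm[of "f \<bullet> v"] M.a_assoc M.r_neg)
  also have "\<dots> \<in> Y" by (rule D(3)[OF mem D(5)[OF f]])
  finally have "flip (g \<bullet> flip v) \<in> Y" by (rule submodule_flip[OF Y])
  then show "star g \<bullet> v \<in> Y" using v(1) by (simp add: flip_act)
qed

lemma fold_components:
  assumes v: "homogeneous M v \<zeta> \<epsilon>" and "\<zeta> ^ 2 = 1"
  shows "f \<bullet> v \<oplus>\<^bsub>M\<^esub> g \<bullet> flip v = (f + Polynomial.smult \<epsilon> g) \<bullet> v"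
  using homogeneousD[OF v] assms(2) by (simp add: act_add act_smult)

text \<open>
  The cyclic module on a homogeneous element \<open>v\<close> is local with radical generated by
  \<open>u \<bullet> v\<close>, for the following reason. A coefficient polynomial is either invertible at \<open>\<zeta>\<close>, and then
  \<open>v\<close> can be recovered, or divisible by \<open>u\<close> there.
\<close>
lemma homogeneous_local:
  assumes v: "homogeneous M v \<zeta> \<epsilon>" and Y: "submodule Y A M" "v \<notin> Y"
    and r: "r \<in> carrier A" "r \<odot>\<^bsub>M\<^esub> v \<in> Y"
  shows "r \<odot>\<^bsub>M\<^esub> v \<in> cyclic (u \<bullet> v)"
proof -
  note vD = homogeneousD[OF v]
  have uv: "u \<bullet> v \<in> carrier M" using vD(1) by simp
  note C = submodule_cyclic[OF uv]
  have *: "f \<bullet> v \<in> cyclic (u \<bullet> v)" if f: "f \<bullet> v \<in> Y" for f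
  proof (cases "poly f \<zeta> = 0")
    case False
    then obtain g where "\<And>v. v \<in> carrier M \<Longrightarrow> primary \<zeta> \<bullet> v = \<zero>\<^bsub>M\<^esub> \<Longrightarrow> g \<bullet> f \<bullet> v = v"
      using act_inverse by blast
    then have "g \<bullet> f \<bullet> v = v" using vD by blast
    then have "v \<in> Y" using submodule_act[OF Y(1) f, of g] by simp
    with Y(2) show ?thesis by simp
  next
    case True
    obtain g where "\<And>v. v \<in> carrier M \<Longrightarrow> primary \<zeta> \<bullet> v = \<zero>\<^bsub>M\<^esub> \<Longrightarrow> f \<bullet> v = g \<bullet> u \<bullet> v"
      using act_root_factor[OF vD(2) True] by blast
    then have "f \<bullet> v = g \<bullet> u \<bullet> v" using vD by blast
    also have "\<dots> \<in> cyclic (u \<bullet> v)" by (rule submodule_act[OF C cyclic_self[OF uv]])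
    finally show ?thesis .
  qed
  obtain f g where fg: "\<And>v. v \<in> carrier M \<Longrightarrow> r \<odot>\<^bsub>M\<^esub> v = f \<bullet> v \<oplus>\<^bsub>M\<^esub> g \<bullet> flip v"
    using spanned_act[OF r(1)] by blast
  have rv: "r \<odot>\<^bsub>M\<^esub> v = f \<bullet> v \<oplus>\<^bsub>M\<^esub> g \<bullet> flip v" using fg vD(1) by blast
  show ?thesis
  proof (cases "\<zeta> ^ 2 = 1")
    case True
    show ?thesis using r(2) * unfolding rv fold_components[OF v True] by blast
  next
    case False
    have "f \<bullet> v \<in> Y" "star g \<bullet> v \<in> Y"
      using split_components[OF Y(1) vD(1-3) False, of f g] r(2) unfolding rv by blast+
    then have "f \<bullet> v \<in> cyclic (u \<bullet> v)" "flip (star g \<bullet> v) \<in> cyclic (u \<bullet> v)"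
      using * submodule_flip[OF C] by blast+
    then show ?thesis
      unfolding rv using submoduleD(3)[OF C] vD(1) by (simp add: act_flip)
  qed
qed

text \<open>
  The Lagrange polynomials raised to the power \<open>q\<close> still add up to \<open>1\<close>, and they project
  onto the primary components; for \<open>\<zeta> = \<plusminus>1\<close> the two eigenspaces of the involution are
  separated by \<open>v \<plusminus> flip v\<close>, which works since \<open>2\<close> is invertible.
\<close>
lemma homogeneous_component:
  assumes Y: "submodule Y A M" and y: "y \<in> carrier M" "y \<notin> Y"
  obtains r \<zeta> \<epsilon> where "r \<in> carrier A" "r \<odot>\<^bsub>M\<^esub> y \<notin> Y" "homogeneous M (r \<odot>\<^bsub>M\<^esub> y) \<zeta> \<epsilon>"
proof -
  note D = submoduleD[OF Y]
  obtain l :: "'k \<Rightarrow> 'k poly" where l: "(\<Sum>\<zeta>\<in>unity_roots t. l \<zeta>) = 1"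
    "\<And>\<zeta>. \<zeta> \<in> unity_roots t \<Longrightarrow> u dvd [:-\<zeta>, 1:] * l \<zeta>"
    using lagrange_unity[OF not_dvd] by metis
  have "(\<Sum>\<zeta>\<in>unity_roots t. l \<zeta> ^ q) = (\<Sum>\<zeta>\<in>unity_roots t. l \<zeta>) ^ q"
    by (rule freshmans_dream_sum'[symmetric, where n = s]) (use prime_char in \<open>simp_all add: q_eq\<close>)
  then have sum1: "(\<Sum>\<zeta>\<in>unity_roots t. l \<zeta> ^ q) = 1" by (simp add: l(1))
  have "\<exists>\<zeta>\<in>unity_roots t. l \<zeta> ^ q \<bullet> y \<notin> Y"
  proof (rule ccontr)
    assume neg: "\<not> ?thesis"
    have "(\<Sum>\<zeta>\<in>S. l \<zeta> ^ q) \<bullet> y \<in> Y" if "finite S" "S \<subseteq> unity_roots t" for S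
      using that
    proof (induction S)
      case (insert \<zeta> S)
      then have "l \<zeta> ^ q \<bullet> y \<in> Y" using neg by blast
      with insert show ?case using D(3) y(1) by (simp add: act_add)
    qed (use y(1) D(2) in simp)
    from this[OF finite_unity_roots[OF t_pos]] y show False by (simp add: sum1)
  qed
  then obtain \<zeta> where \<zeta>: "\<zeta> \<in> unity_roots t" and ly: "l \<zeta> ^ q \<bullet> y \<notin> Y" by blast
  have \<zeta>t: "\<zeta> ^ t = 1" using \<zeta> by (simp add: unity_roots_def)
  define z where "z = l \<zeta> ^ q \<bullet> y"
  have z: "z \<in> carrier M" "z \<notin> Y" using y ly by (auto simp: z_def)
  have "unity_poly n dvd primary \<zeta> * l \<zeta> ^ q"
    using dvd_power_same[OF l(2)[OF \<zeta>], of q] by (simp only: unity_power power_mult_distrib)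
  then have pz: "primary \<zeta> \<bullet> z = \<zero>\<^bsub>M\<^esub>"
    unfolding z_def using act_dvd[OF y(1) _ act_unity[OF y(1)]] y(1) by (simp only: flip: act_mult)
  have z_eq: "z = \<Phi> (l \<zeta> ^ q) \<odot>\<^bsub>M\<^esub> y" by (simp add: z_def act_def)
  show ?thesis
  proof (cases "\<zeta> ^ 2 = 1")
    case False
    have "homogeneous M z \<zeta> 1"
      using z pz \<zeta>t False by (simp add: homogeneous_def act_def)
    then show ?thesis using z by (intro that[of "\<Phi> (l \<zeta> ^ q)"]) (simp_all add: z_eq)
  next
    case True
    define w where "w \<epsilon> = z \<oplus>\<^bsub>M\<^esub> \<eta> \<epsilon> \<odot>\<^bsub>M\<^esub> flip z" for \<epsilon>
    have w: "w \<epsilon> \<in> carrier M" for \<epsilon> using z(1) by (simp add: w_def)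
    have "\<exists>\<epsilon>\<in>{1, -1}. w \<epsilon> \<notin> Y"
    proof (rule ccontr)
      assume "\<not> ?thesis"
      then have "w 1 \<oplus>\<^bsub>M\<^esub> w (-1) \<in> Y" using D(3) by blast
      moreover have "w 1 \<oplus>\<^bsub>M\<^esub> w (-1) = (z \<oplus>\<^bsub>M\<^esub> z) \<oplus>\<^bsub>M\<^esub> (\<eta> 1 \<odot>\<^bsub>M\<^esub> flip z \<oplus>\<^bsub>M\<^esub> \<eta> (-1) \<odot>\<^bsub>M\<^esub> flip z)"
        using z(1) by (simp add: w_def M.a_ac del: scalar_one)
      moreover have "\<eta> 1 \<odot>\<^bsub>M\<^esub> flip z \<oplus>\<^bsub>M\<^esub> \<eta> (-1) \<odot>\<^bsub>M\<^esub> flip z = \<eta> (1 + - 1) \<odot>\<^bsub>M\<^esub> flip z"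
        using z(1) by (simp only: scalar_add smult_l_distr scalar_closed flip_closed)
      moreover have "z \<oplus>\<^bsub>M\<^esub> z = [:2:] \<bullet> z"
      proof -
        have "[:2:] = (1 + 1 :: 'k poly)" by (simp add: one_pCons)
        then show ?thesis using z(1) by (simp only: act_add act_1)
      qed
      ultimately have "[:1/2:] \<bullet> [:2:] \<bullet> z \<in> Y"
        using z(1) submodule_act[OF Y] by simp
      then show False using z two_nonzero using act_mult[of z "[:1/2:]" "[:2:]"] by (simp add: act_const)
    qed
    then obtain \<epsilon> where \<epsilon>: "\<epsilon> \<in> {1, -1 :: 'k}" "w \<epsilon> \<notin> Y" by blast
    have \<epsilon>2: "\<epsilon> * \<epsilon> = 1" using \<epsilon>(1) by auto
    have "flip (w \<epsilon>) = \<eta> \<epsilon> \<odot>\<^bsub>M\<^esub> w \<epsilon>"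
    proof -
      have "\<eta> \<epsilon> \<odot>\<^bsub>M\<^esub> w \<epsilon> = \<eta> \<epsilon> \<odot>\<^bsub>M\<^esub> z \<oplus>\<^bsub>M\<^esub> \<eta> (\<epsilon> * \<epsilon>) \<odot>\<^bsub>M\<^esub> flip z"
        using z(1) by (simp add: w_def smult_r_distr scalar_mult smult_assoc1)
      then show ?thesis
        using z(1) by (simp add: w_def flip_add flip_scalar \<epsilon>2 M.a_comm)
    qed
    moreover have "primary \<zeta> \<bullet> flip z = \<zero>\<^bsub>M\<^esub>"
      using primary_flip[OF z(1) \<zeta>t pz] involutive_root[OF True] by simp
    then have "primary \<zeta> \<bullet> w \<epsilon> = \<zero>\<^bsub>M\<^esub>"
      using z(1) pz primary_act[of "flip z" \<zeta> "[:\<epsilon>:]"]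
      by (simp add: w_def act_distrib act_const)
    ultimately have "homogeneous M (w \<epsilon>) \<zeta> \<epsilon>"
      using w \<zeta>t True \<epsilon>(1) by (simp add: homogeneous_def act_def flip_def)
    moreover have "w \<epsilon> = ((\<one> \<oplus> \<eta> \<epsilon> \<otimes> \<beta>) \<otimes> \<Phi> (l \<zeta> ^ q)) \<odot>\<^bsub>M\<^esub> y"
      using y(1) by (simp add: w_def z_eq flip_def smult_l_distr smult_assoc1)
    ultimately show ?thesis using \<epsilon>(2) by (intro that[of "(\<one> \<oplus> \<eta> \<epsilon> \<otimes> \<beta>) \<otimes> \<Phi> (l \<zeta> ^ q)"]) auto
  qed
qed

text \<open>In particular \<open>u\<close> maps \<open>cyclic v\<close> onto its radical.\<close>
lemma cyclic_act_unity:
  assumes v: "v \<in> carrier M" and z: "z \<in> cyclic (u \<bullet> v)"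
  obtains w where "w \<in> cyclic v" "z = u \<bullet> w"
proof -
  obtain r where r: "r \<in> carrier A" "z = r \<odot>\<^bsub>M\<^esub> (u \<bullet> v)" using z by (auto simp: cyclic_def)
  obtain f g where fg: "\<And>v. v \<in> carrier M \<Longrightarrow> r \<odot>\<^bsub>M\<^esub> v = f \<bullet> v \<oplus>\<^bsub>M\<^esub> g \<bullet> flip v"
    using spanned_act[OF r(1)] by blast
  obtain h where h: "star u = u * h" using unity_dvd_star[of 1] by (auto elim: dvdE)
  have "z = u \<bullet> (f \<bullet> v \<oplus>\<^bsub>M\<^esub> g \<bullet> h \<bullet> flip v)"
    using v by (simp add: r(2) fg flip_act h act_mult act_distrib act_commute[of _ _ u])
  moreover have "f \<bullet> v \<oplus>\<^bsub>M\<^esub> g \<bullet> h \<bullet> flip v \<in> cyclic v"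
    using submodule_cyclic[OF v] cyclic_self[OF v]
    by (simp add: submoduleD(3) submodule_act submodule_flip)
  ultimately show ?thesis using that by blast
qed

text \<open>
  If \<open>u\<close> is nilpotent of order \<open>l + 1\<close> on the whole module, a homogeneous element not killed
  by \<open>u\<^sup>l\<close> generates a direct summand. Let \<open>W\<close> be maximal among the submodules that meet
  \<open>cyclic v\<close> trivially. Were \<open>cyclic v + W\<close> proper, multiplying by \<open>u\<close> would lead to some
  \<open>y\<close> outside with \<open>u \<bullet> y = x + w\<close> inside. Here \<open>u^l \<bullet> x = 0\<close> since \<open>u^(l+1)\<close> kills
  \<open>y\<close>, so \<open>x = u \<bullet> x'\<close> with \<open>x'\<close> in \<open>cyclic v\<close>, and \<open>y - x'\<close> is mapped into \<open>W\<close>. A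
  homogeneous component of it spans, together with \<open>W\<close>, a larger submodule that still meets
  \<open>cyclic v\<close> trivially.
\<close>
lemma cyclic_complement:
  assumes nil: "\<And>w. w \<in> carrier M \<Longrightarrow> u ^ Suc l \<bullet> w = \<zero>\<^bsub>M\<^esub>"
    and v: "homogeneous M v \<zeta> \<epsilon>" "u ^ l \<bullet> v \<noteq> \<zero>\<^bsub>M\<^esub>"
  obtains W where "submodule W A M" "cyclic v \<inter> W = {\<zero>\<^bsub>M\<^esub>}" "cyclic v <+>\<^bsub>M\<^esub> W = carrier M"
proof -
  have vM: "v \<in> carrier M" by (rule homogeneousD[OF v(1)])
  let ?U = "cyclic v"
  have U: "submodule ?U A M" by (rule submodule_cyclic[OF vM])
  obtain W where W: "submodule W A M" "?U \<inter> W = {\<zero>\<^bsub>M\<^esub>}"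
    and max: "\<And>W'. submodule W' A M \<Longrightarrow> ?U \<inter> W' = {\<zero>\<^bsub>M\<^esub>} \<Longrightarrow> W \<subseteq> W' \<Longrightarrow> W' = W"
    using maximal_disjoint_submodule[OF U] by metis
  define Y where "Y = ?U <+>\<^bsub>M\<^esub> W"
  have Y: "submodule Y A M" unfolding Y_def by (rule submodule_set_add[OF U W(1)])
  have UY: "?U \<subseteq> Y" and WY: "W \<subseteq> Y" unfolding Y_def by (rule set_add_upper[OF U W(1)])+
  note UD = submoduleD[OF U] and WD = submoduleD[OF W(1)] and YD = submoduleD[OF Y]
  have "Y = carrier M"
  proof (rule ccontr)
    assume "Y \<noteq> carrier M"
    then obtain y0 where y0: "y0 \<in> carrier M" "y0 \<notin> Y" using YD(1) by blast
    \<comment> \<open>The last multiple of \<open>y0\<close> by a power of \<open>u\<close> that is still outside \<open>Y\<close>.\<close>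
    define i where "i = (LEAST i. u ^ i \<bullet> y0 \<in> Y)"
    have "u ^ Suc l \<bullet> y0 \<in> Y" using nil[OF y0(1)] YD(2) by simp
    then have i: "u ^ i \<bullet> y0 \<in> Y" unfolding i_def by (rule LeastI)
    moreover have "u ^ 0 \<bullet> y0 \<notin> Y" using y0 by simp
    ultimately obtain j where j: "i = Suc j" by (metis not0_implies_Suc)
    define y1 where "y1 = u ^ j \<bullet> y0"
    have y1: "y1 \<in> carrier M" "u \<bullet> y1 \<in> Y"
      using y0(1) i by (simp_all add: y1_def j act_mult)
    have y1Y: "y1 \<notin> Y" unfolding y1_def using not_less_Least[of j "\<lambda>i. u ^ i \<bullet> y0 \<in> Y"] j by (simp add: i_def)
    obtain x w where xw: "x \<in> ?U" "w \<in> W" "u \<bullet> y1 = x \<oplus>\<^bsub>M\<^esub> w"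
      using y1(2) by (auto simp: Y_def set_add_iff)
    have xM: "x \<in> carrier M" and wM: "w \<in> carrier M" using UD(1) WD(1) xw by auto
    have "u ^ l \<bullet> x \<oplus>\<^bsub>M\<^esub> u ^ l \<bullet> w = \<zero>\<^bsub>M\<^esub>"
      using nil[OF y1(1)] xw(3) xM wM y1(1)
      by (simp add: power_Suc2 act_mult act_distrib del: power_Suc)
    then have "u ^ l \<bullet> x = \<ominus>\<^bsub>M\<^esub> (u ^ l \<bullet> w)"
      using xM wM by (intro M.minus_equality[symmetric]) auto
    also have "\<dots> \<in> W" using submodule_act[OF W(1) xw(2)] WD(5) by blast
    finally have "u ^ l \<bullet> x \<in> W" .
    then have ulx: "u ^ l \<bullet> x = \<zero>\<^bsub>M\<^esub>" using submodule_act[OF U xw(1)] W(2) by blast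
    let ?K = "{w \<in> carrier M. u ^ l \<bullet> w = \<zero>\<^bsub>M\<^esub>}"
    obtain r where r: "r \<in> carrier A" "x = r \<odot>\<^bsub>M\<^esub> v" using xw(1) by (auto simp: cyclic_def)
    have "r \<odot>\<^bsub>M\<^esub> v \<in> cyclic (u \<bullet> v)"
      by (rule homogeneous_local[OF v(1) submodule_kernel[of l] _ r(1)]) (use v(2) ulx r xM in auto)
    then obtain x' where x': "x' \<in> ?U" "x = u \<bullet> x'" unfolding r(2)[symmetric]
      using cyclic_act_unity[OF vM] by metis
    have x'M: "x' \<in> carrier M" by (rule UD(1)[OF x'(1)])
    define y2 where "y2 = y1 \<oplus>\<^bsub>M\<^esub> \<ominus>\<^bsub>M\<^esub> x'"
    have y2: "y2 \<in> carrier M" using y1(1) x'M by (simp add: y2_def)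
    have y1_eq: "y1 = y2 \<oplus>\<^bsub>M\<^esub> x'" using y1(1) x'M by (simp add: y2_def M.a_assoc M.l_neg)
    have y2Y: "y2 \<notin> Y" using y1Y y1_eq YD(3) x'(1) UY by blast
    have "u \<bullet> y2 \<oplus>\<^bsub>M\<^esub> x = w \<oplus>\<^bsub>M\<^esub> x"
      using xw(3) y1_eq y2 x'M x'(2) xM wM by (simp add: act_distrib M.a_comm)
    then have "u \<bullet> y2 \<in> W" using xM wM y2 xw(2) by simp
    obtain r' \<xi> \<delta> where r': "r' \<in> carrier A" "r' \<odot>\<^bsub>M\<^esub> y2 \<notin> Y"
      and hom: "homogeneous M (r' \<odot>\<^bsub>M\<^esub> y2) \<xi> \<delta>"
      by (rule homogeneous_component[OF Y y2 y2Y])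
    define y where "y = r' \<odot>\<^bsub>M\<^esub> y2"
    have y: "y \<in> carrier M" "y \<notin> Y" using r' y2 by (auto simp: y_def)
    have "y2 \<in> {w \<in> carrier M. u ^ 1 \<bullet> w \<in> W}" using y2 \<open>u \<bullet> y2 \<in> W\<close> by simp
    then have "y \<in> {w \<in> carrier M. u ^ 1 \<bullet> w \<in> W}"
      unfolding y_def by (rule submoduleD(4)[OF submodule_preimage[OF W(1)] r'(1)])
    then have uy: "u \<bullet> y \<in> W" by simp
    let ?C = "cyclic y"
    have C: "submodule ?C A M" by (rule submodule_cyclic[OF y(1)])
    have CW: "z \<in> W" if "z \<in> ?C" "z \<in> Y" for z
    proof -
      obtain s where s: "s \<in> carrier A" "z = s \<odot>\<^bsub>M\<^esub> y" using \<open>z \<in> ?C\<close> by (auto simp: cyclic_def)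
      have "s \<odot>\<^bsub>M\<^esub> y \<in> cyclic (u \<bullet> y)"
        using homogeneous_local[OF hom[folded y_def] Y y(2) s(1)] \<open>z \<in> Y\<close> s(2) by simp
      then show ?thesis using cyclic_subset[OF W(1) uy] s(2) by blast
    qed
    have "?U \<inter> (W <+>\<^bsub>M\<^esub> ?C) = {\<zero>\<^bsub>M\<^esub>}"
    proof
      show "{\<zero>\<^bsub>M\<^esub>} \<subseteq> ?U \<inter> (W <+>\<^bsub>M\<^esub> ?C)"
        using UD(2) submoduleD(2)[OF submodule_set_add[OF W(1) C]] by simp
      show "?U \<inter> (W <+>\<^bsub>M\<^esub> ?C) \<subseteq> {\<zero>\<^bsub>M\<^esub>}"
      proof
        fix x assume "x \<in> ?U \<inter> (W <+>\<^bsub>M\<^esub> ?C)"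
        then obtain w z where *: "x \<in> ?U" "w \<in> W" "z \<in> ?C" "x = w \<oplus>\<^bsub>M\<^esub> z" by (auto simp: set_add_iff)
        have M: "w \<in> carrier M" "z \<in> carrier M" using * WD(1) submoduleD(1)[OF C] by auto
        have "z = \<ominus>\<^bsub>M\<^esub> w \<oplus>\<^bsub>M\<^esub> x" using M by (simp add: *(4) M.l_neg flip: M.a_assoc)
        also have "\<dots> \<in> Y" using * UY WY WD(5) YD(3) by blast
        finally have "z \<in> W" using CW *(3) by blast
        then have "x \<in> W" using * WD(3) by blast
        then show "x \<in> {\<zero>\<^bsub>M\<^esub>}" using *(1) W(2) by blast
      qed
    qed
    then have "W <+>\<^bsub>M\<^esub> ?C = W"
      by (rule max[OF submodule_set_add[OF W(1) C] _ set_add_upper(1)[OF W(1) C]])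
    then have "y \<in> W" using set_add_upper(2)[OF W(1) C] cyclic_self[OF y(1)] by blast
    with WY y(2) show False by blast
  qed
  with W show ?thesis unfolding Y_def by (rule that)
qed

end

section \<open>Labels of indecomposable modules\<close>

context dihedral_module
begin

lemma generatorD:
  assumes "generator M v \<zeta> \<epsilon> l"
  shows "homogeneous M v \<zeta> \<epsilon>" "u ^ l \<bullet> v \<noteq> \<zero>\<^bsub>M\<^esub>" "u ^ Suc l \<bullet> v = \<zero>\<^bsub>M\<^esub>" "carrier M = cyclic v"
  using assms by (auto simp: generator_def act_def cyclic_def)

lemma generatorI:
  assumes "homogeneous M v \<zeta> \<epsilon>" "u ^ l \<bullet> v \<noteq> \<zero>\<^bsub>M\<^esub>" "u ^ Suc l \<bullet> v = \<zero>\<^bsub>M\<^esub>" "carrier M = cyclic v"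
  shows "generator M v \<zeta> \<epsilon> l"
  using assms by (auto simp: generator_def act_def cyclic_def)

lemma unity_q_act: "w \<in> carrier M \<Longrightarrow> u ^ q \<bullet> w = \<zero>\<^bsub>M\<^esub>"
  using act_unity by (simp add: unity_power)

lemma generator_length: "generator M v \<zeta> \<epsilon> l \<Longrightarrow> l < q"
proof (rule ccontr)
  assume v: "generator M v \<zeta> \<epsilon> l" and "\<not> l < q"
  then have "u ^ q dvd u ^ l" by (intro le_imp_power_dvd) simp
  moreover have "v \<in> carrier M" using homogeneousD(1)[OF generatorD(1)[OF v]] .
  ultimately show False using act_dvd unity_q_act generatorD(2)[OF v] by blast
qed

lemma generator_nilpotent:
  assumes v: "generator M v \<zeta> \<epsilon> l" and w: "w \<in> carrier M"
  shows "u ^ Suc l \<bullet> w = \<zero>\<^bsub>M\<^esub>"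
proof -
  have "v \<in> {w \<in> carrier M. u ^ Suc l \<bullet> w = \<zero>\<^bsub>M\<^esub>}"
    using generatorD[OF v] homogeneousD(1) by blast
  from cyclic_subset[OF submodule_kernel this] w show ?thesis
    unfolding generatorD(4)[OF v] by blast
qed

text \<open>
  A module with a generator is local: a submodule that does not contain the generator lies in
  the radical, on which \<open>u\<^sup>l\<close> vanishes, so two such submodules cannot add up to everything.
\<close>
lemma generator_indecomposable:
  assumes v: "generator M v \<zeta> \<epsilon> l"
  shows "indecomposable_module A M"
  unfolding indecomposable_module_def
proof (intro conjI allI impI)
  note h = generatorD(1)[OF v]
  have vM: "v \<in> carrier M" by (rule homogeneousD(1)[OF h])
  show "left_module A M" by unfold_locales
  have "v \<noteq> \<zero>\<^bsub>M\<^esub>" using generatorD(2)[OF v] by auto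
  with vM show "carrier M \<noteq> {\<zero>\<^bsub>M\<^esub>}" by blast
  fix U V assume "submodule U A M \<and> submodule V A M \<and> U <+>\<^bsub>M\<^esub> V = carrier M \<and> U \<inter> V = {\<zero>\<^bsub>M\<^esub>}"
  then have U: "submodule U A M" and V: "submodule V A M" and UV: "U <+>\<^bsub>M\<^esub> V = carrier M"
    and int: "U \<inter> V = {\<zero>\<^bsub>M\<^esub>}" by auto
  have full: "Y = carrier M" if "submodule Y A M" "v \<in> Y" for Y
    using cyclic_subset[OF that] submoduleD(1)[OF that(1)] generatorD(4)[OF v] by blast
  have kill: "u ^ l \<bullet> y = \<zero>\<^bsub>M\<^esub>" if Y: "submodule Y A M" "v \<notin> Y" and y: "y \<in> Y" for Y y
  proof -
    have "y \<in> cyclic v" using y submoduleD(1)[OF Y(1)] generatorD(4)[OF v] by blast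
    then obtain r where r: "r \<in> carrier A" "y = r \<odot>\<^bsub>M\<^esub> v" by (auto simp: cyclic_def)
    have "y \<in> cyclic (u \<bullet> v)" using homogeneous_local[OF h Y r(1)] r(2) y by simp
    moreover have "u \<bullet> v \<in> {w \<in> carrier M. u ^ l \<bullet> w = \<zero>\<^bsub>M\<^esub>}"
      using generatorD(3)[OF v] vM by (simp add: power_Suc2 act_mult del: power_Suc)
    ultimately show ?thesis using cyclic_subset[OF submodule_kernel] by blast
  qed
  have "v \<in> U \<or> v \<in> V"
  proof (rule ccontr)
    assume neg: "\<not> ?thesis"
    obtain x y where xy: "x \<in> U" "y \<in> V" "v = x \<oplus>\<^bsub>M\<^esub> y" using vM by (auto simp: UV[symmetric] set_add_iff)
    have "x \<in> carrier M" "y \<in> carrier M" using xy submoduleD(1)[OF U] submoduleD(1)[OF V] by auto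
    then have "u ^ l \<bullet> v = \<zero>\<^bsub>M\<^esub>"
      using kill[OF U] kill[OF V] neg xy by (simp add: act_distrib)
    with generatorD(2)[OF v] show False by simp
  qed
  then have "U = carrier M \<or> V = carrier M" using full U V by blast
  then show "U = {\<zero>\<^bsub>M\<^esub>} \<or> V = {\<zero>\<^bsub>M\<^esub>}"
    using int submoduleD(1)[OF U] submoduleD(1)[OF V] by blast
qed

text \<open>
  Choose \<open>l\<close> largest with \<open>u^l\<close> nonzero on the module, and a homogeneous element \<open>v\<close> not
  killed by \<open>u^l\<close>. Its cyclic module is a nonzero direct summand, hence everything.
\<close>
lemma indecomposable_generator:
  assumes ind: "indecomposable_module A M"
  obtains v \<zeta> \<epsilon> l where "generator M v \<zeta> \<epsilon> l"
proof -
  obtain y where y: "y \<in> carrier M" "y \<noteq> \<zero>\<^bsub>M\<^esub>"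
    using ind M.zero_closed unfolding indecomposable_module_def by blast
  define l where "l = (LEAST l. \<forall>w\<in>carrier M. u ^ Suc l \<bullet> w = \<zero>\<^bsub>M\<^esub>)"
  have "\<forall>w\<in>carrier M. u ^ Suc (q - 1) \<bullet> w = \<zero>\<^bsub>M\<^esub>" using unity_q_act q_pos by simp
  then have nil: "\<forall>w\<in>carrier M. u ^ Suc l \<bullet> w = \<zero>\<^bsub>M\<^esub>" unfolding l_def by (rule LeastI)
  have "\<exists>w\<in>carrier M. u ^ l \<bullet> w \<noteq> \<zero>\<^bsub>M\<^esub>"
  proof (cases l)
    case 0
    then show ?thesis using y by (auto intro!: bexI[of _ y])
  next
    case (Suc k)
    then show ?thesis
      using not_less_Least[of k "\<lambda>l. \<forall>w\<in>carrier M. u ^ Suc l \<bullet> w = \<zero>\<^bsub>M\<^esub>"] by (simp add: l_def)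
  qed
  then obtain w where w: "w \<in> carrier M" "w \<notin> {w \<in> carrier M. u ^ l \<bullet> w = \<zero>\<^bsub>M\<^esub>}" by blast
  obtain r \<zeta> \<epsilon> where r: "r \<in> carrier A" "r \<odot>\<^bsub>M\<^esub> w \<notin> {w \<in> carrier M. u ^ l \<bullet> w = \<zero>\<^bsub>M\<^esub>}"
    and h: "homogeneous M (r \<odot>\<^bsub>M\<^esub> w) \<zeta> \<epsilon>"
    by (rule homogeneous_component[OF submodule_kernel w])
  define v where "v = r \<odot>\<^bsub>M\<^esub> w"
  have v: "v \<in> carrier M" "u ^ l \<bullet> v \<noteq> \<zero>\<^bsub>M\<^esub>" using r w(1) by (auto simp: v_def)
  obtain W where W: "submodule W A M" "cyclic v \<inter> W = {\<zero>\<^bsub>M\<^esub>}" "cyclic v <+>\<^bsub>M\<^esub> W = carrier M"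
    using cyclic_complement[OF _ h[folded v_def] v(2)] nil by blast
  have "v \<noteq> \<zero>\<^bsub>M\<^esub>" using v(2) by auto
  then have "cyclic v \<noteq> {\<zero>\<^bsub>M\<^esub>}" using cyclic_self[OF v(1)] by blast
  then have "W = {\<zero>\<^bsub>M\<^esub>}"
    using ind W submodule_cyclic[OF v(1)] unfolding indecomposable_module_def by blast
  then have "carrier M = cyclic v"
    using W(3) submoduleD(1)[OF submodule_cyclic[OF v(1)]] by (auto simp: set_add_iff)
  then have "generator M v \<zeta> \<epsilon> l"
    using h nil v by (intro generatorI) (auto simp: v_def)
  then show ?thesis by (rule that)
qed

text \<open>
  On the primary component \<open>u\<close> and \<open>X - \<zeta>\<close> differ by an invertible factor, so \<open>v\<close> has
  the same order under both, and \<open>k[X] \<bullet> v\<close> is \<open>k[X]/(X - \<zeta>)^(l+1)\<close>.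
\<close>
lemma act_zero_iff_dvd:
  assumes v: "homogeneous M v \<zeta> \<epsilon>" "u ^ l \<bullet> v \<noteq> \<zero>\<^bsub>M\<^esub>" "u ^ Suc l \<bullet> v = \<zero>\<^bsub>M\<^esub>"
  shows "f \<bullet> v = \<zero>\<^bsub>M\<^esub> \<longleftrightarrow> [:-\<zeta>, 1:] ^ Suc l dvd f"
proof -
  note vD = homogeneousD[OF v(1)]
  obtain h where h: "u = [:-\<zeta>, 1:] * h" "poly h \<zeta> \<noteq> 0"
    using unity_poly_simple_root[OF not_dvd vD(2)] .
  have pow: "[:-\<zeta>, 1:] ^ i \<bullet> v = \<zero>\<^bsub>M\<^esub> \<longleftrightarrow> u ^ i \<bullet> v = \<zero>\<^bsub>M\<^esub>" for i
  proof
    assume "u ^ i \<bullet> v = \<zero>\<^bsub>M\<^esub>"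
    then have "h ^ i \<bullet> [:-\<zeta>, 1:] ^ i \<bullet> v = \<zero>\<^bsub>M\<^esub>"
      using vD(1) by (simp only: h(1) power_mult_distrib act_mult act_commute)
    moreover have "poly (h ^ i) \<zeta> \<noteq> 0" using h(2) by simp
    ultimately show "[:-\<zeta>, 1:] ^ i \<bullet> v = \<zero>\<^bsub>M\<^esub>"
      using act_eq_zero_cancel primary_act vD act_closed by metis
  next
    assume "[:-\<zeta>, 1:] ^ i \<bullet> v = \<zero>\<^bsub>M\<^esub>"
    then show "u ^ i \<bullet> v = \<zero>\<^bsub>M\<^esub>"
      unfolding h(1) power_mult_distrib by (rule act_dvd[OF vD(1) dvd_triv_left])
  qed
  show ?thesis
  proof
    assume "[:-\<zeta>, 1:] ^ Suc l dvd f"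
    then show "f \<bullet> v = \<zero>\<^bsub>M\<^esub>" using act_dvd[OF vD(1)] pow v(3) by blast
  next
    assume fv: "f \<bullet> v = \<zero>\<^bsub>M\<^esub>"
    show "[:-\<zeta>, 1:] ^ Suc l dvd f"
    proof (rule ccontr)
      assume nd: "\<not> [:-\<zeta>, 1:] ^ Suc l dvd f"
      then have f0: "f \<noteq> 0" and ord: "Polynomial.order \<zeta> f \<le> l" by (auto simp: order_divides simp del: power_Suc)
      define j where "j = Polynomial.order \<zeta> f"
      obtain g where g: "f = [:-\<zeta>, 1:] ^ j * g" "\<not> [:-\<zeta>, 1:] dvd g"
        using order_decomp[OF f0] unfolding j_def by blast
      have "poly g \<zeta> \<noteq> 0" using g(2) by (simp add: poly_eq_0_iff_dvd)
      moreover have "g \<bullet> [:-\<zeta>, 1:] ^ j \<bullet> v = \<zero>\<^bsub>M\<^esub>"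
        using fv vD(1) by (simp only: g(1) act_mult act_commute)
      ultimately have "[:-\<zeta>, 1:] ^ j \<bullet> v = \<zero>\<^bsub>M\<^esub>"
        using act_eq_zero_cancel primary_act vD act_closed by metis
      then have "u ^ j \<bullet> v = \<zero>\<^bsub>M\<^esub>" using pow by blast
      then have "u ^ l \<bullet> v = \<zero>\<^bsub>M\<^esub>"
        using act_dvd[OF vD(1) le_imp_power_dvd] ord by (simp add: j_def)
      with v(2) show False by simp
    qed
  qed
qed

text \<open>
  The right-hand side depends on the label alone. Modules with generators of the same label are
  therefore quotients of the algebra by the same left ideal.
\<close>
lemma generator_annihilator:
  assumes v: "generator M v \<zeta> \<epsilon> l"
  shows "(\<Phi> f \<oplus> \<Phi> g \<otimes> \<beta>) \<odot>\<^bsub>M\<^esub> v = \<zero>\<^bsub>M\<^esub> \<longleftrightarrow>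
    (if \<zeta> ^ 2 = 1 then [:-\<zeta>, 1:] ^ Suc l dvd f + Polynomial.smult \<epsilon> g
     else [:-\<zeta>, 1:] ^ Suc l dvd f \<and> [:-\<zeta>, 1:] ^ Suc l dvd star g)"
proof -
  note gD = generatorD[OF v] and h = generatorD(1)[OF v]
  note vD = homogeneousD[OF h]
  note ann = act_zero_iff_dvd[OF gD(1-3)]
  have eq: "(\<Phi> f \<oplus> \<Phi> g \<otimes> \<beta>) \<odot>\<^bsub>M\<^esub> v = f \<bullet> v \<oplus>\<^bsub>M\<^esub> g \<bullet> flip v"
    using vD(1) by (simp add: act_def flip_def smult_l_distr smult_assoc1)
  show ?thesis
  proof (cases "\<zeta> ^ 2 = 1")
    case True
    then show ?thesis unfolding eq fold_components[OF h True] ann by simp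
  next
    case False
    have "f \<bullet> v \<oplus>\<^bsub>M\<^esub> g \<bullet> flip v = \<zero>\<^bsub>M\<^esub> \<longleftrightarrow> f \<bullet> v = \<zero>\<^bsub>M\<^esub> \<and> star g \<bullet> v = \<zero>\<^bsub>M\<^esub>"
    proof
      assume "f \<bullet> v \<oplus>\<^bsub>M\<^esub> g \<bullet> flip v = \<zero>\<^bsub>M\<^esub>"
      then show "f \<bullet> v = \<zero>\<^bsub>M\<^esub> \<and> star g \<bullet> v = \<zero>\<^bsub>M\<^esub>"
        using split_components[OF submodule_zero vD(1-3) False, of f g] by simp
    qed (use vD(1) in \<open>simp add: act_flip\<close>)
    then show ?thesis unfolding eq ann using False by simp
  qed
qed

text \<open>
  The length is the nilpotency index of \<open>u\<close>, the pair \<open>{\<zeta>, 1/\<zeta>}\<close> is the set of roots of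
  unity with nonzero primary component, and the sign is the action of the involution on the
  top of the module.
\<close>
lemma generator_unique:
  assumes v: "generator M v \<zeta> \<epsilon> l" and w: "generator M w \<xi> \<delta> m"
  shows "l = m" "\<xi> = \<zeta> \<or> \<xi> = inverse \<zeta>" "\<zeta> ^ 2 = 1 \<Longrightarrow> \<epsilon> = \<delta>"
proof -
  note vg = generatorD[OF v] and wg = generatorD[OF w]
  note vD = homogeneousD[OF vg(1)] and wD = homogeneousD[OF wg(1)]
  have le: "l' \<le> l"
    if v: "generator M v \<zeta> \<epsilon> l" and w: "generator M w \<xi> \<delta> l'" for v w \<zeta> \<xi> \<epsilon> \<delta> l l'
  proof (rule ccontr)
    assume "\<not> l' \<le> l"
    then have "u ^ Suc l dvd u ^ l'" by (intro le_imp_power_dvd) simp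
    moreover have "w \<in> carrier M" using homogeneousD(1)[OF generatorD(1)[OF w]] .
    ultimately show False
      using act_dvd generator_nilpotent[OF v] generatorD(2)[OF w] by blast
  qed
  show lm: "l = m" using le[OF v w] le[OF w v] by simp
  have w0: "w \<noteq> \<zero>\<^bsub>M\<^esub>" using wg(2) by auto
  obtain r where r: "r \<in> carrier A" "w = r \<odot>\<^bsub>M\<^esub> v"
    using wD(1) unfolding vg(4) by (auto simp: cyclic_def)
  obtain f g where "\<And>v. v \<in> carrier M \<Longrightarrow> r \<odot>\<^bsub>M\<^esub> v = f \<bullet> v \<oplus>\<^bsub>M\<^esub> g \<bullet> flip v"
    using spanned_act[OF r(1)] by blast
  then have w_eq: "w = f \<bullet> v \<oplus>\<^bsub>M\<^esub> g \<bullet> flip v" using vD(1) r(2) by blast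
  show "\<xi> = \<zeta> \<or> \<xi> = inverse \<zeta>"
  proof (rule ccontr)
    assume neg: "\<not> ?thesis"
    let ?e = "primary \<zeta> * primary (inverse \<zeta>)"
    have "?e \<bullet> w = primary (inverse \<zeta>) \<bullet> f \<bullet> primary \<zeta> \<bullet> v \<oplus>\<^bsub>M\<^esub>
        primary \<zeta> \<bullet> g \<bullet> primary (inverse \<zeta>) \<bullet> flip v"
      unfolding w_eq using vD(1)
      by (simp only: act_distrib act_mult act_closed flip_closed act_commute[of _ "primary \<zeta>" "primary (inverse \<zeta>)"]
          act_commute[of _ f] act_commute[of _ g])
    also have "\<dots> = \<zero>\<^bsub>M\<^esub>" using vD primary_flip[OF vD(1-3)] by simp
    finally have "?e \<bullet> w = \<zero>\<^bsub>M\<^esub>" .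
    moreover have "poly ?e \<xi> \<noteq> 0" using neg by simp
    ultimately show False using act_eq_zero_cancel[OF _ wD(1,3)] w0 by blast
  qed
  show "\<epsilon> = \<delta>" if \<zeta>2: "\<zeta> ^ 2 = 1"
  proof -
    define h where "h = f + Polynomial.smult \<epsilon> g"
    have w_h: "w = h \<bullet> v" unfolding h_def w_eq fold_components[OF vg(1) \<zeta>2] ..
    have \<xi>: "\<xi> = \<zeta>" using \<open>\<xi> = \<zeta> \<or> \<xi> = inverse \<zeta>\<close> involutive_root[OF \<zeta>2] by auto
    \<comment> \<open>Otherwise \<open>w\<close> would be in the radical and killed by \<open>u^l\<close>.\<close>
    have h0: "poly h \<zeta> \<noteq> 0"
    proof
      assume "poly h \<zeta> = 0"
      then obtain k where "w = k \<bullet> u \<bullet> v"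
        using act_root_factor[OF vD(2)] vD(1,3) unfolding w_h by metis
      then have "u ^ m \<bullet> w = k \<bullet> u ^ Suc l \<bullet> v"
        using vD(1) lm by (simp only: power_Suc2 act_mult act_commute[of _ k] act_closed)
      with vg(3) wg(2) show False by simp
    qed
    have "star h \<bullet> (\<eta> \<epsilon> \<odot>\<^bsub>M\<^esub> v) = \<eta> \<delta> \<odot>\<^bsub>M\<^esub> (h \<bullet> v)"
      using flip_act[OF vD(1), of h] vD(4)[OF \<zeta>2] wD(4) \<xi> \<zeta>2 by (simp flip: w_h)
    then have "Polynomial.smult \<epsilon> (star h) \<bullet> v = Polynomial.smult \<delta> h \<bullet> v"
      using vD(1) act_commute[OF vD(1), of "[:\<delta>:]" h] by (simp add: act_smult act_const)
    then have "(Polynomial.smult \<epsilon> (star h) + - Polynomial.smult \<delta> h) \<bullet> v = \<zero>\<^bsub>M\<^esub>"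
      using vD(1) by (simp only: act_add act_uminus M.r_neg act_closed)
    then have "[:-\<zeta>, 1:] ^ Suc l dvd Polynomial.smult \<epsilon> (star h) + - Polynomial.smult \<delta> h"
      by (simp only: act_zero_iff_dvd[OF vg(1-3)])
    then have "[:-\<zeta>, 1:] dvd Polynomial.smult \<epsilon> (star h) + - Polynomial.smult \<delta> h"
      by (rule dvd_trans[OF dvd_power, rotated]) simp
    then have "\<epsilon> * poly (star h) \<zeta> - \<delta> * poly h \<zeta> = 0"
      by (simp flip: poly_eq_0_iff_dvd)
    then show ?thesis
      using h0 root_star[OF vD(2)] involutive_root[OF \<zeta>2] by (simp add: poly_star)
  qed
qed

lemma generator_inverse:
  assumes v: "generator M v \<zeta> \<epsilon> l"  and \<zeta>2: "\<zeta> ^ 2 \<noteq> 1"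
  shows "generator M (flip v) (inverse \<zeta>) \<epsilon> l"
proof (rule generatorI)
  note vg = generatorD[OF v]
  note vD = homogeneousD[OF vg(1)]
  have "inverse \<zeta> ^ 2 \<noteq> 1" using \<zeta>2 by (simp add: power_inverse inverse_eq_1_iff)
  then show "homogeneous M (flip v) (inverse \<zeta>) \<epsilon>"
    using vD primary_flip[OF vD(1-3)] vg(1) \<zeta>2
    by (simp add: homogeneous_def power_inverse act_def)
  have *: "flip v \<in> carrier M" using vD(1) by simp
  show "carrier M = cyclic (flip v)"
  proof
    show "cyclic (flip v) \<subseteq> carrier M" using submoduleD(1)[OF submodule_cyclic[OF *]] by blast
    have "flip (flip v) \<in> cyclic (flip v)"
      by (rule submodule_flip[OF submodule_cyclic[OF *] cyclic_self[OF *]])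
    then show "carrier M \<subseteq> cyclic (flip v)"
      using cyclic_subset[OF submodule_cyclic[OF *]] vD(1) by (simp add: vg(4))
  qed
  show "u ^ Suc l \<bullet> flip v = \<zero>\<^bsub>M\<^esub>" by (rule generator_nilpotent[OF v *])
  show "u ^ l \<bullet> flip v \<noteq> \<zero>\<^bsub>M\<^esub>"
  proof
    assume "u ^ l \<bullet> flip v = \<zero>\<^bsub>M\<^esub>"
    then have "flip v \<in> {w \<in> carrier M. u ^ l \<bullet> w = \<zero>\<^bsub>M\<^esub>}" using * by simp
    from submodule_flip[OF submodule_kernel this] show False using vg(2) vD(1) by simp
  qed
qed

end

context dihedral_algebra
begin

lemma same_label_isomorphic:
  assumes M: "left_module A M" "generator M v \<zeta> \<epsilon> l" and N: "left_module A N" "generator N w \<zeta> \<epsilon> l"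
  shows "module_isomorphic A M N"
proof (rule cyclic_modules_isomorphic[OF M(1) N(1)])
  interpret M: left_module A M by fact
  interpret N: left_module A N by fact
  interpret M: dihedral_module A \<eta> \<alpha> \<beta> s t q n M ..
  interpret N: dihedral_module A \<eta> \<alpha> \<beta> s t q n N ..
  show "v \<in> carrier M" "w \<in> carrier N"
    and "carrier M = (\<lambda>r. r \<odot>\<^bsub>M\<^esub> v) ` carrier A" "carrier N = (\<lambda>r. r \<odot>\<^bsub>N\<^esub> w) ` carrier A"
    using M(2) N(2) unfolding generator_def homogeneous_def by blast+
  show "r \<odot>\<^bsub>M\<^esub> v = \<zero>\<^bsub>M\<^esub> \<longleftrightarrow> r \<odot>\<^bsub>N\<^esub> w = \<zero>\<^bsub>N\<^esub>" if r: "r \<in> carrier A" for r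
  proof -
    obtain f g where "r = \<Phi> f \<oplus> \<Phi> g \<otimes> \<beta>" using spanned[OF r] by blast
    then show ?thesis
      by (simp only: M.generator_annihilator[OF M(2)] N.generator_annihilator[OF N(2)])
  qed
qed

lemma generator_transport:
  assumes M: "left_module A M" and N: "left_module A N"
    and iso: "module_isomorphic A M N" and v: "generator M v \<zeta> \<epsilon> l"
  obtains w where "generator N w \<zeta> \<epsilon> l"
proof -
  interpret M: left_module A M by fact
  interpret N: left_module A N by fact
  obtain h where h: "h \<in> iso (add_monoid M) (add_monoid N)"
    and lin: "\<And>r x. r \<in> carrier A \<Longrightarrow> x \<in> carrier M \<Longrightarrow> h (r \<odot>\<^bsub>M\<^esub> x) = r \<odot>\<^bsub>N\<^esub> h x"
    using iso unfolding module_isomorphic_def by blast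
  have bij: "bij_betw h (carrier M) (carrier N)" using h by (simp add: iso_def)
  have vM: "v \<in> carrier M" using v unfolding generator_def homogeneous_def by blast
  have hv: "h v \<in> carrier N" using bij vM bij_betwE by blast
  have h0: "h \<zero>\<^bsub>M\<^esub> = \<zero>\<^bsub>N\<^esub>"
    using lin[of \<zero> v] vM hv by simp
  have zero: "r \<odot>\<^bsub>N\<^esub> h v = \<zero>\<^bsub>N\<^esub> \<longleftrightarrow> r \<odot>\<^bsub>M\<^esub> v = \<zero>\<^bsub>M\<^esub>" if r: "r \<in> carrier A" for r
  proof -
    have "h (r \<odot>\<^bsub>M\<^esub> v) = h \<zero>\<^bsub>M\<^esub> \<longleftrightarrow> r \<odot>\<^bsub>M\<^esub> v = \<zero>\<^bsub>M\<^esub>"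
      using bij r vM unfolding bij_betw_def by (intro inj_on_eq_iff) auto
    then show ?thesis using lin[OF r vM] h0 by simp
  qed
  have "homogeneous M v \<zeta> \<epsilon>" using v by (simp only: generator_def)
  then have hom: "homogeneous N (h v) \<zeta> \<epsilon>"
    using hv lin[OF invol_closed vM] lin[OF scalar_closed vM, of \<epsilon>]
    by (auto simp: homogeneous_def zero split: if_splits)
  have "carrier N = h ` carrier M" using bij by (simp add: bij_betw_def)
  also have "carrier M = (\<lambda>r. r \<odot>\<^bsub>M\<^esub> v) ` carrier A" using v by (simp add: generator_def)
  also have "h ` \<dots> = (\<lambda>r. r \<odot>\<^bsub>N\<^esub> h v) ` carrier A"
    unfolding image_image by (rule image_cong) (simp_all add: lin vM)
  finally have "generator N (h v) \<zeta> \<epsilon> l"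
    using v hom unfolding generator_def by (simp only: zero poly_at_closed rot_closed simp_thms)
  then show ?thesis by (rule that)
qed

end

section \<open>Existence and number of indecomposable modules\<close>

definition regular_module :: "('a, 'r) ring_scheme \<Rightarrow> ('a, 'a) module" where
  "regular_module A = \<lparr>carrier = carrier A, monoid.mult = monoid.mult A, one = one A, zero = zero A,
     add = add A, module.smult = monoid.mult A\<rparr>"

lemma (in ring) left_module_regular: "left_module R (regular_module R)"
proof (intro left_module.intro left_module_axioms.intro ring_axioms)
  show "abelian_group (regular_module R)"
  proof (rule abelian_groupI)
    fix x assume "x \<in> carrier (regular_module R)"
    then show "\<exists>y\<in>carrier (regular_module R). y \<oplus>\<^bsub>regular_module R\<^esub> x = \<zero>\<^bsub>regular_module R\<^esub>"
      by (intro bexI[of _ "\<ominus> x"]) (auto simp: regular_module_def l_neg)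
  qed (auto simp: regular_module_def a_ac)
qed (auto simp: regular_module_def l_distr r_distr m_assoc)

context dihedral_module
begin

text \<open>The elements \<open>\<alpha>^i v\<close> and \<open>\<alpha>^i \<beta> v\<close> with \<open>i < n\<close> span the cyclic module.\<close>
lemma cyclic_finite_dimensional:
  assumes v: "v \<in> carrier M" and gen: "carrier M = cyclic v"
  shows "fd_module \<eta> A M"
proof -
  define B where "B = (\<lambda>i. monom 1 i \<bullet> v) ` {..<n} \<union> (\<lambda>i. monom 1 i \<bullet> flip v) ` {..<n}"
  have fin: "finite B" by (simp add: B_def)
  have BM: "B \<subseteq> carrier M" using v unfolding B_def by blast
  define S where "S = {x. \<exists>c. x = (\<Oplus>\<^bsub>M\<^esub>w\<in>B. \<eta> (c w) \<odot>\<^bsub>M\<^esub> w)}"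
  have cl: "(\<lambda>w. \<eta> (c w) \<odot>\<^bsub>M\<^esub> w) \<in> B \<rightarrow> carrier M" for c using BM by auto
  have S_add: "x \<oplus>\<^bsub>M\<^esub> y \<in> S" if xS: "x \<in> S" and yS: "y \<in> S" for x y
  proof -
    obtain c d where "x = (\<Oplus>\<^bsub>M\<^esub>w\<in>B. \<eta> (c w) \<odot>\<^bsub>M\<^esub> w)" "y = (\<Oplus>\<^bsub>M\<^esub>w\<in>B. \<eta> (d w) \<odot>\<^bsub>M\<^esub> w)"
      using xS yS by (auto simp: S_def)
    then have "x \<oplus>\<^bsub>M\<^esub> y = (\<Oplus>\<^bsub>M\<^esub>w\<in>B. \<eta> (c w) \<odot>\<^bsub>M\<^esub> w \<oplus>\<^bsub>M\<^esub> \<eta> (d w) \<odot>\<^bsub>M\<^esub> w)"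
      using M.finsum_addf[OF cl cl] by simp
    also have "\<dots> = (\<Oplus>\<^bsub>M\<^esub>w\<in>B. \<eta> (c w + d w) \<odot>\<^bsub>M\<^esub> w)"
      using BM cl by (intro M.finsum_cong') (auto simp: scalar_add smult_l_distr)
    finally have "\<exists>e. x \<oplus>\<^bsub>M\<^esub> y = (\<Oplus>\<^bsub>M\<^esub>w\<in>B. \<eta> (e w) \<odot>\<^bsub>M\<^esub> w)" by (rule exI[of _ "\<lambda>w. c w + d w"])
    then show ?thesis by (simp add: S_def)
  qed
  have S_single: "\<eta> c \<odot>\<^bsub>M\<^esub> b \<in> S" if b: "b \<in> B" for c b
  proof -
    have "(\<Oplus>\<^bsub>M\<^esub>w\<in>B. \<eta> (if w = b then c else 0) \<odot>\<^bsub>M\<^esub> w) = (\<Oplus>\<^bsub>M\<^esub>w\<in>B. if b = w then \<eta> c \<odot>\<^bsub>M\<^esub> w else \<zero>\<^bsub>M\<^esub>)"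
      using BM by (intro M.finsum_cong') auto
    also have "\<dots> = \<eta> c \<odot>\<^bsub>M\<^esub> b" using BM by (intro M.finsum_singleton[OF b fin]) auto
    finally have "\<eta> c \<odot>\<^bsub>M\<^esub> b = (\<Oplus>\<^bsub>M\<^esub>w\<in>B. \<eta> (if w = b then c else 0) \<odot>\<^bsub>M\<^esub> w)" by simp
    then have "\<exists>d. \<eta> c \<odot>\<^bsub>M\<^esub> b = (\<Oplus>\<^bsub>M\<^esub>w\<in>B. \<eta> (d w) \<odot>\<^bsub>M\<^esub> w)"
      by (rule exI[of _ "\<lambda>w. if w = b then c else 0"])
    then show ?thesis by (simp add: S_def)
  qed
  have S_monom: "monom c i \<bullet> w \<in> S" if w: "w \<in> {v, flip v}" for c i w
  proof -
    have wM: "w \<in> carrier M" using w v by auto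
    have "monom c i \<bullet> w = \<eta> c \<odot>\<^bsub>M\<^esub> (monom 1 (i mod n) \<bullet> w)"
      using wM by (simp add: act_def poly_at_monom nat_pow_mod_order[OF rot_closed rot_order, of i] smult_assoc1)
    also have "\<dots> \<in> S" by (rule S_single) (use w n_pos in \<open>auto simp: B_def\<close>)
    finally show ?thesis .
  qed
  have S_act: "f \<bullet> w \<in> S" if w: "w \<in> {v, flip v}" for f w
  proof -
    have wM: "w \<in> carrier M" using w v by auto
    have "(\<Sum>i\<in>I. monom (coeff f i) i) \<bullet> w \<in> S" if "finite I" for I
      using that
    proof (induction I)
      case empty
      then show ?case using S_monom[OF w, of 0 0] by simp
    next
      case (insert i I)
      then show ?case using S_monom[OF w] S_add wM by (simp add: act_add)
    qed
    from this[of "{..degree f}"] show ?thesis by (simp add: poly_as_sum_of_monoms)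
  qed
  have "x \<in> S" if x: "x \<in> carrier M" for x
  proof -
    obtain r where r: "r \<in> carrier A" "x = r \<odot>\<^bsub>M\<^esub> v" using x unfolding gen cyclic_def by blast
    obtain f g where "\<And>v. v \<in> carrier M \<Longrightarrow> r \<odot>\<^bsub>M\<^esub> v = f \<bullet> v \<oplus>\<^bsub>M\<^esub> g \<bullet> flip v"
      using spanned_act[OF r(1)] by blast
    then have "x = f \<bullet> v \<oplus>\<^bsub>M\<^esub> g \<bullet> flip v" using r(2) v by blast
    then show ?thesis using S_add S_act by simp
  qed
  moreover have "left_module A M" by unfold_locales
  ultimately show ?thesis
    unfolding fd_module_def using fin BM by (auto simp: S_def intro!: exI[of _ B])
qed

end

text \<open>
  Without further relations the algebra has dimension \<open>2n\<close>, and it is this that provides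
  modules with all possible labels.
\<close>
locale free_dihedral_algebra = dihedral_algebra A \<eta> \<alpha> \<beta> s t q n
  for A (structure) and \<eta> :: "'k::alg_closed_field \<Rightarrow> 'a" and \<alpha> \<beta> s t q n +
  assumes independent: "\<Phi> f \<oplus> \<Phi> g \<otimes> \<beta> = \<zero> \<Longrightarrow> unity_poly n dvd f"
begin

definition labels :: "('k \<times> 'k \<times> nat) set" where
  "labels = {(\<zeta>, \<epsilon>, l). \<zeta> ^ t = 1 \<and> (if \<zeta> ^ 2 = 1 then \<epsilon> \<in> {1, -1} else \<epsilon> = 1) \<and> l < q}"

text \<open>
  All labels occur inside the regular module. With the idempotent \<open>L^q\<close> of the component of
  \<open>\<zeta>\<close>, the element \<open>L^q u^(q-1-l)\<close> is killed by \<open>u^(l+1)\<close> but not by \<open>u^l\<close>, since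
  \<open>X^n - 1 = u^q\<close> and \<open>L(\<zeta>) = 1\<close>. If \<open>\<zeta> = \<plusminus>1\<close>, it is made an eigenvector of the
  involution by adding its multiple by \<open>\<epsilon> \<beta>\<close>; as \<open>\<beta> k[X]\<close> and \<open>k[X]\<close> are independent,
  this cannot cancel \<open>u^l L^q u^(q-1-l)\<close>.
\<close>
lemma generator_exists:
  assumes "(\<zeta>, \<epsilon>, l) \<in> labels"
  obtains M :: "('a, 'a) module" and v where "left_module A M" "generator M v \<zeta> \<epsilon> l"
proof -
  have \<zeta>: "\<zeta> ^ t = 1" and \<epsilon>: "if \<zeta> ^ 2 = 1 then \<epsilon> \<in> {1, -1} else \<epsilon> = 1" and l: "l < q"
    using assms by (auto simp: labels_def)
  let ?R = "regular_module A"
  interpret R: left_module A ?R by (rule left_module_regular)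
  interpret R: dihedral_module A \<eta> \<alpha> \<beta> s t q n ?R ..
  have R_simps: "carrier ?R = carrier A" "\<And>x y. x \<oplus>\<^bsub>?R\<^esub> y = x \<oplus> y" "\<And>x y. x \<odot>\<^bsub>?R\<^esub> y = x \<otimes> y" "\<zero>\<^bsub>?R\<^esub> = \<zero>"
    by (simp_all add: regular_module_def)
  obtain L where L: "u dvd [:-\<zeta>, 1:] * L" "poly L \<zeta> = 1"
    using lagrange_unity[OF not_dvd] \<zeta> unfolding unity_roots_def by (metis mem_Collect_eq)
  define f where "f = L ^ q * u ^ (q - Suc l)"
  have one: "\<one> \<in> carrier ?R" by (simp add: R_simps)
  define x where "x = R.act f \<one>"
  have x: "x \<in> carrier ?R" using one by (simp add: x_def)
  have "u ^ q dvd ([:-\<zeta>, 1:] * L) ^ q" by (rule dvd_power_same[OF L(1)])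
  then have "unity_poly n dvd primary \<zeta> * f"
    unfolding f_def mult.assoc[symmetric] unity_power power_mult_distrib by (rule dvd_mult2)
  then have px: "R.act (primary \<zeta>) x = \<zero>\<^bsub>?R\<^esub>"
    unfolding x_def using R.act_dvd[OF one _ R.act_unity[OF one]] one by (simp only: flip: R.act_mult)
  have "u ^ Suc l * u ^ (q - Suc l) = unity_poly n"
    using l by (simp only: flip: power_add unity_power) simp
  then have "unity_poly n dvd u ^ Suc l * f"
    unfolding f_def by (metis dvd_triv_right mult.left_commute)
  then have ux: "R.act (u ^ Suc l) x = \<zero>\<^bsub>?R\<^esub>"
    unfolding x_def using R.act_dvd[OF one _ R.act_unity[OF one]] one by (simp only: flip: R.act_mult)
  \<comment> \<open>The value \<open>0\<close> makes \<open>v = x\<close> when no symmetrisation is called for.\<close>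
  define \<delta> where "\<delta> = (if \<zeta> ^ 2 = 1 then \<epsilon> else 0)"
  define v where "v = x \<oplus>\<^bsub>?R\<^esub> \<eta> \<delta> \<odot>\<^bsub>?R\<^esub> R.flip x"
  have v: "v \<in> carrier ?R" using x by (simp add: v_def)
  have hom: "homogeneous ?R v \<zeta> \<epsilon>"
  proof (cases "\<zeta> ^ 2 = 1")
    case False
    then have "v = x" using x by (simp add: v_def \<delta>_def)
    then show ?thesis using False x px \<zeta> \<epsilon> by (simp add: homogeneous_def R.act_def)
  next
    case True
    have \<epsilon>2: "\<epsilon> * \<epsilon> = 1" using \<epsilon> True by auto
    have "\<eta> \<epsilon> \<odot>\<^bsub>?R\<^esub> v = \<eta> \<epsilon> \<odot>\<^bsub>?R\<^esub> x \<oplus>\<^bsub>?R\<^esub> \<eta> (\<epsilon> * \<epsilon>) \<odot>\<^bsub>?R\<^esub> R.flip x"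
      using x True by (simp add: v_def \<delta>_def R.smult_r_distr scalar_mult R.smult_assoc1)
    then have "R.flip v = \<eta> \<epsilon> \<odot>\<^bsub>?R\<^esub> v"
      using x True by (simp add: v_def \<delta>_def R.flip_add R.flip_scalar \<epsilon>2 R.M.a_comm)
    moreover have "R.act (primary \<zeta>) (R.flip x) = \<zero>\<^bsub>?R\<^esub>"
      using R.primary_flip[OF x \<zeta> px] involutive_root[OF True] by simp
    then have "R.act (primary \<zeta>) v = \<zero>\<^bsub>?R\<^esub>"
      using x px R.primary_act[of "R.flip x" \<zeta> "[:\<delta>:]"]
      by (simp add: v_def R.act_distrib R.act_const)
    ultimately show ?thesis
      using v \<zeta> True \<epsilon> by (simp add: homogeneous_def R.act_def R.flip_def)
  qed
  have "x \<in> {w \<in> carrier ?R. R.act (u ^ Suc l) w = \<zero>\<^bsub>?R\<^esub>}" using x ux by simp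
  then have "R.act (u ^ Suc l) (R.flip x) = \<zero>\<^bsub>?R\<^esub>"
    using R.submodule_flip[OF R.submodule_kernel] by blast
  then have uv: "R.act (u ^ Suc l) v = \<zero>\<^bsub>?R\<^esub>"
    using x ux R.act_commute[of "R.flip x" "u ^ Suc l" "[:\<delta>:]"]
    by (simp add: v_def R.act_distrib R.act_const del: power_Suc)
  have "R.act (u ^ l) v \<noteq> \<zero>\<^bsub>?R\<^esub>"
  proof
    assume zero: "R.act (u ^ l) v = \<zero>\<^bsub>?R\<^esub>"
    have "R.act (u ^ l) v = R.act (u ^ l * f) \<one> \<oplus>\<^bsub>?R\<^esub> R.act (Polynomial.smult \<delta> (u ^ l * star f)) (R.flip \<one>)"
      using one R.act_commute[of "R.act (star f) (R.flip \<one>)" "u ^ l" "[:\<delta>:]"]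
        R.act_mult[of "R.flip \<one>" "[:\<delta>:]" "u ^ l * star f"]
      by (simp add: v_def x_def R.act_distrib R.act_mult R.flip_act R.act_const)
    also have "\<dots> = \<Phi> (u ^ l * f) \<oplus> \<Phi> (Polynomial.smult \<delta> (u ^ l * star f)) \<otimes> \<beta>"
      by (simp add: R.act_def R.flip_def R_simps)
    finally have "unity_poly n dvd u ^ l * f"
      using zero by (intro independent) (simp add: R_simps)
    moreover have "u ^ l * f = u ^ (q - 1) * L ^ q"
      using l by (simp add: f_def mult.left_commute flip: power_add)
    moreover have "unity_poly n = u ^ (q - 1) * u"
      using power_minus_mult[OF q_pos, of u] by (simp add: unity_power)
    ultimately have "u ^ (q - 1) * u dvd u ^ (q - 1) * L ^ q" by simp
    then have "u dvd L ^ q"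
      using unity_poly_nonzero[OF t_pos, where 'k = 'k] by simp
    then have "poly u \<zeta> dvd poly (L ^ q) \<zeta>" by (elim dvdE) simp
    then show False using \<zeta> L(2) by simp
  qed
  with hom uv have "generator (?R\<lparr>carrier := R.cyclic v\<rparr>) v \<zeta> \<epsilon> l"
    using R.cyclic_self[OF v]
    by (simp add: generator_def homogeneous_def R.act_def R.cyclic_def split: if_splits)
  moreover have "left_module A (?R\<lparr>carrier := R.cyclic v\<rparr>)"
    by (rule R.left_module_submodule[OF R.submodule_cyclic[OF v]])
  ultimately show ?thesis using that by blast
qed

definition label_class :: "'k \<times> 'k \<times> nat \<Rightarrow> ('a, 'k list) module set" where
  "label_class = (\<lambda>(\<zeta>, \<epsilon>, l). {N \<in> fd_indecomposables \<eta> A. \<exists>v. generator N v \<zeta> \<epsilon> l})"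

lemma fd_indecomposable_left_module: "N \<in> fd_indecomposables \<eta> A \<Longrightarrow> left_module A N"
  by (simp add: fd_indecomposables_def fd_module_def)

lemma class_nonempty:
  assumes "(\<zeta>, \<epsilon>, l) \<in> labels"
  obtains N where "N \<in> label_class (\<zeta>, \<epsilon>, l)"
proof -
  obtain M :: "('a, 'a) module" and v where M: "left_module A M" "generator M v \<zeta> \<epsilon> l"
    using generator_exists[OF assms] .
  interpret M: left_module A M by fact
  interpret M: dihedral_module A \<eta> \<alpha> \<beta> s t q n M ..
  have "v \<in> carrier M" using M.homogeneousD(1)[OF M.generatorD(1)[OF M(2)]] .
  then have "fd_module \<eta> A M" by (rule M.cyclic_finite_dimensional) (rule M.generatorD(4)[OF M(2)])
  then obtain N :: "('a, 'k list) module" where N: "fd_module \<eta> A N" "module_isomorphic A M N"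
    using fd_module_copy[of \<eta> A M] by blast
  have lN: "left_module A N" using N(1) by (simp add: fd_module_def)
  interpret N: left_module A N by fact
  interpret N: dihedral_module A \<eta> \<alpha> \<beta> s t q n N ..
  obtain w where w: "generator N w \<zeta> \<epsilon> l" using generator_transport[OF M(1) lN N(2) M(2)] .
  have "N \<in> label_class (\<zeta>, \<epsilon>, l)"
    using N(1) w N.generator_indecomposable[OF w] by (auto simp: label_class_def fd_indecomposables_def)
  then show ?thesis by (rule that)
qed

lemma class_eq:
  assumes N: "N \<in> label_class (\<zeta>, \<epsilon>, l)"
  shows "{(M, N) \<in> fd_indecomposables \<eta> A \<times> fd_indecomposables \<eta> A. module_isomorphic A M N} `` {N}
    = label_class (\<zeta>, \<epsilon>, l)"
proof -
  obtain v where v: "N \<in> fd_indecomposables \<eta> A" "generator N v \<zeta> \<epsilon> l"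
    using N by (auto simp: label_class_def)
  have lN: "left_module A N" by (rule fd_indecomposable_left_module[OF v(1)])
  have "module_isomorphic A N N' \<longleftrightarrow> (\<exists>w. generator N' w \<zeta> \<epsilon> l)"
    if N': "N' \<in> fd_indecomposables \<eta> A" for N'
    using generator_transport[OF lN fd_indecomposable_left_module[OF N'] _ v(2)]
      same_label_isomorphic[OF lN v(2) fd_indecomposable_left_module[OF N']] by blast
  then show ?thesis using v(1) by (auto simp: label_class_def)
qed

lemma fd_indecomposable_label:
  assumes N: "N \<in> fd_indecomposables \<eta> A"
  obtains \<zeta> \<epsilon> l where "(\<zeta>, \<epsilon>, l) \<in> labels" "N \<in> label_class (\<zeta>, \<epsilon>, l)"
proof -
  interpret N: left_module A N by (rule fd_indecomposable_left_module[OF N])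
  interpret N: dihedral_module A \<eta> \<alpha> \<beta> s t q n N ..
  have "indecomposable_module A N" using N by (simp add: fd_indecomposables_def)
  then obtain v \<zeta> \<epsilon> l where v: "generator N v \<zeta> \<epsilon> l" by (rule N.indecomposable_generator)
  then have "(\<zeta>, \<epsilon>, l) \<in> labels"
    using N.generator_length[OF v] unfolding generator_def homogeneous_def labels_def
    by (auto split: if_splits)
  moreover have "N \<in> label_class (\<zeta>, \<epsilon>, l)" using N v by (auto simp: label_class_def)
  ultimately show ?thesis by (rule that)
qed

lemma class_inverse:
  assumes N: "N \<in> label_class (\<zeta>, 1, l)" and \<zeta>2: "\<zeta> ^ 2 \<noteq> 1"
  shows "N \<in> label_class (inverse \<zeta>, 1, l)"
proof -
  obtain v where v: "N \<in> fd_indecomposables \<eta> A" "generator N v \<zeta> 1 l"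
    using N by (auto simp: label_class_def)
  interpret N: left_module A N by (rule fd_indecomposable_left_module[OF v(1)])
  interpret N: dihedral_module A \<eta> \<alpha> \<beta> s t q n N ..
  show ?thesis using N.generator_inverse[OF v(2) \<zeta>2] v(1) by (auto simp: label_class_def)
qed

lemma class_unique:
  assumes "N \<in> label_class (\<zeta>, \<epsilon>, l)" "N \<in> label_class (\<xi>, \<delta>, m)"
  shows "l = m" "\<xi> = \<zeta> \<or> \<xi> = inverse \<zeta>" "\<zeta> ^ 2 = 1 \<Longrightarrow> \<epsilon> = \<delta>"
proof -
  obtain v w where v: "N \<in> fd_indecomposables \<eta> A" "generator N v \<zeta> \<epsilon> l" "generator N w \<xi> \<delta> m"
    using assms by (auto simp: label_class_def)
  interpret N: left_module A N by (rule fd_indecomposable_left_module[OF v(1)])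
  interpret N: dihedral_module A \<eta> \<alpha> \<beta> s t q n N ..
  show "l = m" "\<xi> = \<zeta> \<or> \<xi> = inverse \<zeta>" "\<zeta> ^ 2 = 1 \<Longrightarrow> \<epsilon> = \<delta>"
    using N.generator_unique[OF v(2,3)] by blast+
qed

end

text \<open>This will choose one element from each pair \<open>{\<zeta>, 1/\<zeta>}\<close> of distinct roots of unity.\<close>
lemma involution_transversal:
  assumes "finite S" "\<And>x. x \<in> S \<Longrightarrow> f x \<in> S \<and> f x \<noteq> x \<and> f (f x) = x"
  shows "\<exists>H\<subseteq>S. H \<inter> f ` H = {} \<and> H \<union> f ` H = S"
  using assms
proof (induction S rule: finite_psubset_induct)
  case (psubset S)
  show ?case
  proof (cases "S = {}")
    case False
    then obtain x where x: "x \<in> S" by blast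
    let ?S = "S - {x, f x}"
    have inv: "f y \<in> ?S \<and> f y \<noteq> y \<and> f (f y) = y" if y: "y \<in> ?S" for y
    proof -
      have "f y \<noteq> x" "f y \<noteq> f x" using psubset.prems[of y] psubset.prems[OF x] y by auto
      then show ?thesis using psubset.prems[of y] y by simp
    qed
    have "?S \<subset> S" using x by blast
    then have "\<exists>H\<subseteq>?S. H \<inter> f ` H = {} \<and> H \<union> f ` H = ?S"
      by (rule psubset.IH) (rule inv)
    then obtain H where H: "H \<subseteq> ?S" "H \<inter> f ` H = {}" "H \<union> f ` H = ?S"
      by (elim exE conjE) (rule that)
    have "f x \<in> S" "f x \<noteq> x" using psubset.prems[OF x] by auto
    moreover have "f ` H \<subseteq> ?S" unfolding H(3)[symmetric] by (rule Un_upper2)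
    ultimately have "insert x H \<subseteq> S" "insert x H \<inter> f ` insert x H = {}"
      using H(1,2) x by auto
    moreover have "insert x H \<union> f ` insert x H = {x, f x} \<union> (H \<union> f ` H)" by auto
    then have "insert x H \<union> f ` insert x H = S" using H(3) x \<open>f x \<in> S\<close> by auto
    ultimately show ?thesis by metis
  qed auto
qed

context free_dihedral_algebra
begin

text \<open>
  Isomorphism classes correspond to labels up to inversion of \<open>\<zeta>\<close>. The roots in \<open>E\<close>
  carry two signs, the others come in pairs, and \<open>l\<close> has \<open>q\<close> values, which gives
  \<open>(2 |E| + (t - |E|) / 2) q\<close> classes.
\<close>
theorem card_indecomposable_classes:
  defines "E \<equiv> {\<zeta> :: 'k. \<zeta> ^ t = 1 \<and> \<zeta> ^ 2 = 1}"
  shows "finite (indecomposable_classes \<eta> A)"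
    and "2 * card (indecomposable_classes \<eta> A) = (t + 3 * card E) * q"
proof -
  let ?T = "unity_roots t :: 'k set"
  have fin: "finite ?T" by (rule finite_unity_roots[OF t_pos])
  have ET: "E \<subseteq> ?T" by (auto simp: E_def unity_roots_def)
  have finE: "finite E" using fin ET by (rule rev_finite_subset)
  have "\<exists>H\<subseteq>?T - E. H \<inter> inverse ` H = {} \<and> H \<union> inverse ` H = ?T - E"
  proof (rule involution_transversal)
    show "finite (?T - E)" using fin by simp
    show "inverse \<zeta> \<in> ?T - E \<and> inverse \<zeta> \<noteq> \<zeta> \<and> inverse (inverse \<zeta>) = \<zeta>" if "\<zeta> \<in> ?T - E" for \<zeta>
      using that non_involutive_root[of \<zeta>]
      by (auto simp: E_def unity_roots_def power_inverse inverse_eq_1_iff)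
  qed
  then obtain H where H: "H \<subseteq> ?T - E" "H \<inter> inverse ` H = {}" "H \<union> inverse ` H = ?T - E" by blast
  have finH: "finite H" using H(1) fin by (meson finite_Diff rev_finite_subset)
  have "card (H \<union> inverse ` H) = card H + card (inverse ` H)"
    using H(2) finH by (intro card_Un_disjoint) auto
  also have "card (inverse ` H) = card H" by (intro card_image inj_onI) simp
  finally have "2 * card H = card ?T - card E"
    using H(3) finE ET by (simp add: card_Diff_subset)
  then have cardH: "2 * card H + card E = t"
    using card_mono[OF fin ET] card_unity_roots[OF not_dvd] by simp
  define L :: "('k \<times> 'k \<times> nat) set" where "L = E \<times> {1, -1} \<times> {..<q} \<union> H \<times> {1} \<times> {..<q}"
  have LL: "L \<subseteq> labels"
    using H(1) by (auto simp: L_def labels_def E_def unity_roots_def split: if_splits)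
  have one: "(1 :: 'k) \<noteq> -1" using two_nonzero by (metis one_add_one add.right_inverse)
  have "card L = card (E \<times> {1, -1 :: 'k} \<times> {..<q}) + card (H \<times> {1 :: 'k} \<times> {..<q})"
    unfolding L_def using H(1) finE finH by (intro card_Un_disjoint) auto
  also have "\<dots> = card E * (2 * q) + card H * q"
    using one by (simp add: card_cartesian_product)
  finally have "2 * card L = (4 * card E + 2 * card H) * q" by (simp add: algebra_simps)
  then have cardL: "2 * card L = (t + 3 * card E) * q"
    by (simp add: cardH[symmetric] algebra_simps)
  have inj: "inj_on label_class L"
  proof (rule inj_onI)
    fix x y assume xy: "x \<in> L" "y \<in> L" "label_class x = label_class y"
    obtain \<zeta> \<epsilon> l \<xi> \<delta> m where x: "x = (\<zeta>, \<epsilon>, l)" and y: "y = (\<xi>, \<delta>, m)" by (metis prod_cases3)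
    obtain N where N: "N \<in> label_class (\<zeta>, \<epsilon>, l)" using xy(1) LL x class_nonempty by blast
    then have N': "N \<in> label_class (\<xi>, \<delta>, m)" using xy(3) x y by simp
    note U = class_unique[OF N N']
    show "x = y"
    proof (cases "\<zeta> ^ 2 = 1")
      case True
      then show ?thesis using U involutive_root[OF True] by (auto simp: x y)
    next
      case False
      then have \<zeta>: "\<zeta> \<in> H" "\<epsilon> = 1" using xy(1) by (auto simp: x L_def E_def)
      have "\<xi> ^ 2 \<noteq> 1"
        using U(2) False by (auto simp: power_inverse inverse_eq_1_iff)
      then have \<xi>: "\<xi> \<in> H" "\<delta> = 1" using xy(2) by (auto simp: y L_def E_def)
      then have "\<xi> \<noteq> inverse \<zeta>" using H(2) \<zeta>(1) by blast
      then show ?thesis using U \<zeta> \<xi> by (simp add: x y)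
    qed
  qed
  have "indecomposable_classes \<eta> A = label_class ` L"
  proof
    show "indecomposable_classes \<eta> A \<subseteq> label_class ` L"
    proof
      fix C assume "C \<in> indecomposable_classes \<eta> A"
      then obtain N where N: "N \<in> fd_indecomposables \<eta> A"
        "C = {(M, N) \<in> fd_indecomposables \<eta> A \<times> fd_indecomposables \<eta> A. module_isomorphic A M N} `` {N}"
        unfolding indecomposable_classes_def by (rule quotientE)
      obtain \<zeta> \<epsilon> l where lab: "(\<zeta>, \<epsilon>, l) \<in> labels" "N \<in> label_class (\<zeta>, \<epsilon>, l)"
        by (rule fd_indecomposable_label[OF N(1)])
      have "\<exists>x\<in>L. N \<in> label_class x"
      proof (cases "\<zeta> \<in> E \<union> H")
        case True
        then have "(\<zeta>, \<epsilon>, l) \<in> L" using lab(1) H(1) by (auto simp: L_def labels_def E_def unity_roots_def subset_iff split: if_splits)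
        with lab(2) show ?thesis by blast
      next
        case False
        moreover have "\<zeta> \<in> ?T" using lab(1) by (simp add: labels_def unity_roots_def)
        ultimately have "\<zeta> \<in> inverse ` H" using H(3) by blast
        then have inv: "inverse \<zeta> \<in> H" by auto
        have \<zeta>2: "\<zeta> ^ 2 \<noteq> 1" using False \<open>\<zeta> \<in> ?T\<close> by (simp add: E_def unity_roots_def)
        with lab(1) have "\<epsilon> = 1" "l < q" by (auto simp: labels_def)
        with inv have "(inverse \<zeta>, 1, l) \<in> L" by (simp add: L_def)
        then show ?thesis using class_inverse[OF _ \<zeta>2] lab(2) \<open>\<epsilon> = 1\<close> by blast
      qed
      then show "C \<in> label_class ` L" using class_eq N(2) by fastforce
    qed
    show "label_class ` L \<subseteq> indecomposable_classes \<eta> A"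
    proof
      fix C assume "C \<in> label_class ` L"
      then obtain \<zeta> \<epsilon> l where C: "(\<zeta>, \<epsilon>, l) \<in> L" "C = label_class (\<zeta>, \<epsilon>, l)" by auto
      then obtain N where N: "N \<in> label_class (\<zeta>, \<epsilon>, l)" using LL class_nonempty by blast
      then have "N \<in> fd_indecomposables \<eta> A" by (simp add: label_class_def)
      then show "C \<in> indecomposable_classes \<eta> A"
        unfolding indecomposable_classes_def C(2) class_eq[OF N, symmetric] by (rule quotientI)
    qed
  qed
  moreover have "finite L" using finE finH by (simp add: L_def)
  ultimately show "finite (indecomposable_classes \<eta> A)"
    and "2 * card (indecomposable_classes \<eta> A) = (t + 3 * card E) * q"
    using cardL card_image[OF inj] by simp_all
qed

end

section \<open>Group algebras of dihedral groups\<close>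

definition single :: "'k::field \<Rightarrow> 'g \<Rightarrow> 'g \<Rightarrow> 'k" where
  "single c g = (\<lambda>x. if x = g then c else 0)"

locale finite_group = group G for G (structure) +
  assumes finite_carrier: "finite (carrier G)"
begin

lemma group_algebra_carrier:
  "f \<in> carrier (group_algebra G) \<longleftrightarrow> (\<forall>x. x \<notin> carrier G \<longrightarrow> f x = 0)"
  using finite_subset[OF _ finite_carrier, of "{x. f x \<noteq> 0}"] by (auto simp: group_algebra_def)

lemma group_algebra_simps:
  "(f \<oplus>\<^bsub>group_algebra G\<^esub> g) = (\<lambda>x. f x + g x)"
  "\<zero>\<^bsub>group_algebra G\<^esub> = (\<lambda>x. 0)"
  "\<one>\<^bsub>group_algebra G\<^esub> = single 1 \<one>"
  by (simp_all add: group_algebra_def single_def)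

lemma single_closed [simp]: "g \<in> carrier G \<Longrightarrow> single c g \<in> carrier (group_algebra G)"
  by (auto simp: group_algebra_carrier single_def)

lemma group_algebra_mult:
  assumes "f \<in> carrier (group_algebra G)" "g \<in> carrier (group_algebra G)"
  shows "(f \<otimes>\<^bsub>group_algebra G\<^esub> g) x =
    (\<Sum>y\<in>carrier G. \<Sum>z\<in>carrier G. if y \<otimes> z = x then f y * g z else 0)"
proof -
  have supp: "{x. f x \<noteq> 0} \<subseteq> carrier G" "{x. g x \<noteq> 0} \<subseteq> carrier G"
    using assms by (auto simp: group_algebra_carrier)
  have "(f \<otimes>\<^bsub>group_algebra G\<^esub> g) x =
      (\<Sum>y | f y \<noteq> 0. \<Sum>z | g z \<noteq> 0. if y \<otimes> z = x then f y * g z else 0)"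
    by (simp add: group_algebra_def)
  also have "\<dots> = (\<Sum>y | f y \<noteq> 0. \<Sum>z\<in>carrier G. if y \<otimes> z = x then f y * g z else 0)"
    by (intro sum.cong sum.mono_neutral_left finite_carrier supp) auto
  also have "\<dots> = (\<Sum>y\<in>carrier G. \<Sum>z\<in>carrier G. if y \<otimes> z = x then f y * g z else 0)"
    by (intro sum.mono_neutral_left finite_carrier supp) (auto intro!: sum.neutral split: if_splits)
  finally show ?thesis .
qed

lemma group_algebra_mult_closed:
  assumes "f \<in> carrier (group_algebra G)" "g \<in> carrier (group_algebra G)"
  shows "f \<otimes>\<^bsub>group_algebra G\<^esub> g \<in> carrier (group_algebra G)"
  unfolding group_algebra_carrier group_algebra_mult[OF assms]
  by (auto intro!: sum.neutral split: if_splits)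

text \<open>
  A product is the image of \<open>f \<otimes> g\<close> under the multiplication of the group; pairing it with an
  arbitrary function \<open>k\<close> turns associativity of the algebra into associativity of the group.
\<close>
lemma sum_group_algebra_mult:
  assumes "f \<in> carrier (group_algebra G)" "g \<in> carrier (group_algebra G)"
  shows "(\<Sum>w\<in>carrier G. (f \<otimes>\<^bsub>group_algebra G\<^esub> g) w * k w) =
    (\<Sum>y\<in>carrier G. \<Sum>z\<in>carrier G. f y * g z * k (y \<otimes> z))"
proof -
  have "(\<Sum>w\<in>carrier G. (f \<otimes>\<^bsub>group_algebra G\<^esub> g) w * k w) =
      (\<Sum>w\<in>carrier G. \<Sum>y\<in>carrier G. \<Sum>z\<in>carrier G. if y \<otimes> z = w then f y * g z * k w else 0)"
    by (simp add: group_algebra_mult[OF assms] sum_distrib_right if_distrib[of "\<lambda>x. x * _"] cong: if_cong)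
  also have "\<dots> = (\<Sum>y\<in>carrier G. \<Sum>z\<in>carrier G. \<Sum>w\<in>carrier G. if y \<otimes> z = w then f y * g z * k w else 0)"
  proof (rule HOL.trans[OF sum.swap], rule sum.cong[OF HOL.refl])
    fix y
    show "(\<Sum>w\<in>carrier G. \<Sum>z\<in>carrier G. if y \<otimes> z = w then f y * g z * k w else 0) =
        (\<Sum>z\<in>carrier G. \<Sum>w\<in>carrier G. if y \<otimes> z = w then f y * g z * k w else 0)"
      by (rule sum.swap)
  qed
  also have "\<dots> = (\<Sum>y\<in>carrier G. \<Sum>z\<in>carrier G. f y * g z * k (y \<otimes> z))"
    by (intro sum.cong HOL.refl) (simp add: finite_carrier)
  finally show ?thesis .
qed

lemma group_algebra_assoc:
  assumes f: "f \<in> carrier (group_algebra G)" and g: "g \<in> carrier (group_algebra G)"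
    and h: "h \<in> carrier (group_algebra G)"
  shows "(f \<otimes>\<^bsub>group_algebra G\<^esub> g) \<otimes>\<^bsub>group_algebra G\<^esub> h = f \<otimes>\<^bsub>group_algebra G\<^esub> (g \<otimes>\<^bsub>group_algebra G\<^esub> h)"
    (is "?l = ?r")
proof
  fix x
  have "?l x = (\<Sum>w\<in>carrier G. (f \<otimes>\<^bsub>group_algebra G\<^esub> g) w * (\<Sum>c\<in>carrier G. if w \<otimes> c = x then h c else 0))"
    by (simp add: group_algebra_mult[OF group_algebra_mult_closed[OF f g] h] sum_distrib_left if_distrib cong: if_cong)
  also have "\<dots> = (\<Sum>y\<in>carrier G. \<Sum>z\<in>carrier G. \<Sum>c\<in>carrier G. if y \<otimes> z \<otimes> c = x then f y * g z * h c else 0)"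
    unfolding sum_group_algebra_mult[OF f g] by (simp add: sum_distrib_left if_distrib cong: if_cong)
  also have "\<dots> = (\<Sum>y\<in>carrier G. \<Sum>z\<in>carrier G. \<Sum>c\<in>carrier G. f y * (g z * h c * (if y \<otimes> (z \<otimes> c) = x then 1 else 0)))"
    by (intro sum.cong HOL.refl) (simp add: m_assoc)
  also have "\<dots> = (\<Sum>y\<in>carrier G. f y * (\<Sum>z\<in>carrier G. \<Sum>c\<in>carrier G. g z * h c * (if y \<otimes> (z \<otimes> c) = x then 1 else 0)))"
    by (simp only: sum_distrib_left)
  also have "\<dots> = (\<Sum>y\<in>carrier G. f y * (\<Sum>w\<in>carrier G. (g \<otimes>\<^bsub>group_algebra G\<^esub> h) w * (if y \<otimes> w = x then 1 else 0)))"
    by (simp only: sum_group_algebra_mult[OF g h])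
  also have "\<dots> = ?r x"
    unfolding group_algebra_mult[OF f group_algebra_mult_closed[OF g h]] sum_distrib_left
    by (intro sum.cong HOL.refl) simp
  finally show "?l x = ?r x" .
qed

lemma single_mult:
  assumes "g \<in> carrier G" "h \<in> carrier G"
  shows "single c g \<otimes>\<^bsub>group_algebra G\<^esub> single d h = single (c * d) (g \<otimes> h)"
proof
  fix x
  have "(single c g \<otimes>\<^bsub>group_algebra G\<^esub> single d h) x =
      (\<Sum>y\<in>carrier G. if y = g then \<Sum>z\<in>carrier G. if z = h then (if g \<otimes> h = x then c * d else 0) else 0 else 0)"
    unfolding group_algebra_mult[OF single_closed[OF assms(1)] single_closed[OF assms(2)]]
    by (intro sum.cong HOL.refl) (auto simp: single_def intro!: sum.cong sum.neutral)
  then show "(single c g \<otimes>\<^bsub>group_algebra G\<^esub> single d h) x = single (c * d) (g \<otimes> h) x"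
    using assms by (simp add: finite_carrier single_def)
qed

lemma single_one_mult:
  assumes f: "f \<in> carrier (group_algebra G)"
  shows "single c \<one> \<otimes>\<^bsub>group_algebra G\<^esub> f = (\<lambda>x. c * f x)"
    and "f \<otimes>\<^bsub>group_algebra G\<^esub> single c \<one> = (\<lambda>x. c * f x)"
proof -
  have fx: "f x = 0" if "x \<notin> carrier G" for x using f that by (simp add: group_algebra_carrier)
  show "single c \<one> \<otimes>\<^bsub>group_algebra G\<^esub> f = (\<lambda>x. c * f x)"
  proof
    fix x
    have "(single c \<one> \<otimes>\<^bsub>group_algebra G\<^esub> f) x =
        (\<Sum>y\<in>carrier G. if y = \<one> then \<Sum>z\<in>carrier G. if z = x then c * f x else 0 else 0)"
      unfolding group_algebra_mult[OF single_closed[OF one_closed] f]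
      by (intro sum.cong HOL.refl) (auto simp: single_def intro!: sum.cong sum.neutral)
    then show "(single c \<one> \<otimes>\<^bsub>group_algebra G\<^esub> f) x = c * f x"
      by (simp add: finite_carrier fx)
  qed
  show "f \<otimes>\<^bsub>group_algebra G\<^esub> single c \<one> = (\<lambda>x. c * f x)"
  proof
    fix x
    have "(f \<otimes>\<^bsub>group_algebra G\<^esub> single c \<one>) x =
        (\<Sum>y\<in>carrier G. if y = x then \<Sum>z\<in>carrier G. if z = \<one> then c * f x else 0 else 0)"
      unfolding group_algebra_mult[OF f single_closed[OF one_closed]]
    proof (intro sum.cong HOL.refl)
      fix y assume y: "y \<in> carrier G"
      have "(\<Sum>z\<in>carrier G. if y \<otimes> z = x then f y * single c \<one> z else 0) =
          (\<Sum>z\<in>carrier G. if z = \<one> then (if y = x then c * f x else 0) else 0)"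
        using y by (intro sum.cong HOL.refl) (auto simp: single_def)
      then show "(\<Sum>z\<in>carrier G. if y \<otimes> z = x then f y * single c \<one> z else 0) =
          (if y = x then \<Sum>z\<in>carrier G. if z = \<one> then c * f x else 0 else 0)" by auto
    qed
    then show "(f \<otimes>\<^bsub>group_algebra G\<^esub> single c \<one>) x = c * f x"
      by (simp add: finite_carrier fx)
  qed
qed

lemma ring_group_algebra: "ring (group_algebra G :: ('a \<Rightarrow> 'k::field) ring)"
proof (rule ringI)
  let ?A = "group_algebra G :: ('a \<Rightarrow> 'k) ring"
  show "abelian_group ?A"
  proof (rule abelian_groupI)
    fix f :: "'a \<Rightarrow> 'k" assume "f \<in> carrier ?A"
    then show "\<exists>g\<in>carrier ?A. g \<oplus>\<^bsub>?A\<^esub> f = \<zero>\<^bsub>?A\<^esub>"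
      by (intro bexI[of _ "\<lambda>x. - f x"]) (auto simp: group_algebra_carrier group_algebra_simps)
  qed (auto simp: group_algebra_carrier group_algebra_simps add_ac)
  show "Group.monoid ?A"
  proof (rule Group.monoidI)
    show "f \<otimes>\<^bsub>?A\<^esub> g \<in> carrier ?A" if "f \<in> carrier ?A" "g \<in> carrier ?A" for f g
      by (rule group_algebra_mult_closed[OF that])
    show "f \<otimes>\<^bsub>?A\<^esub> g \<otimes>\<^bsub>?A\<^esub> h = f \<otimes>\<^bsub>?A\<^esub> (g \<otimes>\<^bsub>?A\<^esub> h)"
      if "f \<in> carrier ?A" "g \<in> carrier ?A" "h \<in> carrier ?A" for f g h
      by (rule group_algebra_assoc[OF that])
  qed (simp_all add: group_algebra_simps single_one_mult)
  fix f g h :: "'a \<Rightarrow> 'k" assume fgh: "f \<in> carrier ?A" "g \<in> carrier ?A" "h \<in> carrier ?A"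
  then have fg: "f \<oplus>\<^bsub>?A\<^esub> g \<in> carrier ?A" by (auto simp: group_algebra_carrier group_algebra_simps)
  show "(f \<oplus>\<^bsub>?A\<^esub> g) \<otimes>\<^bsub>?A\<^esub> h = f \<otimes>\<^bsub>?A\<^esub> h \<oplus>\<^bsub>?A\<^esub> g \<otimes>\<^bsub>?A\<^esub> h"
  proof
    fix x show "((f \<oplus>\<^bsub>?A\<^esub> g) \<otimes>\<^bsub>?A\<^esub> h) x = (f \<otimes>\<^bsub>?A\<^esub> h \<oplus>\<^bsub>?A\<^esub> g \<otimes>\<^bsub>?A\<^esub> h) x"
      unfolding group_algebra_simps group_algebra_mult[OF fg[unfolded group_algebra_simps] fgh(3)]
        group_algebra_mult[OF fgh(1,3)] group_algebra_mult[OF fgh(2,3)] sum.distrib[symmetric]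
      by (intro sum.cong HOL.refl) (simp add: algebra_simps)
  qed
  show "h \<otimes>\<^bsub>?A\<^esub> (f \<oplus>\<^bsub>?A\<^esub> g) = h \<otimes>\<^bsub>?A\<^esub> f \<oplus>\<^bsub>?A\<^esub> h \<otimes>\<^bsub>?A\<^esub> g"
  proof
    fix x show "(h \<otimes>\<^bsub>?A\<^esub> (f \<oplus>\<^bsub>?A\<^esub> g)) x = (h \<otimes>\<^bsub>?A\<^esub> f \<oplus>\<^bsub>?A\<^esub> h \<otimes>\<^bsub>?A\<^esub> g) x"
      unfolding group_algebra_simps group_algebra_mult[OF fgh(3) fg[unfolded group_algebra_simps]]
        group_algebra_mult[OF fgh(3,1)] group_algebra_mult[OF fgh(3,2)] sum.distrib[symmetric]
      by (intro sum.cong HOL.refl) (simp add: algebra_simps)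
  qed
qed

lemma group_algebra_of_field_eq: "group_algebra_of_field G c = single c \<one>"
  by (simp add: group_algebra_of_field_def single_def)

lemma algebra_over_field_group_algebra:
  "algebra_over_field (group_algebra G :: ('a \<Rightarrow> 'k::field) ring) (group_algebra_of_field G)"
  unfolding group_algebra_of_field_eq
proof (intro algebra_over_field.intro algebra_over_field_axioms.intro ring_group_algebra)
  fix c d :: 'k
  show "single (c + d) \<one> = single c \<one> \<oplus>\<^bsub>group_algebra G\<^esub> single d \<one>"
    by (auto simp: group_algebra_simps single_def)
  show "single (c * d) \<one> = single c \<one> \<otimes>\<^bsub>group_algebra G\<^esub> single d \<one>"
    by (simp add: single_mult)
qed (simp_all add: group_algebra_simps single_one_mult)

end

text \<open>
  The dihedral relations together with the normal form of the elements, which says that the group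
  has order exactly \<open>2n\<close>.
\<close>
locale dihedral_generators = finite_group G for G (structure) +
  fixes a b and n :: nat
  assumes n_pos: "n > 0"
    and a_closed [simp]: "a \<in> carrier G" and b_closed [simp]: "b \<in> carrier G"
    and a_order: "a [^] n = \<one>" and b_b: "b \<otimes> b = \<one>" and b_a: "b \<otimes> a = a [^] (n - 1) \<otimes> b"
    and carrier_eq: "carrier G = (\<lambda>i. a [^] i) ` {..<n} \<union> (\<lambda>i. a [^] i \<otimes> b) ` {..<n}"
    and inj: "inj_on (\<lambda>i. a [^] i) {..<n}"
    and disjoint: "\<And>i j. a [^] (i::nat) \<noteq> a [^] (j::nat) \<otimes> b"
begin

lemma inj_b: "inj_on (\<lambda>i. a [^] i \<otimes> b) {..<n}"
  using inj by (auto simp: inj_on_def)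

context
  fixes A :: "('a \<Rightarrow> 'k::alg_closed_field) ring" and \<eta> :: "'k \<Rightarrow> 'a \<Rightarrow> 'k" and \<alpha> \<beta> :: "'a \<Rightarrow> 'k"
  defines "A \<equiv> group_algebra G" and "\<eta> \<equiv> group_algebra_of_field G"
    and "\<alpha> \<equiv> single 1 a" and "\<beta> \<equiv> single 1 b"
begin

interpretation algebra_over_field A \<eta>
  unfolding A_def \<eta>_def by (rule algebra_over_field_group_algebra)

lemma A_simps:
  "f \<oplus>\<^bsub>A\<^esub> g = (\<lambda>x. f x + g x)" "\<zero>\<^bsub>A\<^esub> = (\<lambda>x. 0)" "\<one>\<^bsub>A\<^esub> = single 1 \<one>"
  by (simp_all add: A_def group_algebra_simps)

lemma A_single:
  "g \<in> carrier G \<Longrightarrow> h \<in> carrier G \<Longrightarrow> single c g \<otimes>\<^bsub>A\<^esub> single d h = single (c * d) (g \<otimes> h)"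
  by (simp add: A_def single_mult)

lemma rot_closed: "\<alpha> \<in> carrier A" and flip_closed: "\<beta> \<in> carrier A"
  by (simp_all add: A_def \<alpha>_def \<beta>_def)

lemma rot_power: "\<alpha> [^]\<^bsub>A\<^esub> (i::nat) = single 1 (a [^] i)"
  by (induction i) (simp_all add: \<alpha>_def A_simps A_single)

lemma poly_rot_monom: "poly_at \<alpha> (monom c i) = single c (a [^] i)"
  unfolding poly_at_monom[OF rot_closed] rot_power
  by (simp add: \<eta>_def group_algebra_of_field_eq A_single)

lemma poly_rot_sum:
  assumes "finite I"
  shows "poly_at \<alpha> (\<Sum>i\<in>I. monom (c i) i) = (\<lambda>x. \<Sum>i\<in>I. if x = a [^] i then c i else 0)"
  using assms
proof (induction I)
  case empty
  show ?case by (simp add: A_simps)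
next
  case (insert i I)
  then show ?case
    by (simp add: poly_at_add rot_closed poly_rot_monom) (simp add: A_simps single_def)
qed

lemma poly_rot_sum_flip:
  assumes "finite I"
  shows "poly_at \<alpha> (\<Sum>i\<in>I. monom (c i) i) \<otimes>\<^bsub>A\<^esub> \<beta> = (\<lambda>x. \<Sum>i\<in>I. if x = a [^] i \<otimes> b then c i else 0)"
  using assms
proof (induction I)
  case empty
  have "\<zero>\<^bsub>A\<^esub> \<otimes>\<^bsub>A\<^esub> \<beta> = \<zero>\<^bsub>A\<^esub>" by (rule l_null[OF flip_closed])
  then show ?case by (simp add: A_simps)
next
  case (insert i I)
  have "single (c i) (a [^] i) \<otimes>\<^bsub>A\<^esub> \<beta> = single (c i) (a [^] i \<otimes> b)"
    by (simp add: \<beta>_def A_single)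
  with insert show ?case
    by (simp add: poly_at_add rot_closed flip_closed l_distr poly_rot_monom[symmetric])
       (simp add: poly_rot_monom A_simps single_def)
qed

text \<open>
  An element of the group algebra is the pair of polynomials formed by its values at the
  \<open>a^i\<close> and at the \<open>a^i b\<close>. Conversely, a relation \<open>f(a) + g(a) b = 0\<close> forces \<open>f\<close>
  reduced modulo \<open>X^n - 1\<close> to vanish, as one sees from the values at the \<open>a^j\<close>.
\<close>
lemma free_dihedral_algebra_group_algebra:
  assumes "odd CHAR('k)" "\<not> CHAR('k) dvd t" "n = CHAR('k) ^ s * t"
  shows "free_dihedral_algebra A \<eta> \<alpha> \<beta> s t (CHAR('k) ^ s) n"
proof (intro free_dihedral_algebra.intro dihedral_algebra.intro dihedral_algebra_axioms.intro
    free_dihedral_algebra_axioms.intro algebra_over_field_axioms rot_closed flip_closed assms HOL.refl)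
  show "\<alpha> [^]\<^bsub>A\<^esub> n = \<one>\<^bsub>A\<^esub>" unfolding rot_power by (simp add: a_order A_simps)
  show "\<beta> \<otimes>\<^bsub>A\<^esub> \<beta> = \<one>\<^bsub>A\<^esub>" by (simp add: \<beta>_def A_single b_b A_simps)
  show "\<beta> \<otimes>\<^bsub>A\<^esub> \<alpha> = \<alpha> [^]\<^bsub>A\<^esub> (n - 1) \<otimes>\<^bsub>A\<^esub> \<beta>"
    unfolding rot_power by (simp add: \<alpha>_def \<beta>_def A_single b_a)
next
  fix r assume r: "r \<in> carrier A"
  let ?f = "\<Sum>i<n. monom (r (a [^] i)) i" and ?g = "\<Sum>i<n. monom (r (a [^] i \<otimes> b)) i"
  have rx: "r x = (\<Sum>i<n. if x = a [^] i then r (a [^] i) else 0) + (\<Sum>i<n. if x = a [^] i \<otimes> b then r (a [^] i \<otimes> b) else 0)"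
    for x
  proof -
    consider "x \<notin> carrier G" | i where "i < n" "x = a [^] i" | i where "i < n" "x = a [^] i \<otimes> b"
      unfolding carrier_eq by blast
    then show ?thesis
    proof cases
      case 1
      then have "r x = 0" using r by (simp add: A_def group_algebra_carrier)
      moreover have "x \<noteq> a [^] i" "x \<noteq> a [^] i \<otimes> b" for i :: nat using 1 by auto
      ultimately show ?thesis by simp
    next
      case (2 i)
      have "(\<Sum>j<n. if x = a [^] j then r (a [^] j) else 0) = (\<Sum>j<n. if j = i then r x else 0)"
        using 2 inj by (intro sum.cong HOL.refl) (auto simp: inj_on_def)
      then show ?thesis using 2 disjoint by simp
    next
      case (3 i)
      have "(\<Sum>j<n. if x = a [^] j \<otimes> b then r (a [^] j \<otimes> b) else 0) = (\<Sum>j<n. if j = i then r x else 0)"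
        using 3 inj_b by (intro sum.cong HOL.refl) (auto simp: inj_on_def)
      then show ?thesis using 3 disjoint[symmetric] by simp
    qed
  qed
  have "r = poly_at \<alpha> ?f \<oplus>\<^bsub>A\<^esub> poly_at \<alpha> ?g \<otimes>\<^bsub>A\<^esub> \<beta>"
    unfolding poly_rot_sum_flip[OF finite_lessThan] unfolding poly_rot_sum[OF finite_lessThan] A_simps
    by (rule ext) (rule rx)
  then show "\<exists>f g. r = poly_at \<alpha> f \<oplus>\<^bsub>A\<^esub> poly_at \<alpha> g \<otimes>\<^bsub>A\<^esub> \<beta>" by blast
next
  fix f g assume zero: "poly_at \<alpha> f \<oplus>\<^bsub>A\<^esub> poly_at \<alpha> g \<otimes>\<^bsub>A\<^esub> \<beta> = \<zero>\<^bsub>A\<^esub>"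
  define h where "h = f mod unity_poly n"
  have Pn: "unity_poly n \<noteq> (0 :: 'k poly)" by (rule unity_poly_nonzero[OF n_pos])
  have "poly_at \<alpha> (unity_poly n) = \<zero>\<^bsub>A\<^esub>"
    unfolding unity_poly_def poly_at_diff[OF rot_closed] poly_rot_monom poly_at_1[OF rot_closed]
    by (simp add: a_order minus_eq r_neg flip: A_simps(3))
  then have "poly_at \<alpha> (f div unity_poly n * unity_poly n) = \<zero>\<^bsub>A\<^esub>"
    by (simp add: poly_at_mult rot_closed)
  then have fh: "poly_at \<alpha> f = poly_at \<alpha> h"
    using poly_at_add[OF rot_closed, of "f div unity_poly n * unity_poly n" h] rot_closed
    by (simp add: h_def)
  have "h = 0 \<or> degree h < n"
    using degree_mod_less[OF Pn, of f] by (simp add: h_def degree_unity_poly)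
  then have deg: "degree h < n" using n_pos by auto
  have "coeff h j = 0" for j
  proof (cases "j \<le> degree h")
    case True
    have "0 = (poly_at \<alpha> f \<oplus>\<^bsub>A\<^esub> poly_at \<alpha> g \<otimes>\<^bsub>A\<^esub> \<beta>) (a [^] j)"
      unfolding zero by (simp add: A_simps)
    also have "\<dots> = poly_at \<alpha> h (a [^] j) + (poly_at \<alpha> g \<otimes>\<^bsub>A\<^esub> \<beta>) (a [^] j)"
      unfolding fh by (simp add: A_simps)
    also have "(poly_at \<alpha> g \<otimes>\<^bsub>A\<^esub> \<beta>) (a [^] j) = 0"
      using poly_rot_sum_flip[of "{..degree g}" "coeff g"] disjoint
      by (simp add: poly_as_sum_of_monoms)
    also have "poly_at \<alpha> h (a [^] j) = (\<Sum>i\<le>degree h. if a [^] j = a [^] i then coeff h i else 0)"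
      using poly_rot_sum[of "{..degree h}" "coeff h"] by (simp add: poly_as_sum_of_monoms)
    also have "\<dots> = (\<Sum>i\<le>degree h. if i = j then coeff h i else 0)"
      using inj deg True by (intro sum.cong HOL.refl) (auto simp: inj_on_def)
    also have "\<dots> = coeff h j" using True by simp
    finally show ?thesis by simp
  qed (simp add: coeff_eq_0)
  then have "h = 0" by (simp add: poly_eq_iff)
  then show "unity_poly n dvd f" by (simp add: h_def mod_eq_0_iff_dvd)
qed

end
end

section \<open>The presented dihedral group\<close>

text \<open>
  Left multiplication by a letter on the normal forms \<open>a^i b^e\<close>. The exponent \<open>i\<close> is kept
  in the integers and compared modulo \<open>n\<close> afterwards, since \<open>b a^i = a^(-i) b\<close>. This action
  shows that the relators do not identify different normal forms.
\<close>
fun letter_act :: "dihedral_gen \<times> bool \<Rightarrow> int \<times> bool \<Rightarrow> int \<times> bool" where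
  "letter_act (dihedral_gen.a, d) (i, e) = (if d then i + 1 else i - 1, e)"
| "letter_act (dihedral_gen.b, d) (i, e) = (- i, \<not> e)"

definition word_act :: "dihedral_gen group_word \<Rightarrow> int \<times> bool \<Rightarrow> int \<times> bool" where
  "word_act w = foldr letter_act w"

definition cong_act :: "nat \<Rightarrow> int \<times> bool \<Rightarrow> int \<times> bool \<Rightarrow> bool" where
  "cong_act n x y \<longleftrightarrow> int n dvd fst x - fst y \<and> snd x = snd y"

lemma cong_act_letter: "cong_act n x y \<Longrightarrow> cong_act n (letter_act l x) (letter_act l y)"
  by (cases "(l, x)" rule: letter_act.cases; cases "(l, y)" rule: letter_act.cases)
     (auto simp: cong_act_def dvd_diff_commute)

lemma cong_act_word: "cong_act n x y \<Longrightarrow> cong_act n (word_act w x) (word_act w y)"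
  by (induction w) (auto simp: word_act_def cong_act_letter)

lemma word_act_append: "word_act (v @ w) x = word_act v (word_act w x)"
  by (simp add: word_act_def)

lemma word_act_replicate: "word_act (replicate m (dihedral_gen.a, True)) (i, e) = (i + int m, e)"
  by (induction m) (auto simp: word_act_def)

definition dihedral_relators :: "nat \<Rightarrow> dihedral_gen group_word set" where
  "dihedral_relators n =
    (let a = (dihedral_gen.a, True); b = (dihedral_gen.b, True)
     in {replicate n a, [b, b], [a, b, a, b]})"

lemma dihedral_group_presented: "dihedral_group n = presented_group (dihedral_relators n)"
  by (simp add: dihedral_group_def dihedral_relators_def Let_def)

lemma word_eq_cong_act:
  "word_eq (dihedral_relators n) v w \<Longrightarrow> cong_act n (word_act v x) (word_act w x)"
proof (induction v w arbitrary: x rule: word_eq.induct)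
  case (sym u v)
  then show ?case by (metis cong_act_def dvd_diff_commute)
next
  case (trans u v w)
  have "int n dvd (fst (word_act u x) - fst (word_act v x)) + (fst (word_act v x) - fst (word_act w x))"
    using trans.IH[of x] by (intro dvd_add) (auto simp: cong_act_def)
  then show ?case using trans.IH[of x] by (simp add: cong_act_def)
next
  case (cancel u z e v)
  obtain i d where "word_act v x = (i, d)" by force
  then have "word_act [(z, e), (z, \<not> e)] (word_act v x) = word_act v x"
    by (cases z) (auto simp: word_act_def)
  then show ?case by (simp only: word_act_append) (simp add: cong_act_def)
next
  case (relator r u v)
  obtain i d where v: "word_act v x = (i, d)" by force
  have "cong_act n (word_act r (word_act v x)) (word_act v x)"
    using relator unfolding v dihedral_relators_def Let_def
    by (auto simp: word_act_replicate cong_act_def) (auto simp: word_act_def)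
  then show ?case by (simp only: word_act_append) (rule cong_act_word)
qed (simp add: cong_act_def)

lemma dihedral_generators_dihedral_group:
  assumes n: "n > 0"
  shows "\<exists>a b. dihedral_generators (dihedral_group n) a b n"
proof -
  let ?R = "dihedral_relators n" and ?G = "dihedral_group n"
  define cls where "cls w = {v. word_eq ?R w v}" for w
  interpret group ?G unfolding dihedral_group_presented by (rule group_presented_group)
  define a where "a = cls [(dihedral_gen.a, True)]"
  define b where "b = cls [(dihedral_gen.b, True)]"
  have carrier: "carrier ?G = range cls"
    by (simp add: dihedral_group_presented presented_group_carrier cls_def)
  have cls_closed: "cls w \<in> carrier ?G" for w by (simp add: carrier)
  have mult: "cls v \<otimes>\<^bsub>?G\<^esub> cls w = cls (v @ w)" for v w
    by (simp add: dihedral_group_presented presented_group_mult cls_def)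
  have one: "\<one>\<^bsub>?G\<^esub> = cls []"
    by (simp add: dihedral_group_presented presented_group_def cls_def)
  have cls_eq: "cls v = cls w \<longleftrightarrow> word_eq ?R v w" for v w
    unfolding cls_def by (rule word_eq_class_eq)
  have a_closed: "a \<in> carrier ?G" and b_closed: "b \<in> carrier ?G" by (simp_all add: a_def b_def cls_closed)
  note closed [simp] = a_closed b_closed
  have power: "a [^]\<^bsub>?G\<^esub> i = cls (replicate i (dihedral_gen.a, True))" for i :: nat
  proof (induction i)
    case (Suc i)
    then show ?case by (simp add: a_def mult replicate_append_same)
  qed (simp add: one)
  have rel: "cls r = \<one>\<^bsub>?G\<^esub>" if "r \<in> ?R" for r
    using word_eq.relator[OF that, of "[]" "[]"] by (simp add: one cls_eq)
  have a_order: "a [^]\<^bsub>?G\<^esub> n = \<one>\<^bsub>?G\<^esub>"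
    unfolding power by (rule rel) (simp add: dihedral_relators_def Let_def)
  have b_b: "b \<otimes>\<^bsub>?G\<^esub> b = \<one>\<^bsub>?G\<^esub>"
    unfolding b_def mult by (rule rel) (simp add: dihedral_relators_def Let_def)
  have "(a \<otimes>\<^bsub>?G\<^esub> b) \<otimes>\<^bsub>?G\<^esub> (a \<otimes>\<^bsub>?G\<^esub> b) = \<one>\<^bsub>?G\<^esub>"
    unfolding a_def b_def mult by (rule rel) (simp add: dihedral_relators_def Let_def)
  then have "a \<otimes>\<^bsub>?G\<^esub> (b \<otimes>\<^bsub>?G\<^esub> a \<otimes>\<^bsub>?G\<^esub> b) = \<one>\<^bsub>?G\<^esub>" by (simp add: m_assoc)
  moreover have a_inv: "a \<otimes>\<^bsub>?G\<^esub> a [^]\<^bsub>?G\<^esub> (n - 1) = \<one>\<^bsub>?G\<^esub>"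
    using nat_pow_Suc2[OF a_closed, of "n - 1"] a_order n by simp
  ultimately have "b \<otimes>\<^bsub>?G\<^esub> a \<otimes>\<^bsub>?G\<^esub> b = a [^]\<^bsub>?G\<^esub> (n - 1)"
    by (metis a_closed b_closed Units_l_cancel Units_eq m_closed nat_pow_closed)
  then have "b \<otimes>\<^bsub>?G\<^esub> a \<otimes>\<^bsub>?G\<^esub> (b \<otimes>\<^bsub>?G\<^esub> b) = a [^]\<^bsub>?G\<^esub> (n - 1) \<otimes>\<^bsub>?G\<^esub> b"
    by (simp flip: m_assoc)
  then have b_a: "b \<otimes>\<^bsub>?G\<^esub> a = a [^]\<^bsub>?G\<^esub> (n - 1) \<otimes>\<^bsub>?G\<^esub> b" by (simp add: b_b)
  define S where "S = range (\<lambda>i::nat. a [^]\<^bsub>?G\<^esub> i) \<union> range (\<lambda>i::nat. a [^]\<^bsub>?G\<^esub> i \<otimes>\<^bsub>?G\<^esub> b)"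
  have S_a: "a \<otimes>\<^bsub>?G\<^esub> x \<in> S" if "x \<in> S" for x
  proof -
    have "a \<otimes>\<^bsub>?G\<^esub> a [^]\<^bsub>?G\<^esub> i = a [^]\<^bsub>?G\<^esub> Suc i" for i :: nat by (rule nat_pow_Suc2[OF a_closed, symmetric])
    moreover from this have "a \<otimes>\<^bsub>?G\<^esub> (a [^]\<^bsub>?G\<^esub> i \<otimes>\<^bsub>?G\<^esub> b) = a [^]\<^bsub>?G\<^esub> Suc i \<otimes>\<^bsub>?G\<^esub> b" for i :: nat
      by (simp flip: m_assoc)
    ultimately show ?thesis using \<open>x \<in> S\<close> unfolding S_def by blast
  qed
  have S_b: "b \<otimes>\<^bsub>?G\<^esub> x \<in> S" if "x \<in> S" for x
  proof -
    have *: "b \<otimes>\<^bsub>?G\<^esub> a [^]\<^bsub>?G\<^esub> i = a [^]\<^bsub>?G\<^esub> ((n - 1) * i) \<otimes>\<^bsub>?G\<^esub> b" for i :: nat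
    proof (induction i)
      case (Suc i)
      have "b \<otimes>\<^bsub>?G\<^esub> a [^]\<^bsub>?G\<^esub> Suc i = (b \<otimes>\<^bsub>?G\<^esub> a [^]\<^bsub>?G\<^esub> i) \<otimes>\<^bsub>?G\<^esub> a" by (simp add: m_assoc)
      also have "\<dots> = a [^]\<^bsub>?G\<^esub> ((n - 1) * i) \<otimes>\<^bsub>?G\<^esub> (b \<otimes>\<^bsub>?G\<^esub> a)" by (simp only: Suc) (simp add: m_assoc)
      also have "\<dots> = (a [^]\<^bsub>?G\<^esub> ((n - 1) * i) \<otimes>\<^bsub>?G\<^esub> a [^]\<^bsub>?G\<^esub> (n - 1)) \<otimes>\<^bsub>?G\<^esub> b" by (simp add: b_a m_assoc)
      also have "a [^]\<^bsub>?G\<^esub> ((n - 1) * i) \<otimes>\<^bsub>?G\<^esub> a [^]\<^bsub>?G\<^esub> (n - 1) = a [^]\<^bsub>?G\<^esub> ((n - 1) * Suc i)"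
        by (simp add: nat_pow_mult add.commute)
      finally show ?case .
    qed simp
    moreover have "b \<otimes>\<^bsub>?G\<^esub> (a [^]\<^bsub>?G\<^esub> i \<otimes>\<^bsub>?G\<^esub> b) = a [^]\<^bsub>?G\<^esub> ((n - 1) * i)" for i :: nat
    proof -
      have "b \<otimes>\<^bsub>?G\<^esub> (a [^]\<^bsub>?G\<^esub> i \<otimes>\<^bsub>?G\<^esub> b) = (b \<otimes>\<^bsub>?G\<^esub> a [^]\<^bsub>?G\<^esub> i) \<otimes>\<^bsub>?G\<^esub> b" by (simp add: m_assoc)
      also have "\<dots> = a [^]\<^bsub>?G\<^esub> ((n - 1) * i)" unfolding * by (simp add: m_assoc b_b)
      finally show ?thesis .
    qed
    ultimately show ?thesis using \<open>x \<in> S\<close> unfolding S_def by blast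
  qed
  have S_pow: "a [^]\<^bsub>?G\<^esub> i \<otimes>\<^bsub>?G\<^esub> x \<in> S" if "x \<in> S" for x and i :: nat
  proof (induction i)
    case 0
    have "S \<subseteq> carrier ?G" by (auto simp: S_def)
    then show ?case using \<open>x \<in> S\<close> by auto
  next
    case (Suc i)
    have "x \<in> carrier ?G" using \<open>x \<in> S\<close> by (auto simp: S_def)
    then have "a [^]\<^bsub>?G\<^esub> Suc i \<otimes>\<^bsub>?G\<^esub> x = a \<otimes>\<^bsub>?G\<^esub> (a [^]\<^bsub>?G\<^esub> i \<otimes>\<^bsub>?G\<^esub> x)"
      unfolding nat_pow_Suc2[OF a_closed] by (simp add: m_assoc)
    then show ?case using S_a[OF Suc] by simp
  qed
  have inverse_letter: "cls [(z, False)] = y"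
    if "cls [(z, True)] \<otimes>\<^bsub>?G\<^esub> y = \<one>\<^bsub>?G\<^esub>" "y \<in> carrier ?G" for z y
  proof -
    have "cls [(z, True)] \<otimes>\<^bsub>?G\<^esub> cls [(z, False)] = \<one>\<^bsub>?G\<^esub>"
      using word_eq.cancel[of ?R "[]" z True "[]"] by (simp add: mult one cls_eq)
    then show ?thesis using that cls_closed by (metis Units_l_cancel Units_eq)
  qed
  have letter: "cls [(z, e)] \<otimes>\<^bsub>?G\<^esub> x \<in> S" if x: "x \<in> S" for z e x
  proof (cases z)
    case a
    have "cls [(z, False)] = a [^]\<^bsub>?G\<^esub> (n - 1)"
      by (rule inverse_letter) (use a a_inv in \<open>simp_all add: a_def cls_closed\<close>)
    then show ?thesis using S_a[OF x] S_pow[OF x] a by (cases e) (auto simp: a_def)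
  next
    case b
    have "cls [(z, False)] = b"
      by (rule inverse_letter) (use b b_b in \<open>simp_all add: b_def cls_closed\<close>)
    then show ?thesis using S_b[OF x] b by (cases e) (auto simp: b_def)
  qed
  have "cls w \<in> S" for w
  proof (induction w)
    case Nil
    have "a [^]\<^bsub>?G\<^esub> (0::nat) \<in> S" unfolding S_def by blast
    then show ?case by (simp add: one)
  next
    case (Cons l w)
    then have "cls [(fst l, snd l)] \<otimes>\<^bsub>?G\<^esub> cls w \<in> S" by (rule letter)
    then show ?case by (simp add: mult)
  qed
  then have carrier_S: "carrier ?G \<subseteq> S" by (auto simp: carrier)
  have carrier_eq: "carrier ?G = (\<lambda>i. a [^]\<^bsub>?G\<^esub> i) ` {..<n} \<union> (\<lambda>i. a [^]\<^bsub>?G\<^esub> i \<otimes>\<^bsub>?G\<^esub> b) ` {..<n}"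
  proof
    show "carrier ?G \<subseteq> (\<lambda>i. a [^]\<^bsub>?G\<^esub> i) ` {..<n} \<union> (\<lambda>i. a [^]\<^bsub>?G\<^esub> i \<otimes>\<^bsub>?G\<^esub> b) ` {..<n}"
    proof
      fix x assume "x \<in> carrier ?G"
      then have "x \<in> S" using carrier_S by blast
      then obtain i :: nat where "x = a [^]\<^bsub>?G\<^esub> i \<or> x = a [^]\<^bsub>?G\<^esub> i \<otimes>\<^bsub>?G\<^esub> b" unfolding S_def by blast
      then have "x = a [^]\<^bsub>?G\<^esub> (i mod n) \<or> x = a [^]\<^bsub>?G\<^esub> (i mod n) \<otimes>\<^bsub>?G\<^esub> b" using nat_pow_mod_order[OF a_closed a_order, of i] by simp
      moreover have "i mod n \<in> {..<n}" using n by simp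
      ultimately show "x \<in> (\<lambda>i. a [^]\<^bsub>?G\<^esub> i) ` {..<n} \<union> (\<lambda>i. a [^]\<^bsub>?G\<^esub> i \<otimes>\<^bsub>?G\<^esub> b) ` {..<n}" by blast
    qed
  qed auto
  have inj: "inj_on (\<lambda>i. a [^]\<^bsub>?G\<^esub> i) {..<n}"
  proof (rule inj_onI)
    fix i j assume ij: "i \<in> {..<n}" "j \<in> {..<n}" "a [^]\<^bsub>?G\<^esub> i = a [^]\<^bsub>?G\<^esub> j"
    then have "cong_act n (int i, False) (int j, False)"
      using word_eq_cong_act[of n "replicate i (dihedral_gen.a, True)" "replicate j (dihedral_gen.a, True)" "(0, False)"]
      by (simp add: power cls_eq word_act_replicate)
    then have "int i mod int n = int j mod int n" by (simp add: cong_act_def mod_eq_dvd_iff)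
    then show "i = j" using ij by simp
  qed
  have disjoint: "a [^]\<^bsub>?G\<^esub> i \<noteq> a [^]\<^bsub>?G\<^esub> j \<otimes>\<^bsub>?G\<^esub> b" for i j :: nat
  proof
    assume "a [^]\<^bsub>?G\<^esub> i = a [^]\<^bsub>?G\<^esub> j \<otimes>\<^bsub>?G\<^esub> b"
    then have "word_eq ?R (replicate i (dihedral_gen.a, True)) (replicate j (dihedral_gen.a, True) @ [(dihedral_gen.b, True)])"
      by (simp add: power b_def mult cls_eq)
    moreover have "word_act [(dihedral_gen.b, True)] (0, False) = (0, True)" by (simp add: word_act_def)
    ultimately show False
      using word_eq_cong_act[of n _ _ "(0, False)"]
      by (fastforce simp: word_act_append word_act_replicate cong_act_def)
  qed
  have "finite (carrier ?G)" unfolding carrier_eq by simp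
  then have "dihedral_generators ?G a b n"
    by (intro dihedral_generators.intro finite_group.intro finite_group_axioms.intro dihedral_generators_axioms.intro
        is_group n a_closed b_closed a_order b_b b_a carrier_eq inj disjoint)
  then show ?thesis by blast
qed

text \<open>The exponent \<open>t\<close> enters through its parity, which decides whether \<open>-1\<close> is a root.\<close>
lemma involutive_unity_roots:
  assumes "odd CHAR('k::field)"
  shows "card {\<zeta> :: 'k. \<zeta> ^ t = 1 \<and> \<zeta> ^ 2 = 1} = (if even t then 2 else 1)"
proof -
  have "(1 :: 'k) \<noteq> -1"
  proof
    assume "(1 :: 'k) = -1"
    then have "(of_nat 2 :: 'k) = 0" by (simp add: eq_neg_iff_add_eq_0)
    then have "CHAR('k) dvd 2" by (simp only: of_nat_eq_0_iff_char_dvd)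
    moreover have "CHAR('k) \<noteq> 1" by simp
    ultimately have "CHAR('k) = 2" using two_is_prime_nat by (metis prime_nat_iff)
    with assms show False by simp
  qed
  moreover have "{\<zeta> :: 'k. \<zeta> ^ t = 1 \<and> \<zeta> ^ 2 = 1} = (if even t then {1, -1} else {1})"
    using \<open>1 \<noteq> -1\<close> by (auto simp: power2_eq_1_iff)
  ultimately show ?thesis by simp
qed

theorem theorem3p5:
  fixes p s t n :: nat
  assumes "CHAR('k::alg_closed_field) = p" and "odd p"
    and "s \<ge> 1" and "\<not> p dvd t" and "n = p ^ s * t"
  shows "let D = dihedral_group n;
             kD = (group_algebra D :: (dihedral_gen group_word set \<Rightarrow> 'k) ring);
             \<eta> = group_algebra_of_field D
         in finite_representation_type \<eta> kD \<and>
            (odd n \<longrightarrow> real (card (indecomposable_classes \<eta> kD)) = (real t + 3) / 2 * real (p ^ s)) \<and>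
            (even n \<longrightarrow> real (card (indecomposable_classes \<eta> kD)) = (real t + 6) / 2 * real (p ^ s))"
proof -
  let ?D = "dihedral_group n"
  let ?kD = "group_algebra ?D :: (dihedral_gen group_word set \<Rightarrow> 'k) ring"
  let ?\<eta> = "group_algebra_of_field ?D :: 'k \<Rightarrow> dihedral_gen group_word set \<Rightarrow> 'k"
  have "t > 0" using assms(4) by (cases t) auto
  moreover have "p > 0" using assms(2) by (cases p) auto
  ultimately have "n > 0" using assms(5) by simp
  then obtain a b where "dihedral_generators ?D a b n" using dihedral_generators_dihedral_group by blast
  then have "free_dihedral_algebra ?kD ?\<eta> (single 1 a) (single 1 b) s t (CHAR('k) ^ s) n"
    by (rule dihedral_generators.free_dihedral_algebra_group_algebra) (use assms in auto)
  then have fin: "finite (indecomposable_classes ?\<eta> ?kD)"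
    and card: "2 * card (indecomposable_classes ?\<eta> ?kD) =
      (t + 3 * card {\<zeta> :: 'k. \<zeta> ^ t = 1 \<and> \<zeta> ^ 2 = 1}) * CHAR('k) ^ s"
    by (rule free_dihedral_algebra.card_indecomposable_classes)+
  have "real (2 * card (indecomposable_classes ?\<eta> ?kD)) =
      real ((t + (if even t then 6 else 3)) * p ^ s)"
    unfolding card using assms(1,2) by (simp add: involutive_unity_roots)
  moreover have "even n \<longleftrightarrow> even t" using assms(2,5) by simp
  ultimately have "odd n \<longrightarrow> real (card (indecomposable_classes ?\<eta> ?kD)) = (real t + 3) / 2 * real (p ^ s)"
    and "even n \<longrightarrow> real (card (indecomposable_classes ?\<eta> ?kD)) = (real t + 6) / 2 * real (p ^ s)"
    by auto
  with fin show ?thesis by (simp add: Let_def finite_representation_type_def)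
qed

end
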